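(* Let $\mathscr{E}_*$, $\mathscr{E}$ and $H$ be complex Hilbert spaces, let $T\in L(H)^d$ be a pure $K$-contraction, and let $B\in L(\mathscr{E}_*,H^d)$, $C\in L(H,\mathscr{E})$, $D\in L(\mathscr{E}_*,\mathscr{E})$ be operators such that the matrix operator $$\begin{pmatrix} T^* & B\\ C& D\end{pmatrix}\colon H\oplus\mathscr{E}_*\to H^d\oplus\mathscr{E}$$ satisfies the conditions (K1) $C^*C=\frac1K(T)$, (K2) $D^*C+B^*(\oplus\Delta_T)T^*=0$, (K3) $D^*D+B^*(\oplus\Delta_T)B=1_{\mathscr{E}_*}$, (K4) $\operatorname{Im}((\oplus j_C)B)\subset M_z^*H_K(\mathscr{E})$. Let $W\colon\mathbb{B}_d\to L(\mathscr{E}_*,\mathscr{E})$ be the function $$W(z)=D+CF(ZT^* )ZB\qquad(z\in\mathbb{B}_d).$$ Then $W$ is a $K$-inner function.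
   Context: Kernel and function spaces. Let $d\ge 1$, let $\mathbb{B}_d$ be the open Euclidean unit ball of $\mathbb{C}^d$ and $\mathbb{D}$ the open unit disc. Let $k\colon\mathbb{D}\to\mathbb{C}$, $k(z)=\sum_{n=0}^\infty a_nz^n$, be an analytic function without zeros such that $a_0=1$, $a_n>0$ for all $n$ and $0<\inf_n \frac{a_n}{a_{n+1}}\le\sup_n\frac{a_n}{a_{n+1}}<\infty$. Assume moreover that the limit $r=\lim_{n\to\infty}\frac{a_n}{a_{n+1}}$ exists (then $r\in[1,\infty)$ is the radius of convergence of $\sum a_nz^n$). Write $\frac1k(z)=\sum_{n=0}^\infty c_nz^n$ on $\mathbb{D}$ and $K(z,w)=k(\langle z,w\rangle)$ for $z,w\in\mathbb{B}_d$. Set $\gamma_\alpha=|\alpha|!/\alpha!$ for $\alpha\in\mathbb{N}^d$ ($0\in\mathbb N$). For a complex Hilbert space $\mathscr{E}$, $H_K(\mathscr{E})$ is the $\mathscr{E}$-valued functional Hilbert space on $\mathbb{B}_d$ with reproducing kernel $(z,w)\mapsto K(z,w)1_{\mathscr{E}}$; it consists of all $f=\sum_{\alpha\in\mathbb{N}^d}f_\alpha z^\alpha$ ($f_\alpha\in\mathscr{E}$) with $\|f\|^2=\sum_\alpha\frac{\|f_\alpha\|^2}{a_{|\alpha|}\gamma_\alpha}<\infty$. $M_z=(M_{z_1},\dots,M_{z_d})$ is the (bounded) tuple of multiplications by the coordinate functions on $H_K(\mathscr{E})$; it is also regarded as the row operator $M_z\colon H_K(\mathscr{E})^d\to H_K(\mathscr{E})$,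 $(f_i)\mapsto\sum_i z_if_i$, with adjoint the column operator $M_z^*f=(M_{z_i}^*f)_{i=1}^d$. $L(H,G)$ denotes the bounded linear operators from $H$ to $G$. $K$-contractions. For a commuting tuple $T=(T_1,\dots,T_d)\in L(H)^d$ let $\sigma_T(X)=\sum_{i=1}^dT_iXT_i^*$. $T$ is a $K$-contraction if the limit $\frac1K(T)=\text{SOT-}\sum_{n=0}^\infty c_n\sigma_T^n(1_H)$ exists and is a positive operator. It is pure if $\text{SOT-}\lim_{N\to\infty}\big(1_H-\sum_{n=0}^Na_n\sigma_T^n(\frac1K(T))\big)=0$. $T$ is also regarded as the row operator $T\colon H^d\to H$, $(x_i)\mapsto\sum_iT_ix_i$, and $T^*\colon H\to H^d$ denotes the column operator $x\mapsto(T_i^*x)_{i=1}^d$. Operators $\Delta$, $\Delta_T$, $j_C$. On $H_K(\mathscr{E})$ let $\Delta\big(\sum_{n}\sum_{|\alpha|=n}f_\alpha z^\alpha\big)=\sum_{n=0}^\infty\frac{a_{n+1}}{a_n}\sum_{|\alpha|=n}f_\alpha z^\alpha$. For a pure $K$-contraction $T\in L(H)^d$ put $C_T=(\frac1K(T))^{1/2}$, $\mathscr{D}=\overline{\operatorname{Im}C_T}$, let $j\colon H\to H_K(\mathscr{D})$ be the isometry $j(h)=\sum_\alpha a_{|\alpha|}\gamma_\alpha(C_TT^{*\alpha}h)z^\alpha$, and define $\Delta_T=j^*\Delta j\in L(H)$. For any $C\in L(H,\mathscr{E})$ with $C^*C=\frac1K(T)$, $j_C\colon H\to H_K(\mathscr{E})$,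 $j_C(x)=\sum_\alpha a_{|\alpha|}\gamma_\alpha(CT^{*\alpha}x)z^\alpha$, is a well-defined isometry. $\oplus X$ denotes the $d$-fold direct sum of an operator $X$ acting componentwise on $d$-tuples. The function $F(ZT^* )$. Let $F(z)=\sum_{n=0}^\infty a_{n+1}z^n$ on the disc $D_r(0)$. For $z\in\mathbb{B}_d$ let $Z\colon H^d\to H$, $(h_i)\mapsto\sum_iz_ih_i$. Then $ZT^*=\sum_iz_iT_i^*\in L(H)$ has spectrum in $D_r(0)$ and $F(ZT^* )=\sum_{n=0}^\infty a_{n+1}\sum_{|\alpha|=n}\gamma_\alpha T^{*\alpha}z^\alpha\in L(H)$. $K$-inner functions. An operator-valued analytic function $W\colon\mathbb{B}_d\to L(\mathscr{E}_*,\mathscr{E})$ is $K$-inner if the map $\mathscr{E}_*\to H_K(\mathscr{E})$, $x\mapsto Wx$ (with $(Wx)(z)=W(z)x$), is a well-defined isometry and $W\mathscr{E}_*\perp M_z^\alpha(W\mathscr{E}_* )$ for all $\alpha\in\mathbb{N}^d\setminus\{0\}$. *)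

theory Defs
  imports "HOL-Analysis.Analysis"
begin

(* Complex Hilbert spaces.  The real structure of class real_inner is the one underlying
   the complex structure; in particular the norm is sqrt (Re (cinner x x)).  The inner
   product is linear in its first argument. *)

class complex_hilbert = real_inner + complete_space +
  fixes scaleC :: "complex \<Rightarrow> 'a \<Rightarrow> 'a" (infixr "*\<^sub>C" 75)
    and cinner :: "'a \<Rightarrow> 'a \<Rightarrow> complex"
  assumes scaleC_add_right: "u *\<^sub>C (x + y) = u *\<^sub>C x + u *\<^sub>C y"
    and scaleC_add_left: "(u + v) *\<^sub>C x = u *\<^sub>C x + v *\<^sub>C x"
    and scaleC_scaleC: "u *\<^sub>C v *\<^sub>C x = (u * v) *\<^sub>C x"
    and scaleR_eq_scaleC: "t *\<^sub>R x = complex_of_real t *\<^sub>C x"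
    and cinner_add_left: "cinner (x + y) w = cinner x w + cinner y w"
    and cinner_scaleC_left: "cinner (u *\<^sub>C x) y = u * cinner x y"
    and cinner_commute: "cinner x y = cnj (cinner y x)"
    and inner_eq_Re_cinner: "inner x y = Re (cinner x y)"

instantiation complex :: complex_hilbert
begin

definition "u *\<^sub>C (z::complex) = u * z"
definition "cinner z (w::complex) = z * cnj w"

instance
  by standard
    (auto simp: scaleC_complex_def cinner_complex_def algebra_simps scaleR_conv_of_real
      inner_complex_def)

end

instantiation vec :: (complex_hilbert, finite) complex_hilbert
begin

definition "u *\<^sub>C (x :: 'a ^ 'b) = (\<chi> i. u *\<^sub>C (x $ i))"
definition "cinner x (y :: 'a ^ 'b) = (\<Sum>i\<in>UNIV. cinner (x $ i) (y $ i))"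

instance
proof
  fix x y w :: "'a ^ 'b" and u v :: complex and t :: real
  show "u *\<^sub>C (x + y) = u *\<^sub>C x + u *\<^sub>C y"
    and "(u + v) *\<^sub>C x = u *\<^sub>C x + v *\<^sub>C x"
    and "u *\<^sub>C v *\<^sub>C x = (u * v) *\<^sub>C x"
    and "t *\<^sub>R x = complex_of_real t *\<^sub>C x"
    by (simp_all add: scaleC_vec_def vec_eq_iff scaleC_add_right scaleC_add_left
        scaleC_scaleC scaleR_eq_scaleC)
  show "cinner (x + y) w = cinner x w + cinner y w"
    by (simp add: cinner_vec_def cinner_add_left sum.distrib)
  show "cinner (u *\<^sub>C x) y = u * cinner x y"
    by (simp add: cinner_vec_def scaleC_vec_def cinner_scaleC_left sum_distrib_left)
  show "cinner x y = cnj (cinner y x)"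
    unfolding cinner_vec_def cnj_sum by (intro sum.cong refl cinner_commute)
  show "inner x y = Re (cinner x y)"
    by (simp add: cinner_vec_def inner_vec_def inner_eq_Re_cinner)
qed

end

definition bounded_clinear :: "('a::complex_hilbert \<Rightarrow> 'b::complex_hilbert) \<Rightarrow> bool" where
  "bounded_clinear A \<longleftrightarrow> bounded_linear A \<and> (\<forall>u x. A (u *\<^sub>C x) = u *\<^sub>C A x)"

(* Adjoint of A : S -> S' for Hilbert spaces S, S' with inner products ipS, ipS', where S is
   given by its carrier; the carrier of S' does not enter the defining identity. *)
definition adj_on ::
  "'a set \<Rightarrow> ('a \<Rightarrow> 'a \<Rightarrow> complex) \<Rightarrow> ('b \<Rightarrow> 'b \<Rightarrow> complex) \<Rightarrow> ('a \<Rightarrow> 'b) \<Rightarrow> 'b \<Rightarrow> 'a"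
  where "adj_on S ipS ipS' A y = (THE x. x \<in> S \<and> (\<forall>u\<in>S. ipS' (A u) y = ipS u x))"

definition cadjoint :: "('a::complex_hilbert \<Rightarrow> 'b::complex_hilbert) \<Rightarrow> 'b \<Rightarrow> 'a" where
  "cadjoint = adj_on UNIV cinner cinner"

definition positive_op :: "('a::complex_hilbert \<Rightarrow> 'a) \<Rightarrow> bool" where
  "positive_op X \<longleftrightarrow>
     bounded_clinear X \<and> (\<forall>x. Im (cinner (X x) x) = 0 \<and> 0 \<le> Re (cinner (X x) x))"

definition sqrt_op :: "('a::complex_hilbert \<Rightarrow> 'a) \<Rightarrow> 'a \<Rightarrow> 'a" where
  "sqrt_op X = (THE Y. positive_op Y \<and> Y \<circ> Y = X)"

(* Multi-indices are functions 'd => nat on a finite index type, d = CARD('d). *)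

definition mi_abs :: "('d::finite \<Rightarrow> nat) \<Rightarrow> nat" where
  "mi_abs \<alpha> = (\<Sum>i\<in>UNIV. \<alpha> i)"

definition mi_gamma :: "('d::finite \<Rightarrow> nat) \<Rightarrow> real" where
  "mi_gamma \<alpha> = fact (mi_abs \<alpha>) / (\<Prod>i\<in>UNIV. fact (\<alpha> i))"

definition mi_monom :: "complex ^ 'd \<Rightarrow> ('d::finite \<Rightarrow> nat) \<Rightarrow> complex" where
  "mi_monom z \<alpha> = (\<Prod>i\<in>UNIV. (z $ i) ^ \<alpha> i)"

(* The product over i of S i ^ \<alpha> i; the order of the factors is irrelevant for commuting S,
   the only case in which it is used. *)
definition op_pow :: "('d::finite \<Rightarrow> 'a \<Rightarrow> 'a) \<Rightarrow> ('d \<Rightarrow> nat) \<Rightarrow> 'a \<Rightarrow> 'a" where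
  "op_pow S \<alpha> = Finite_Set.fold (\<lambda>i X. (S i ^^ \<alpha> i) \<circ> X) id UNIV"

definition direct_sum_op :: "('a \<Rightarrow> 'b) \<Rightarrow> 'a ^ 'd \<Rightarrow> 'b ^ 'd" where
  "direct_sum_op X v = (\<chi> i. X (v $ i))"

definition col_adj :: "('d::finite \<Rightarrow> 'h::complex_hilbert \<Rightarrow> 'h) \<Rightarrow> 'h \<Rightarrow> 'h ^ 'd" where
  "col_adj T x = (\<chi> i. cadjoint (T i) x)"

(* Functional Hilbert spaces on the ball.  A function on the unit ball is represented by its
   extension by 0 to the whole space.  The parameter a is the coefficient sequence of k. *)

definition on_ball :: "(complex ^ 'd \<Rightarrow> 'e) \<Rightarrow> complex ^ 'd \<Rightarrow> 'e::zero" where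
  "on_ball f z = (if z \<in> ball 0 1 then f z else 0)"

definition power_series_fun ::
  "(('d::finite \<Rightarrow> nat) \<Rightarrow> 'e::complex_hilbert) \<Rightarrow> complex ^ 'd \<Rightarrow> 'e" where
  "power_series_fun f = on_ball (\<lambda>z. \<Sum>\<^sub>\<infinity>\<alpha>. mi_monom z \<alpha> *\<^sub>C f \<alpha>)"

definition hk_weight :: "(nat \<Rightarrow> real) \<Rightarrow> ('d::finite \<Rightarrow> nat) \<Rightarrow> real" where
  "hk_weight a \<alpha> = a (mi_abs \<alpha>) * mi_gamma \<alpha>"

definition hk_coeffs ::
  "(nat \<Rightarrow> real) \<Rightarrow> (('d::finite \<Rightarrow> nat) \<Rightarrow> 'e::complex_hilbert) set" where
  "hk_coeffs a = {f. (\<lambda>\<alpha>. (norm (f \<alpha>))\<^sup>2 / hk_weight a \<alpha>) summable_on UNIV}"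

definition HK :: "(nat \<Rightarrow> real) \<Rightarrow> (complex ^ 'd \<Rightarrow> 'e::complex_hilbert) set" where
  "HK a = power_series_fun ` hk_coeffs a"

definition hk_coeff ::
  "(nat \<Rightarrow> real) \<Rightarrow> (complex ^ 'd \<Rightarrow> 'e::complex_hilbert) \<Rightarrow> ('d::finite \<Rightarrow> nat) \<Rightarrow> 'e" where
  "hk_coeff a f = (THE g. g \<in> hk_coeffs a \<and> power_series_fun g = f)"

definition hk_inner ::
  "(nat \<Rightarrow> real) \<Rightarrow> (complex ^ 'd \<Rightarrow> 'e::complex_hilbert) \<Rightarrow> (complex ^ 'd::finite \<Rightarrow> 'e) \<Rightarrow> complex"
  where "hk_inner a f g =
    (\<Sum>\<^sub>\<infinity>\<alpha>. cinner (hk_coeff a f \<alpha>) (hk_coeff a g \<alpha>) / complex_of_real (hk_weight a \<alpha>))"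

definition hk_norm ::
  "(nat \<Rightarrow> real) \<Rightarrow> (complex ^ 'd::finite \<Rightarrow> 'e::complex_hilbert) \<Rightarrow> real" where
  "hk_norm a f = sqrt (\<Sum>\<^sub>\<infinity>\<alpha>. (norm (hk_coeff a f \<alpha>))\<^sup>2 / hk_weight a \<alpha>)"

definition Mz :: "'d::finite \<Rightarrow> (complex ^ 'd \<Rightarrow> 'e::complex_hilbert) \<Rightarrow> complex ^ 'd \<Rightarrow> 'e" where
  "Mz i f = (\<lambda>z. (z $ i) *\<^sub>C f z)"

definition Mz_pow ::
  "('d::finite \<Rightarrow> nat) \<Rightarrow> (complex ^ 'd \<Rightarrow> 'e::complex_hilbert) \<Rightarrow> complex ^ 'd \<Rightarrow> 'e" where
  "Mz_pow \<alpha> = op_pow Mz \<alpha>"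

definition Mz_col_adj ::
  "(nat \<Rightarrow> real) \<Rightarrow> (complex ^ 'd::finite \<Rightarrow> 'e::complex_hilbert) \<Rightarrow> (complex ^ 'd \<Rightarrow> 'e) ^ 'd" where
  "Mz_col_adj a f = (\<chi> i. adj_on (HK a) (hk_inner a) (hk_inner a) (Mz i) f)"

definition hk_Delta ::
  "(nat \<Rightarrow> real) \<Rightarrow> (complex ^ 'd::finite \<Rightarrow> 'e::complex_hilbert) \<Rightarrow> complex ^ 'd \<Rightarrow> 'e" where
  "hk_Delta a f = power_series_fun
     (\<lambda>\<alpha>. complex_of_real (a (Suc (mi_abs \<alpha>)) / a (mi_abs \<alpha>)) *\<^sub>C hk_coeff a f \<alpha>)"

(* K-contractions.  The parameter c is the coefficient sequence of 1/k; limits in the strong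
   operator topology are pointwise limits. *)

definition sigma_op ::
  "('d::finite \<Rightarrow> 'h::complex_hilbert \<Rightarrow> 'h) \<Rightarrow> ('h \<Rightarrow> 'h) \<Rightarrow> 'h \<Rightarrow> 'h" where
  "sigma_op T X = (\<lambda>x. \<Sum>i\<in>UNIV. T i (X (cadjoint (T i) x)))"

definition inv_K ::
  "(nat \<Rightarrow> complex) \<Rightarrow> ('d::finite \<Rightarrow> 'h::complex_hilbert \<Rightarrow> 'h) \<Rightarrow> 'h \<Rightarrow> 'h" where
  "inv_K c T x = (\<Sum>n. c n *\<^sub>C (sigma_op T ^^ n) id x)"

definition K_contraction ::
  "(nat \<Rightarrow> complex) \<Rightarrow> ('d::finite \<Rightarrow> 'h::complex_hilbert \<Rightarrow> 'h) \<Rightarrow> bool" where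
  "K_contraction c T \<longleftrightarrow>
     (\<forall>i. bounded_clinear (T i)) \<and> (\<forall>i j. T i \<circ> T j = T j \<circ> T i) \<and>
     (\<forall>x. summable (\<lambda>n. c n *\<^sub>C (sigma_op T ^^ n) id x)) \<and> positive_op (inv_K c T)"

definition pure_K_contraction ::
  "(nat \<Rightarrow> real) \<Rightarrow> (nat \<Rightarrow> complex) \<Rightarrow> ('d::finite \<Rightarrow> 'h::complex_hilbert \<Rightarrow> 'h) \<Rightarrow> bool" where
  "pure_K_contraction a c T \<longleftrightarrow> K_contraction c T \<and>
     (\<forall>x. (\<lambda>N. x - (\<Sum>n\<le>N. a n *\<^sub>R (sigma_op T ^^ n) (inv_K c T) x)) \<longlonglongrightarrow> 0)"

definition j_map ::
  "(nat \<Rightarrow> real) \<Rightarrow> ('d::finite \<Rightarrow> 'h::complex_hilbert \<Rightarrow> 'h) \<Rightarrow> ('h \<Rightarrow> 'e::complex_hilbert)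
     \<Rightarrow> 'h \<Rightarrow> complex ^ 'd \<Rightarrow> 'e" where
  "j_map a T C x = power_series_fun
     (\<lambda>\<alpha>. complex_of_real (hk_weight a \<alpha>) *\<^sub>C C (op_pow (\<lambda>i. cadjoint (T i)) \<alpha> x))"

(* Delta_T = j* Delta j.  The functions j h take values in the closure of the range of the
   square root, a closed subspace of 'h, and j is regarded as a map into the H_K-space over
   'h, which contains the one over that subspace isometrically and Delta-invariantly. *)
definition Delta_T ::
  "(nat \<Rightarrow> real) \<Rightarrow> (nat \<Rightarrow> complex) \<Rightarrow> ('d::finite \<Rightarrow> 'h::complex_hilbert \<Rightarrow> 'h) \<Rightarrow> 'h \<Rightarrow> 'h" where
  "Delta_T a c T =
     (let j = j_map a T (sqrt_op (inv_K c T))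
      in adj_on UNIV cinner (hk_inner a) j \<circ> hk_Delta a \<circ> j)"

definition row_Z :: "complex ^ 'd \<Rightarrow> 'h ^ 'd \<Rightarrow> 'h::complex_hilbert" where
  "row_Z z v = (\<Sum>i\<in>UNIV. (z $ i) *\<^sub>C (v $ i))"

(* f(A) for the power series f with coefficients b; the series converges in operator norm
   if the spectrum of A lies in the open disc of convergence. *)
definition op_series ::
  "(nat \<Rightarrow> real) \<Rightarrow> ('h::complex_hilbert \<Rightarrow> 'h) \<Rightarrow> 'h \<Rightarrow> 'h" where
  "op_series b A = blinfun_apply (\<Sum>n. b n *\<^sub>R Blinfun (A ^^ n))"

(* Complex Frechet differentiability with respect to the operator norm. *)
definition op_analytic_on_ball ::
  "(complex ^ 'd \<Rightarrow> 'f::complex_hilbert \<Rightarrow> 'e::complex_hilbert) \<Rightarrow> bool" where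
  "op_analytic_on_ball W \<longleftrightarrow>
     (\<forall>z\<in>ball 0 1. bounded_clinear (W z)) \<and>
     (\<forall>z\<in>ball 0 1. \<exists>W'. ((\<lambda>z. Blinfun (W z)) has_derivative W') (at z) \<and>
        (\<forall>u v x. blinfun_apply (W' (u *\<^sub>C v)) x = u *\<^sub>C blinfun_apply (W' v) x))"

definition K_inner ::
  "(nat \<Rightarrow> real) \<Rightarrow> (complex ^ 'd::finite \<Rightarrow> 'f::complex_hilbert \<Rightarrow> 'e::complex_hilbert) \<Rightarrow> bool" where
  "K_inner a W \<longleftrightarrow> op_analytic_on_ball W \<and>
     (let ev = (\<lambda>x. on_ball (\<lambda>z. W z x)) in
       (\<forall>x. ev x \<in> HK a \<and> hk_norm a (ev x) = norm x) \<and>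
       (\<forall>\<alpha>. \<alpha> \<noteq> (\<lambda>_. 0) \<longrightarrow> (\<forall>x y. hk_inner a (ev x) (Mz_pow \<alpha> (ev y)) = 0)))"

end

(* By (K4) there is, for each y, a function f in H_K(E) with M_z* f = (j_C (B y)_i)_i.  Comparing
   coefficients, f_(alpha + e_i) = a_|alpha + e_i| gamma_(alpha + e_i) C T*^alpha (B y)_i, and Pascal's
   rule for the gamma_alpha shows that the Taylor coefficients of W y are those of f, except that the
   constant one is D y.  Since <u, Delta_T x> is the sum of a_(|alpha| + 1) gamma_alpha
   <C T*^alpha u, C T*^alpha x>, the same rule turns <W y, W x> and <W y, z^alpha W x> into
   <y, D* v + B* (+Delta_T) k> with (v, k) = (D x, B x) and (v, k) = (C h, T* h), so (K3) and
   (K2) give the claim.  Purity yields sigma_T^n(1) <= sup_k a_k / a_(k+n), so that the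
   power series of F at ZT* converges locally uniformly in operator norm. *)

theory Submission
  imports Defs
begin

text \<open>Adjoints, square roots and coefficient families are all given by definite descriptions,
  so none of them can be computed before existence and uniqueness are known. This is the source of
  the preliminary parts: Riesz representation for adjoints, the binomial series of sqrt(1 - x) for
  square roots of positive operators, and an identity theorem for power series in d variables for
  the coefficients of elements of \<open>HK\<close>. In the statement the square root of (1/K)(T)
  occurs only inside \<open>Delta_T\<close>, and there only through inner products <C0 x, C0 y> =
  <(1/K)(T) x, y>. By (K1) these equal <C x, C y>, so the abstract root can be exchanged for the
  given C; this connects (K2) and (K3) with the coefficients of W y. The adjoint of M_z kills
  constants, so (K4) leaves the constant coefficient free and D y can be put there. The spectrum of
  ZT* is never touched: the explicit bounds on its powers also majorize the differentiated series,
  which gives analyticity.\<close>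

instance complex_hilbert \<subseteq> banach ..

subsection \<open>Complex Hilbert spaces\<close>

lemma cinner_add_right: "cinner x (y + z) = cinner x y + cinner x (z::'a::complex_hilbert)"
  by (metis cinner_add_left cinner_commute complex_cnj_add)

lemma cinner_scaleC_right: "cinner x (u *\<^sub>C y) = cnj u * cinner x (y::'a::complex_hilbert)"
  by (metis cinner_commute cinner_scaleC_left complex_cnj_mult)

lemma scaleC_one [simp]: "1 *\<^sub>C (x::'a::complex_hilbert) = x"
  by (metis of_real_1 scaleR_eq_scaleC scaleR_one)

lemma cinner_self: "cinner x x = complex_of_real ((norm (x::'a::complex_hilbert))\<^sup>2)"
proof -
  have "cnj (cinner x x) = cinner x x"
    by (metis cinner_commute)
  then have "Im (cinner x x) = 0"
    by (simp add: complex_eq_iff)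
  moreover have "Re (cinner x x) = (norm x)\<^sup>2"
    by (metis inner_eq_Re_cinner power2_norm_eq_inner)
  ultimately show ?thesis
    by (simp add: complex_eq_iff)
qed

lemma norm_scaleC: "norm (u *\<^sub>C (x::'a::complex_hilbert)) = norm u * norm x"
proof -
  have "complex_of_real ((norm (u *\<^sub>C x))\<^sup>2) = (u * cnj u) * complex_of_real ((norm x)\<^sup>2)"
    unfolding cinner_self[symmetric] by (simp add: cinner_scaleC_left cinner_scaleC_right)
  also have "\<dots> = complex_of_real ((norm u * norm x)\<^sup>2)"
    by (simp only: complex_norm_square[symmetric] of_real_mult power_mult_distrib)
  finally have "(norm (u *\<^sub>C x))\<^sup>2 = (norm u * norm x)\<^sup>2"
    using of_real_eq_iff by blast
  then show ?thesis
    by (simp add: power2_eq_iff_nonneg)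
qed

text \<open>Rotating x by a unimodular scalar turns the inner product into its modulus, which
  reduces the claim to the real Cauchy-Schwarz inequality.\<close>

lemma norm_cinner_le: "norm (cinner x y) \<le> norm x * norm (y::'a::complex_hilbert)"
proof (cases "cinner x y = 0")
  case False
  define p where "p = cinner x y"
  define u where "u = cnj p / complex_of_real (norm p)"
  have p: "p \<noteq> 0" using False p_def by simp
  have u: "norm u = 1"
    using p by (simp add: u_def norm_divide)
  have "cinner (u *\<^sub>C x) y = (p * cnj p) / complex_of_real (norm p)"
    by (simp add: u_def cinner_scaleC_left p_def)
  also have "\<dots> = complex_of_real (norm p)"
    using p by (simp add: complex_norm_square[symmetric] power2_eq_square)
  finally have "norm p = inner (u *\<^sub>C x) y"
    by (simp add: inner_eq_Re_cinner)
  also have "\<dots> \<le> norm (u *\<^sub>C x) * norm y"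
    by (rule norm_cauchy_schwarz)
  finally show ?thesis
    by (simp add: norm_scaleC u p_def)
qed auto

interpretation scaleC: bounded_bilinear "scaleC :: complex \<Rightarrow> 'a::complex_hilbert \<Rightarrow> 'a"
proof
  show "\<exists>K. \<forall>a b. norm (a *\<^sub>C (b::'a)) \<le> norm a * norm b * K"
    by (intro exI[of _ 1]) (simp add: norm_scaleC)
qed (simp_all add: scaleC_add_left scaleC_add_right scaleR_eq_scaleC scaleC_scaleC
    scaleC_complex_def mult.commute)

text \<open>\<open>cinner\<close> is conjugate linear in its second argument, but real bilinear,
  which is what \<open>bounded_bilinear\<close> asks for. The two interpretations supply the rules
  for sums, limits and series.\<close>

interpretation cinner: bounded_bilinear "cinner :: 'a::complex_hilbert \<Rightarrow> 'a \<Rightarrow> complex"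
proof
  show "\<exists>K. \<forall>a b. norm (cinner a (b::'a)) \<le> norm a * norm b * K"
    by (intro exI[of _ 1]) (simp add: norm_cinner_le)
qed (simp_all add: cinner_add_left cinner_add_right scaleR_eq_scaleC cinner_scaleC_left
    cinner_scaleC_right scaleC_complex_def)

lemma cinner_ext:
  assumes "\<And>u. cinner u x = cinner u (y::'a::complex_hilbert)"
  shows "x = y"
proof -
  have "cinner (x - y) (x - y) = 0"
    using assms[of "x - y"] by (simp add: cinner.diff_right)
  then show ?thesis
    by (simp add: cinner_self)
qed

section \<open>Bounded complex linear operators\<close>

lemma bounded_clinearD:
  assumes "bounded_clinear A"
  shows "bounded_linear A" "A (u *\<^sub>C x) = u *\<^sub>C A x"
  using assms by (simp_all add: bounded_clinear_def)

lemma bounded_clinearI: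
  assumes "\<And>x y. A (x + y) = A x + A y" "\<And>u x. A (u *\<^sub>C x) = u *\<^sub>C A x"
    and "\<And>x. norm (A x) \<le> norm x * K"
  shows "bounded_clinear A"
  unfolding bounded_clinear_def
proof (intro conjI allI assms(2))
  show "bounded_linear A"
    by (rule bounded_linear_intro[of A K]) (simp_all add: assms scaleR_eq_scaleC)
qed

lemma bounded_clinear_compose:
  "bounded_clinear A \<Longrightarrow> bounded_clinear B \<Longrightarrow> bounded_clinear (\<lambda>x. A (B x))"
  by (simp add: bounded_clinear_def bounded_linear_compose)

lemma bounded_clinear_id: "bounded_clinear (\<lambda>x::'a::complex_hilbert. x)"
  by (simp add: bounded_clinear_def bounded_linear_ident)

lemma bounded_clinear_add:
  "bounded_clinear A \<Longrightarrow> bounded_clinear B \<Longrightarrow> bounded_clinear (\<lambda>x. A x + B x)"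
  by (simp add: bounded_clinear_def bounded_linear_add scaleC_add_right)

lemma bounded_clinear_scaleC:
  "bounded_clinear A \<Longrightarrow> bounded_clinear (\<lambda>x. u *\<^sub>C A x)"
  by (auto simp: bounded_clinear_def scaleC_scaleC mult.commute
      intro: bounded_linear_compose[OF scaleC.bounded_linear_right])

lemma bounded_clinear_sum:
  "(\<And>i. i \<in> I \<Longrightarrow> bounded_clinear (A i)) \<Longrightarrow> bounded_clinear (\<lambda>x. \<Sum>i\<in>I. A i x)"
  by (simp add: bounded_clinear_def bounded_linear_sum scaleC.sum_right)

lemma bounded_clinear_funpow:
  "bounded_clinear A \<Longrightarrow> bounded_clinear ((A :: 'a::complex_hilbert \<Rightarrow> 'a) ^^ n)"
proof (induction n)
  case 0
  show ?case using bounded_clinear_id by (simp add: id_def)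
next
  case (Suc n)
  then show ?case by (simp add: comp_def bounded_clinear_compose)
qed

lemma bounded_clinear_vec_nth: "bounded_clinear (\<lambda>v::'a::complex_hilbert ^ 'd. v $ i)"
  by (simp add: bounded_clinear_def bounded_linear_vec_nth scaleC_vec_def)

section \<open>Riesz representation and adjoints\<close>

lemma minimizing_sequence_Cauchy:
  fixes \<psi> :: "'a::real_inner \<Rightarrow> real" and X :: "nat \<Rightarrow> 'a"
  assumes "bounded_linear \<psi>"
    and m: "\<And>x. m \<le> (norm x)\<^sup>2 - 2 * \<psi> x"
    and X: "\<And>n. (norm (X n))\<^sup>2 - 2 * \<psi> (X n) < m + 1 / real (Suc n)"
  shows "Cauchy X"
proof (rule metric_CauchyI)
  interpret bounded_linear \<psi> by fact
  fix e :: real assume "e > 0"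
  then obtain M where M: "inverse (real (Suc M)) < e\<^sup>2 / 4"
    using reals_Archimedean[of "e\<^sup>2/4"] by auto
  show "\<exists>M. \<forall>p\<ge>M. \<forall>n\<ge>M. dist (X p) (X n) < e"
  proof (intro exI allI impI)
    fix p n assume pn: "M \<le> p" "M \<le> n"
    have le: "1 / real (Suc q) \<le> inverse (real (Suc M))" if "M \<le> q" for q
      using that by (simp add: field_simps)
    then have Xq: "(norm (X q))\<^sup>2 - 2 * \<psi> (X q) < m + e\<^sup>2 / 4" if "M \<le> q" for q
      using M X[of q] that by (meson add_strict_left_mono order.strict_trans order.strict_trans1)
    \<comment> \<open>The parallelogram law. At the midpoint of two almost-minimizers the functional
      is still at least m, which forces them to be close.\<close>
    have par: "(norm (x - y))\<^sup>2 = 2 * (norm x)\<^sup>2 + 2 * (norm y)\<^sup>2 - 4 * (norm ((1/2) *\<^sub>R (x + y)))\<^sup>2"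
      for x y :: 'a
      by (simp add: power2_norm_eq_inner inner_simps inner_commute algebra_simps)
    have "(norm (X p - X n))\<^sup>2 \<le> 2 * ((norm (X p))\<^sup>2 - 2 * \<psi> (X p)) + 2 * ((norm (X n))\<^sup>2 - 2 * \<psi> (X n)) - 4 * m"
      using m[of "(1/2) *\<^sub>R (X p + X n)"] unfolding par by (simp add: scaleR add algebra_simps)
    also have "\<dots> < e\<^sup>2"
      using Xq[OF pn(1)] Xq[OF pn(2)] by simp
    finally show "dist (X p) (X n) < e"
      using \<open>e > 0\<close> by (simp add: dist_norm power_less_imp_less_base)
  qed
qed

text \<open>The representing vector is the minimizer of |x|^2 - 2 psi(x), and the representation is
  the vanishing of the first variation there.\<close>

lemma riesz_real:
  fixes \<psi> :: "'a::{real_inner,complete_space} \<Rightarrow> real"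
  assumes "bounded_linear \<psi>"
  obtains x where "\<And>u. \<psi> u = inner u x"
proof -
  interpret bounded_linear \<psi> by fact
  define J where "J x = (norm x)\<^sup>2 - 2 * \<psi> x" for x
  obtain K where K: "\<And>x. norm (\<psi> x) \<le> norm x * K"
    using bounded by blast
  have "- K\<^sup>2 \<le> J x" for x
  proof -
    have "0 \<le> (norm x - K)\<^sup>2" by simp
    then show ?thesis
      using K[of x] unfolding J_def by (simp add: power2_eq_square algebra_simps abs_if split: if_splits)
  qed
  then have bdd: "bdd_below (range J)" by (auto intro!: bdd_belowI)
  define m where "m = Inf (range J)"
  have m: "m \<le> J x" for x
    unfolding m_def using bdd by (simp add: cInf_lower)
  have "\<exists>x. J x < m + 1 / real (Suc n)" for n
    using cInf_less_iff[OF _ bdd, of "m + 1 / real (Suc n)"] unfolding m_def by auto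
  then obtain X where X: "\<And>n. J (X n) < m + 1 / real (Suc n)" by metis
  have "Cauchy X"
    using minimizing_sequence_Cauchy[OF assms, of m X] m X unfolding J_def by auto
  then obtain x where x: "X \<longlonglongrightarrow> x"
    using Cauchy_convergent_iff convergent_def by blast
  have lim: "(\<lambda>n. J (X n)) \<longlonglongrightarrow> J x"
    unfolding J_def by (intro tendsto_intros tendsto x)
  have "(\<lambda>n. m + 1 / real (Suc n)) \<longlonglongrightarrow> m + 0"
    by (intro tendsto_intros LIMSEQ_inverse_real_of_nat[unfolded inverse_eq_divide])
  then have "J x \<le> m + 0"
    using LIMSEQ_le[OF lim] X less_imp_le by blast
  then have min: "J x \<le> J y" for y
    using m[of y] by simp
  have "\<psi> u = inner u x" for u
  proof (rule ccontr)
    assume ne: "\<psi> u \<noteq> inner u x"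
    define d where "d = \<psi> u - inner u x"
    have u: "u \<noteq> 0" using ne zero by auto
    \<comment> \<open>The minimizer of the quadratic polynomial J(x + t u) in t; it lowers J by d^2
      / |u|^2.\<close>
    define t where "t = d / (norm u)\<^sup>2"
    have "(norm (x + t *\<^sub>R u))\<^sup>2 = (norm x)\<^sup>2 + 2 * t * inner u x + t\<^sup>2 * (norm u)\<^sup>2"
      unfolding power2_norm_eq_inner
      by (simp add: inner_simps inner_commute algebra_simps power2_eq_square)
    then have "J (x + t *\<^sub>R u) = J x - 2 * t * d + t\<^sup>2 * (norm u)\<^sup>2"
      by (simp add: J_def d_def add scaleR algebra_simps)
    also have "\<dots> = J x - d\<^sup>2 / (norm u)\<^sup>2"
      using u by (simp add: t_def field_simps power2_eq_square)
    finally have "J (x + t *\<^sub>R u) < J x"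
      using ne u by (simp add: d_def)
    then show False using min[of "x + t *\<^sub>R u"] by simp
  qed
  then show ?thesis using that by blast
qed

text \<open>A complex linear functional is determined by its real part, since the real part of phi(i
  u) is minus the imaginary part of phi(u).\<close>

lemma riesz:
  fixes \<phi> :: "'a::complex_hilbert \<Rightarrow> complex"
  assumes "bounded_clinear \<phi>"
  obtains x where "\<And>u. \<phi> u = cinner u x"
proof -
  have "bounded_linear (\<lambda>u. Re (\<phi> u))"
    using bounded_clinearD(1)[OF assms] by (rule bounded_linear_compose[OF bounded_linear_Re])
  then obtain x where x: "\<And>u. Re (\<phi> u) = inner u x"
    using riesz_real by blast
  have "\<phi> u = cinner u x" for u
  proof (rule complex_eqI)
    show "Re (\<phi> u) = Re (cinner u x)"
      using x[of u] inner_eq_Re_cinner[of u x] by (rule trans)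
    have "Re (\<phi> (\<i> *\<^sub>C u)) = Re (cinner (\<i> *\<^sub>C u) x)"
      using x[of "\<i> *\<^sub>C u"] inner_eq_Re_cinner[of "\<i> *\<^sub>C u" x] by (rule trans)
    then have "Re (\<i> * \<phi> u) = Re (\<i> * cinner u x)"
      by (simp only: bounded_clinearD(2)[OF assms] cinner_scaleC_left scaleC_complex_def)
    then show "Im (\<phi> u) = Im (cinner u x)"
      unfolding times_complex.simps by simp
  qed
  then show ?thesis using that by blast
qed

text \<open>Uniqueness is a premise because two kinds of inner product are served: for
  \<open>cinner\<close> it is \<open>cinner_ext\<close>, for \<open>hk_inner\<close> on
  \<open>HK\<close> it is \<open>hk_inner_nondegenerate\<close>.\<close>

lemma adj_on_eqI:
  assumes "x \<in> S" "\<And>u. u \<in> S \<Longrightarrow> ipS' (A u) y = ipS u x"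
    and "\<And>x'. x' \<in> S \<Longrightarrow> (\<And>u. u \<in> S \<Longrightarrow> ipS u x' = ipS u x) \<Longrightarrow> x' = x"
  shows "adj_on S ipS ipS' A y = x"
  unfolding adj_on_def
proof (rule the_equality)
  show "x \<in> S \<and> (\<forall>u\<in>S. ipS' (A u) y = ipS u x)"
    using assms(1,2) by blast
  fix x' assume x': "x' \<in> S \<and> (\<forall>u\<in>S. ipS' (A u) y = ipS u x')"
  show "x' = x"
  proof (rule assms(3))
    show "x' \<in> S" using x' by blast
    show "ipS u x' = ipS u x" if "u \<in> S" for u
      using x' assms(2)[OF that] that by metis
  qed
qed

text \<open>Riesz is applied in the domain only, so the target may be a space such as
  \<open>HK\<close> that is a mere set of functions. This is how the adjoint of j is
  obtained.\<close>

lemma adj_on_UNIV: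
  fixes A :: "'a::complex_hilbert \<Rightarrow> 'b"
  assumes "bounded_clinear (\<lambda>u. ip (A u) y)"
  shows "ip (A u) y = cinner u (adj_on UNIV cinner ip A y)"
proof -
  obtain x where x: "\<And>u. ip (A u) y = cinner u x"
    using riesz[OF assms] by blast
  then have "adj_on UNIV cinner ip A y = x"
    by (intro adj_on_eqI) (auto intro: cinner_ext)
  then show ?thesis using x by simp
qed

lemma cinner_cadjoint:
  assumes "bounded_clinear A"
  shows "cinner (A u) y = cinner u (cadjoint A y)"
  unfolding cadjoint_def
proof (rule adj_on_UNIV)
  show "bounded_clinear (\<lambda>u. cinner (A u) y)"
    using bounded_clinearD[OF assms]
    by (auto simp: bounded_clinear_def cinner_scaleC_left scaleC_complex_def
        intro: bounded_linear_compose[OF cinner.bounded_linear_left])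
qed

lemma cinner_cadjoint_left:
  assumes "bounded_clinear A"
  shows "cinner (cadjoint A y) u = cinner y (A u)"
  by (metis assms cinner_cadjoint cinner_commute)

text \<open>With S for the adjoint of A, the bound comes from |S x|^2 = <A S x, x> <= K |S x|
  |x|.\<close>

lemma bounded_clinear_cadjoint:
  assumes "bounded_clinear A"
  shows "bounded_clinear (cadjoint A)"
proof -
  obtain K where K: "K > 0" "\<And>x. norm (A x) \<le> norm x * K"
    using bounded_linear.pos_bounded[OF bounded_clinearD(1)[OF assms]] by blast
  show ?thesis
  proof (rule bounded_clinearI)
    fix x y u
    show "cadjoint A (x + y) = cadjoint A x + cadjoint A y"
      by (rule cinner_ext) (simp add: cinner_cadjoint[OF assms, symmetric] cinner_add_right)
    show "cadjoint A (u *\<^sub>C x) = u *\<^sub>C cadjoint A x"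
      by (rule cinner_ext) (simp add: cinner_cadjoint[OF assms, symmetric] cinner_scaleC_right)
    have "complex_of_real ((norm (cadjoint A x))\<^sup>2) = cinner (A (cadjoint A x)) x"
      unfolding cinner_cadjoint[OF assms] by (rule cinner_self[symmetric])
    from arg_cong[OF this, of norm]
    have "(norm (cadjoint A x))\<^sup>2 = norm (cinner (A (cadjoint A x)) x)"
      unfolding norm_of_real by simp
    also have "\<dots> \<le> norm (cadjoint A x) * K * norm x"
      using norm_cinner_le K(2) by (meson mult_right_mono norm_ge_zero order_trans)
    finally show "norm (cadjoint A x) \<le> norm x * K"
      using K(1) by (cases "cadjoint A x = 0") (simp_all add: power2_eq_square ac_simps)
  qed
qed

lemma cadjoint_commute:
  assumes "bounded_clinear A" "bounded_clinear B" "A \<circ> B = B \<circ> A"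
  shows "cadjoint A \<circ> cadjoint B = cadjoint B \<circ> cadjoint A"
proof
  fix x
  have "cinner u (cadjoint A (cadjoint B x)) = cinner u (cadjoint B (cadjoint A x))" for u
  proof -
    have "cinner u (cadjoint A (cadjoint B x)) = cinner (B (A u)) x"
      by (simp only: cinner_cadjoint[OF assms(1)] cinner_cadjoint[OF assms(2)])
    also have "B (A u) = A (B u)"
      using fun_cong[OF assms(3), of u] by simp
    also have "cinner (A (B u)) x = cinner u (cadjoint B (cadjoint A x))"
      by (simp only: cinner_cadjoint[OF assms(1)] cinner_cadjoint[OF assms(2)])
    finally show ?thesis .
  qed
  then show "(cadjoint A \<circ> cadjoint B) x = (cadjoint B \<circ> cadjoint A) x"
    by (auto intro: cinner_ext)
qed

subsection \<open>Square roots of positive operators\<close>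

text \<open>Polarization: the form is real at x + y and at x + i y, and this compares the imaginary
  and the real parts, respectively, of <X x, y> and <X y, x>.\<close>

lemma positive_op_self_adjoint:
  assumes "positive_op X"
  shows "cinner (X x) y = cinner x (X y)"
proof -
  have lin: "X (u + v) = X u + X v" "X (s *\<^sub>C u) = s *\<^sub>C X u" for u v s
    using assms unfolding positive_op_def bounded_clinear_def
    by (auto dest: bounded_linear.linear linear_add)
  have im: "Im (cinner (X u) u) = 0" for u
    using assms by (simp add: positive_op_def)
  have "Im (cinner (X x) y) + Im (cinner (X y) x) = 0"
    using im[of "x + y"] im[of x] im[of y]
    by (simp add: lin cinner_add_left cinner_add_right)
  moreover have "Re (cinner (X y) x) - Re (cinner (X x) y) = 0"
    using im[of "x + \<i> *\<^sub>C y"] im[of x] im[of y]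
    by (simp add: lin cinner_add_left cinner_add_right cinner_scaleC_left cinner_scaleC_right)
  ultimately have "cinner (X x) y = cnj (cinner (X y) x)"
    by (simp add: complex_eq_iff)
  then show ?thesis
    using cinner_commute by metis
qed

text \<open>The operator inequality X^2 <= K X, obtained by evaluating the nonnegative form of X at
  the vector K x - X x.\<close>

lemma positive_op_norm_square_le:
  assumes X: "positive_op X" and K: "K > 0" "\<And>x. Re (cinner (X x) x) \<le> K * (norm x)\<^sup>2"
  shows "(norm (X x))\<^sup>2 \<le> K * Re (cinner (X x) x)"
proof -
  have lin: "X (u - v) = X u - X v" "X (s *\<^sub>C u) = s *\<^sub>C X u" for u v s
    using X unfolding positive_op_def bounded_clinear_def
    by (auto dest: bounded_linear.linear linear_diff)
  define y where "y = X x"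
  define N where "N = (norm y)\<^sup>2"
  have yy: "cinner y y = complex_of_real N"
    by (simp only: cinner_self N_def)
  have xy: "cinner (X y) x = complex_of_real N"
    using positive_op_self_adjoint[OF X, of y x] yy unfolding y_def by simp
  have "0 \<le> Re (cinner (X (complex_of_real K *\<^sub>C x - y)) (complex_of_real K *\<^sub>C x - y))"
    using X by (simp add: positive_op_def)
  also have "cinner (X (complex_of_real K *\<^sub>C x - y)) (complex_of_real K *\<^sub>C x - y)
      = complex_of_real (K * K) * cinner y x - complex_of_real (2 * K * N) + cinner (X y) y"
    by (simp add: lin cinner.diff_left cinner.diff_right cinner_scaleC_left cinner_scaleC_right
        xy yy y_def[symmetric] algebra_simps)
  finally have "0 \<le> K * K * Re (cinner y x) - 2 * K * N + Re (cinner (X y) y)"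
    by simp
  also have "\<dots> \<le> K * K * Re (cinner y x) - 2 * K * N + K * N"
    using K(2)[of y] by (simp add: N_def)
  also have "\<dots> = K * (K * Re (cinner y x) - N)"
    by (simp add: algebra_simps)
  finally show ?thesis
    using K(1) by (simp add: y_def N_def zero_le_mult_iff)
qed

lemma positive_op_form_bound:
  assumes "positive_op X"
  obtains K where "K > 0" "\<And>x. Re (cinner (X x) x) \<le> K * (norm x)\<^sup>2"
proof -
  obtain K where K: "K > 0" "\<And>x. norm (X x) \<le> norm x * K"
    using bounded_linear.pos_bounded assms unfolding positive_op_def bounded_clinear_def by blast
  have "Re (cinner (X x) x) \<le> K * (norm x)\<^sup>2" for x
  proof -
    have "Re (cinner (X x) x) \<le> norm (X x) * norm x"
      using complex_Re_le_cmod norm_cinner_le order_trans by blast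
    also have "\<dots> \<le> norm x * K * norm x"
      by (intro mult_right_mono K) simp
    finally show ?thesis by (simp add: power2_eq_square ac_simps)
  qed
  with K(1) show ?thesis using that by blast
qed

lemma positive_op_eq_0:
  assumes X: "positive_op X" and "Re (cinner (X x) x) = 0"
  shows "X x = 0"
proof -
  obtain K where "K > 0" "\<And>x. Re (cinner (X x) x) \<le> K * (norm x)\<^sup>2"
    using positive_op_form_bound[OF X] by blast
  then have "(norm (X x))\<^sup>2 \<le> K * Re (cinner (X x) x)"
    by (rule positive_op_norm_square_le[OF X])
  with assms(2) show ?thesis by simp
qed

text \<open>For y = S x - Y x, commutation gives (S + Y) y = S^2 x - Y^2 x = 0. Both forms at y are
  nonnegative and add up to 0, so S y = Y y = 0, and then |y|^2 = <x, S y - Y y> = 0.\<close>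

lemma positive_sqrt_unique:
  assumes S: "positive_op S" "\<And>x. S (S x) = X x" and Y: "positive_op Y" "\<And>x. Y (Y x) = X x"
    and comm: "\<And>x. S (Y x) = Y (S x)"
  shows "S = Y"
proof
  fix x
  have S': "S (u - v) = S u - S v" and Y': "Y (u - v) = Y u - Y v" for u v
    using S(1) Y(1) unfolding positive_op_def bounded_clinear_def
    by (auto dest: bounded_linear.linear linear_diff)
  define y where "y = S x - Y x"
  have SY: "S y + Y y = 0"
    by (simp add: y_def S' Y' S(2) Y(2) comm)
  have "Re (cinner (S y) y) + Re (cinner (Y y) y) = Re (cinner (S y + Y y) y)"
    by (simp only: cinner_add_left plus_complex.sel)
  also have "\<dots> = 0" by (simp add: SY cinner.zero_left)
  finally have sum0: "Re (cinner (S y) y) + Re (cinner (Y y) y) = 0" .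
  have "0 \<le> Re (cinner (S y) y)" "0 \<le> Re (cinner (Y y) y)"
    using S(1) Y(1) unfolding positive_op_def by auto
  then have "Re (cinner (S y) y) = 0" "Re (cinner (Y y) y) = 0"
    using sum0 by linarith+
  then have 0: "S y = 0" "Y y = 0"
    using positive_op_eq_0 S(1) Y(1) by blast+
  have "cinner y y = cinner (S x) y - cinner (Y x) y"
    by (simp add: y_def cinner.diff_left)
  also have "\<dots> = cinner x (S y) - cinner x (Y y)"
    by (simp add: positive_op_self_adjoint S(1) Y(1))
  finally have "cinner y y = 0" by (simp add: 0 cinner.zero_right)
  then show "S x = Y x"
    by (simp add: cinner_self y_def)
qed

(* The Taylor coefficients of sqrt (1 - x) at 0. *)
definition sqrt_coeff :: "nat \<Rightarrow> real" where
  "sqrt_coeff n = pochhammer (-1/2) n / fact n"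

lemma sqrt_coeff_0 [simp]: "sqrt_coeff 0 = 1"
  by (simp add: sqrt_coeff_def)

lemma sqrt_coeff_Suc_nonpos: "sqrt_coeff (Suc n) \<le> 0"
proof -
  have "pochhammer (1/2::real) n \<ge> 0"
    by (intro pochhammer_nonneg) simp
  then show ?thesis
    by (simp add: sqrt_coeff_def pochhammer_rec divide_simps)
qed

text \<open>Partial sums are the coefficients of sqrt(1 - x) / (1 - x) = (1 - x)^(-1/2). Their
  nonnegativity yields both absolute summability and the positivity of the square root.\<close>

lemma sum_sqrt_coeff: "(\<Sum>k\<le>n. sqrt_coeff k) = pochhammer (1/2) n / fact n"
proof (induction n)
  case (Suc n)
  have "sqrt_coeff (Suc n) = - (1/2) * pochhammer (1/2) n / fact (Suc n)"
    by (simp add: sqrt_coeff_def pochhammer_rec)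
  then have "(\<Sum>k\<le>Suc n. sqrt_coeff k) =
      pochhammer (1/2) n / fact n - (1/2) * pochhammer (1/2) n / fact (Suc n)"
    by (simp add: Suc)
  also have "\<dots> = pochhammer (1/2) n * (real (Suc n) - 1/2) / fact (Suc n)"
    by (simp add: divide_simps) (simp add: algebra_simps)
  also have "\<dots> = pochhammer (1/2) (Suc n) / fact (Suc n)"
    by (simp add: pochhammer_Suc)
  finally show ?case .
qed simp

lemma sum_sqrt_coeff_nonneg: "0 \<le> (\<Sum>k\<le>n. sqrt_coeff k)"
  unfolding sum_sqrt_coeff by (intro divide_nonneg_nonneg pochhammer_nonneg) auto

text \<open>Only the coefficient of index 0 is positive, so the absolute partial sums equal 2 minus
  the partial sums.\<close>

lemma summable_abs_sqrt_coeff: "summable (\<lambda>n. \<bar>sqrt_coeff n\<bar>)"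
proof (rule summableI_nonneg_bounded)
  fix n
  show "(\<Sum>k<n. \<bar>sqrt_coeff k\<bar>) \<le> 2"
  proof (cases n)
    case (Suc m)
    have "(\<Sum>k\<le>m. \<bar>sqrt_coeff k\<bar>) = 2 - (\<Sum>k\<le>m. sqrt_coeff k)"
      by (induction m) (use sqrt_coeff_Suc_nonpos in \<open>simp_all add: abs_of_nonpos\<close>)
    then show ?thesis
      using sum_sqrt_coeff_nonneg[of m] by (simp add: Suc lessThan_Suc_atMost)
  qed simp
qed simp

text \<open>The square of sqrt(1 - x) is 1 - x; on coefficients this is the Vandermonde identity for
  1/2 + 1/2 = 1.\<close>

lemma sqrt_coeff_convolution:
  "(\<Sum>i\<le>n. sqrt_coeff i * sqrt_coeff (n - i)) = (if n = 0 then 1 else if n = 1 then -1 else 0)"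
proof -
  have c: "sqrt_coeff i = (-1) ^ i * ((1/2) gchoose i)" for i
    by (simp add: sqrt_coeff_def gbinomial_pochhammer mult.assoc[symmetric] power_add[symmetric]
        power_mult_distrib[symmetric])
  have "(\<Sum>i\<le>n. sqrt_coeff i * sqrt_coeff (n - i))
      = (-1) ^ n * (\<Sum>i\<le>n. ((1/2) gchoose i) * ((1/2) gchoose (n - i)))"
    unfolding sum_distrib_left
  proof (intro sum.cong refl)
    fix i assume "i \<in> {..n}"
    then have "(-1::real) ^ n = (-1) ^ i * (-1) ^ (n - i)"
      by (simp add: power_add[symmetric])
    then show "sqrt_coeff i * sqrt_coeff (n - i)
        = (-1) ^ n * (((1/2) gchoose i) * ((1/2) gchoose (n - i)))"
      by (simp add: c)
  qed
  also have "\<dots> = (-1) ^ n * ((1/2 + 1/2 :: real) gchoose n)"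
    by (simp only: gbinomial_Vandermonde atMost_atLeast0)
  also have "(1/2 + 1/2 :: real) gchoose n = (of_nat (1 choose n))"
    using binomial_gbinomial[of 1 n, where ?'a = real] by simp
  also have "(1 choose n) = (if n \<le> 1 then 1 else 0)"
    by (cases "n = 0"; cases "n = 1") (simp_all add: binomial_eq_0)
  finally show ?thesis by auto
qed

text \<open>A Cauchy product: the absolutely summable double family \<open>g\<close> is summed by
  rows and by antidiagonals. In the application \<open>v n\<close> is N^n x.\<close>

lemma power_series_square:
  fixes v :: "nat \<Rightarrow> 'a::banach"
  assumes b: "summable (\<lambda>n. \<bar>b n\<bar>)" and v: "\<And>n. norm (v n) \<le> M"
  shows "(\<Sum>m. b m *\<^sub>R (\<Sum>n. b n *\<^sub>R v (m + n))) = (\<Sum>k. (\<Sum>i\<le>k. b i * b (k - i)) *\<^sub>R v k)"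
proof -
  define g where "g = (\<lambda>(m, n). (b m * b n) *\<^sub>R v (m + n))"
  have M: "M \<ge> 0" using v[of 0] norm_ge_zero order_trans by blast
  have nn: "(\<lambda>n. \<bar>b n\<bar>) summable_on UNIV"
    using b by (simp add: summable_on_UNIV_nonneg_real_iff)
  have "(\<lambda>(m, n). \<bar>b m\<bar> * \<bar>b n\<bar>) summable_on UNIV \<times> UNIV"
    using nn by (intro summable_on_SigmaI[where g = "\<lambda>m. \<bar>b m\<bar> * (\<Sum>\<^sub>\<infinity>n. \<bar>b n\<bar>)"])
      (auto intro!: has_sum_cmult_right has_sum_infsum summable_on_cmult_left)
  then have "(\<lambda>p. M * (case p of (m, n) \<Rightarrow> \<bar>b m\<bar> * \<bar>b n\<bar>)) summable_on UNIV"
    by (simp add: summable_on_cmult_right)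
  then have "(\<lambda>p. norm (g p)) summable_on UNIV"
  proof (rule summable_on_comparison_test)
    fix p show "norm (g p) \<le> M * (case p of (m, n) \<Rightarrow> \<bar>b m\<bar> * \<bar>b n\<bar>)"
      using v[of "fst p + snd p"]
      by (auto simp: g_def abs_mult mult.commute[of M] split: prod.splits intro!: mult_left_mono)
  qed auto
  then have g: "g summable_on UNIV"
    by (rule abs_summable_summable)
  have sv: "summable (\<lambda>n. norm (b n *\<^sub>R v (m + n)))" for m
    by (rule summable_comparison_test'[OF summable_mult[OF b, of M], of 0])
       (use v in \<open>auto intro!: mult_left_mono simp: mult.commute[of M]\<close>)
  have inner_has: "((\<lambda>n. g (m, n)) has_sum b m *\<^sub>R (\<Sum>n. b n *\<^sub>R v (m + n))) UNIV" for m
  proof -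
    have "((\<lambda>n. b n *\<^sub>R v (m + n)) has_sum (\<Sum>n. b n *\<^sub>R v (m + n))) UNIV"
      by (rule norm_summable_imp_has_sum[OF sv summable_sums[OF summable_norm_cancel[OF sv]]])
    from has_sum_scaleR[OF this, of "b m"] show ?thesis
      by (simp add: g_def)
  qed
  have "(g has_sum infsum g UNIV) (UNIV \<times> UNIV)"
    using has_sum_infsum[OF g] by simp
  then have "((\<lambda>m. b m *\<^sub>R (\<Sum>n. b n *\<^sub>R v (m + n))) has_sum infsum g UNIV) UNIV"
    by (rule has_sum_SigmaD[where f = g]) (use inner_has in auto)
  then have L: "(\<lambda>m. b m *\<^sub>R (\<Sum>n. b n *\<^sub>R v (m + n))) sums infsum g UNIV"
    by (rule has_sum_imp_sums)
  have "(g has_sum infsum g UNIV) UNIV \<longleftrightarrow>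
      ((\<lambda>p. g (case p of (k, i) \<Rightarrow> (i, k - i))) has_sum infsum g UNIV) (SIGMA k:UNIV. {..k})"
    by (rule has_sum_reindex_bij_witness[where i = "\<lambda>(k, i). (i, k - i)" and j = "\<lambda>(m, n). (m + n, m)"])
      auto
  then have "((\<lambda>p. g (case p of (k, i) \<Rightarrow> (i, k - i))) has_sum infsum g UNIV) (SIGMA k:UNIV. {..k})"
    using has_sum_infsum[OF g] by blast
  then have "((\<lambda>k. \<Sum>i\<le>k. g (i, k - i)) has_sum infsum g UNIV) UNIV"
    by (rule has_sum_SigmaD) (auto intro!: has_sum_finiteI)
  then have "(\<lambda>k. \<Sum>i\<le>k. g (i, k - i)) sums infsum g UNIV"
    by (rule has_sum_imp_sums)
  moreover have "(\<Sum>i\<le>k. g (i, k - i)) = (\<Sum>i\<le>k. b i * b (k - i)) *\<^sub>R v k" for k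
    by (simp add: g_def scaleR_sum_left)
  ultimately have "(\<lambda>k. (\<Sum>i\<le>k. b i * b (k - i)) *\<^sub>R v k) sums infsum g UNIV"
    by simp
  with L show ?thesis
    by (simp add: sums_iff)
qed

text \<open>S is the binomial series of sqrt(1 - N). As a limit of polynomials in N it commutes with
  everything that commutes with N; this last claim feeds the commutation premise of
  \<open>positive_sqrt_unique\<close>.\<close>

lemma positive_sqrt_exists_contraction:
  assumes N: "positive_op N" and le: "\<And>x. Re (cinner (N x) x) \<le> (norm x)\<^sup>2"
  obtains S where "positive_op S" "\<And>x. S (S x) = x - N x"
    "\<And>Y x. bounded_linear Y \<Longrightarrow> (\<And>x. Y (N x) = N (Y x)) \<Longrightarrow> Y (S x) = S (Y x)"
proof -
  have bN: "bounded_clinear N" using N by (simp add: positive_op_def)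
  have nN: "norm (N x) \<le> norm x" for x
  proof -
    have "(norm (N x))\<^sup>2 \<le> (norm x)\<^sup>2"
      using positive_op_norm_square_le[OF N, of 1 x] le by (simp add: order_trans)
    then show ?thesis by (simp add: power2_le_iff_abs_le)
  qed
  have nNp: "norm ((N ^^ n) x) \<le> norm x" for n x
    by (induction n) (auto intro: order_trans[OF nN])
  have bNp: "bounded_clinear (N ^^ n)" for n
    by (rule bounded_clinear_funpow[OF bN])
  have saNp: "cinner ((N ^^ n) x) y = cinner x ((N ^^ n) y)" for n x y
    by (induction n arbitrary: x y) (simp_all add: positive_op_self_adjoint[OF N] funpow_swap1)
  define S where "S x = (\<Sum>n. sqrt_coeff n *\<^sub>R (N ^^ n) x)" for x
  have sn: "summable (\<lambda>n. norm (sqrt_coeff n *\<^sub>R (N ^^ n) x))" for x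
    by (rule summable_comparison_test'[OF summable_mult[OF summable_abs_sqrt_coeff, of "norm x"], of 0])
       (use nNp in \<open>auto intro!: mult_left_mono simp: mult.commute[of "norm x"]\<close>)
  have S: "(\<lambda>n. sqrt_coeff n *\<^sub>R (N ^^ n) x) sums S x" for x
    unfolding S_def by (rule summable_sums[OF summable_norm_cancel[OF sn]])
  have bS: "bounded_clinear S"
  proof (rule bounded_clinearI)
    fix x y u
    have "(\<lambda>n. sqrt_coeff n *\<^sub>R (N ^^ n) (x + y)) sums (S x + S y)"
      using sums_add[OF S[of x] S[of y]] bNp
      by (simp add: bounded_clinear_def linear_add bounded_linear.linear scaleR_add_right)
    then show "S (x + y) = S x + S y" using S sums_unique2 by blast
    have "(\<lambda>n. u *\<^sub>C (sqrt_coeff n *\<^sub>R (N ^^ n) x)) sums (u *\<^sub>C S x)"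
      by (rule bounded_linear.sums[OF scaleC.bounded_linear_right S])
    then have "(\<lambda>n. sqrt_coeff n *\<^sub>R (N ^^ n) (u *\<^sub>C x)) sums (u *\<^sub>C S x)"
      using bNp by (simp add: bounded_clinear_def scaleR_eq_scaleC scaleC_scaleC mult.commute)
    then show "S (u *\<^sub>C x) = u *\<^sub>C S x" using S sums_unique2 by blast
    have "norm (S x) \<le> (\<Sum>n. norm (sqrt_coeff n *\<^sub>R (N ^^ n) x))"
      unfolding S_def by (rule summable_norm[OF sn])
    also have "\<dots> \<le> (\<Sum>n. norm x * \<bar>sqrt_coeff n\<bar>)"
      by (rule suminf_le[OF _ sn summable_mult[OF summable_abs_sqrt_coeff]])
        (use nNp in \<open>auto intro!: mult_left_mono simp: mult.commute[of "norm x"]\<close>)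
    also have "\<dots> = norm x * (\<Sum>n. \<bar>sqrt_coeff n\<bar>)"
      by (rule suminf_mult[OF summable_abs_sqrt_coeff])
    finally show "norm (S x) \<le> norm x * (\<Sum>n. \<bar>sqrt_coeff n\<bar>)" .
  qed
  have S_lin: "linear S" using bS by (simp add: bounded_clinear_def bounded_linear.linear)
  have pos: "Im (cinner (S x) x) = 0 \<and> 0 \<le> Re (cinner (S x) x)" for x
  proof
    have sums: "(\<lambda>n. cinner (sqrt_coeff n *\<^sub>R (N ^^ n) x) x) sums cinner (S x) x"
      by (rule bounded_linear.sums[OF cinner.bounded_linear_left S])
    have im: "Im (cinner ((N ^^ n) x) x) = 0" for n
    proof -
      have "cinner ((N ^^ n) x) x = cnj (cinner ((N ^^ n) x) x)"
        using saNp[of n x x] cinner_commute by metis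
      then show ?thesis by (simp add: complex_eq_iff)
    qed
    show "Im (cinner (S x) x) = 0"
      using sums_Im[OF sums] by (simp add: im cinner.scaleR_left sums_iff)
    have re: "(\<lambda>n. sqrt_coeff n * Re (cinner ((N ^^ n) x) x)) sums Re (cinner (S x) x)"
      using sums_Re[OF sums] by (simp add: cinner.scaleR_left)
    have ub: "Re (cinner ((N ^^ n) x) x) \<le> (norm x)\<^sup>2" for n
    proof -
      have "Re (cinner ((N ^^ n) x) x) \<le> norm ((N ^^ n) x) * norm x"
        using complex_Re_le_cmod norm_cinner_le order_trans by blast
      also have "\<dots> \<le> norm x * norm x" by (intro mult_right_mono nNp) simp
      finally show ?thesis by (simp add: power2_eq_square)
    qed
    have "0 \<le> (\<Sum>k<n. sqrt_coeff k * Re (cinner ((N ^^ k) x) x))" for n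
    proof (cases n)
      case (Suc m)
      \<comment> \<open>For k >= 1 the coefficient is nonpositive, so replacing <N^k x, x> by its
        upper bound |x|^2 can only lower the sum; at k = 0 both agree.\<close>
      have "0 \<le> (\<Sum>k\<le>m. sqrt_coeff k) * (norm x)\<^sup>2"
        by (intro mult_nonneg_nonneg sum_sqrt_coeff_nonneg) simp
      also have "\<dots> \<le> (\<Sum>k\<le>m. sqrt_coeff k * Re (cinner ((N ^^ k) x) x))"
        unfolding sum_distrib_right
      proof (rule sum_mono)
        fix k
        show "sqrt_coeff k * (norm x)\<^sup>2 \<le> sqrt_coeff k * Re (cinner ((N ^^ k) x) x)"
        proof (cases k)
          case 0 then show ?thesis by (simp add: cinner_self)
        next
          case (Suc l)
          then show ?thesis
            using ub[of k] sqrt_coeff_Suc_nonpos[of l] by (auto intro: mult_left_mono_neg)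
        qed
      qed
      finally show ?thesis by (simp add: Suc lessThan_Suc_atMost)
    qed simp
    then show "0 \<le> Re (cinner (S x) x)"
      using re unfolding sums_def by (intro LIMSEQ_le_const) auto
  qed
  have SS: "S (S x) = x - N x" for x
  proof -
    have Np_S: "(N ^^ m) (S x) = (\<Sum>n. sqrt_coeff n *\<^sub>R (N ^^ (m + n)) x)" for m
    proof -
      interpret bounded_linear "N ^^ m" using bNp by (simp add: bounded_clinear_def)
      have "(\<lambda>n. (N ^^ m) (sqrt_coeff n *\<^sub>R (N ^^ n) x)) sums (N ^^ m) (S x)"
        by (rule sums[OF S])
      then show ?thesis by (simp add: scaleR funpow_add sums_iff)
    qed
    have "S (S x) = (\<Sum>k. (\<Sum>i\<le>k. sqrt_coeff i * sqrt_coeff (k - i)) *\<^sub>R (N ^^ k) x)"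
      unfolding S_def[of "S x"] Np_S
      by (rule power_series_square[OF summable_abs_sqrt_coeff, of _ "norm x"]) (rule nNp)
    also have "\<dots> = (\<Sum>k\<in>{0,1}. (\<Sum>i\<le>k. sqrt_coeff i * sqrt_coeff (k - i)) *\<^sub>R (N ^^ k) x)"
      by (rule suminf_finite) (auto simp: sqrt_coeff_convolution)
    also have "\<dots> = x - N x"
      by (simp add: sqrt_coeff_convolution del: atMost_Suc sum.atMost_Suc)
    finally show ?thesis .
  qed
  have comm: "Y (S x) = S (Y x)" if Y: "bounded_linear Y" "\<And>x. Y (N x) = N (Y x)" for Y x
  proof -
    have "Y ((N ^^ n) x) = (N ^^ n) (Y x)" for n
      by (induction n) (simp_all add: Y(2))
    moreover have "(\<lambda>n. Y (sqrt_coeff n *\<^sub>R (N ^^ n) x)) sums Y (S x)"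
      by (rule bounded_linear.sums[OF Y(1) S])
    ultimately have "(\<lambda>n. sqrt_coeff n *\<^sub>R (N ^^ n) (Y x)) sums Y (S x)"
      using bounded_linear.linear[OF Y(1)] by (simp add: linear_scale)
    then show ?thesis using S sums_unique2 by blast
  qed
  show ?thesis
    by (rule that[of S]) (use bS pos SS comm in \<open>auto simp: positive_op_def\<close>)
qed

lemma positive_op_scale:
  assumes "positive_op X" "t \<ge> 0"
  shows "positive_op (\<lambda>x. complex_of_real t *\<^sub>C X x)"
  using assms by (auto simp: positive_op_def bounded_clinear_scaleC cinner_scaleC_left)

lemma sqrt_op_works:
  assumes X: "positive_op X"
  shows "positive_op (sqrt_op X)" "sqrt_op X (sqrt_op X x) = X x"
proof -
  obtain K where K: "K > 0" "\<And>x. Re (cinner (X x) x) \<le> K * (norm x)\<^sup>2"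
    using positive_op_form_bound[OF X] by blast
  \<comment> \<open>N = 1 - X / K satisfies 0 <= N <= 1, and X = K (1 - N), so the root of X is sqrt
    K times the root of 1 - N.\<close>
  define N where "N x = x + complex_of_real (- 1 / K) *\<^sub>C X x" for x
  have XK: "0 \<le> Re (cinner (X x) x)" "Im (cinner (X x) x) = 0" for x
    using X by (auto simp: positive_op_def)
  have bX: "bounded_clinear X"
    using X by (simp add: positive_op_def)
  have NX: "cinner (N x) x = complex_of_real ((norm x)\<^sup>2) - cinner (X x) x / complex_of_real K" for x
    by (simp add: N_def cinner_add_left cinner_scaleC_left cinner_self)
  have "positive_op N"
    unfolding positive_op_def
  proof (intro conjI allI)
    show "bounded_clinear N"
      unfolding N_def by (intro bounded_clinear_add bounded_clinear_id bounded_clinear_scaleC bX)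
    show "Im (cinner (N x) x) = 0" "0 \<le> Re (cinner (N x) x)" for x
      unfolding NX using XK[of x] K(2)[of x] K(1) by (auto simp: Re_divide_of_real Im_divide_of_real field_simps)
  qed
  moreover have "Re (cinner (N x) x) \<le> (norm x)\<^sup>2" for x
    unfolding NX using XK[of x] K(1) by (auto simp: Re_divide_of_real)
  ultimately obtain S0 where S0: "positive_op S0" "\<And>x. S0 (S0 x) = x - N x"
    "\<And>Y x. bounded_linear Y \<Longrightarrow> (\<And>x. Y (N x) = N (Y x)) \<Longrightarrow> Y (S0 x) = S0 (Y x)"
    using positive_sqrt_exists_contraction by metis
  define S where "S x = complex_of_real (sqrt K) *\<^sub>C S0 x" for x
  have pS: "positive_op S"
    unfolding S_def[abs_def] using S0(1) K(1) by (intro positive_op_scale) auto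
  have SS: "S (S x) = X x" for x
  proof -
    have "S0 (u *\<^sub>C y) = u *\<^sub>C S0 y" for u y
      using S0(1) by (simp add: positive_op_def bounded_clinear_def)
    then have "S (S x) = (complex_of_real (sqrt K) * complex_of_real (sqrt K)) *\<^sub>C (x - N x)"
      by (simp add: S_def S0(2) scaleC_scaleC)
    also have "x - N x = complex_of_real (1 / K) *\<^sub>C X x"
      by (simp add: N_def scaleC.minus_left)
    finally show ?thesis
      using K(1) by (simp add: scaleC_scaleC of_real_mult[symmetric] del: of_real_mult)
  qed
  \<comment> \<open>Any root Y commutes with X = Y^2, hence with N and therefore with the series
    S0.\<close>
  have unique: "Y = S" if Y: "positive_op Y \<and> Y \<circ> Y = X" for Y
  proof -
    have pY: "positive_op Y" and YY: "Y (Y x) = X x" for x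
      using Y by (auto simp: fun_eq_iff)
    have bY: "bounded_linear Y" and lY: "Y (u *\<^sub>C y) = u *\<^sub>C Y y" for u y
      using pY by (auto simp: positive_op_def bounded_clinear_def)
    have "Y (X x) = X (Y x)" for x
      by (simp add: YY[symmetric])
    then have "Y (N x) = N (Y x)" for x
      by (simp add: N_def lY linear_add[OF bounded_linear.linear[OF bY]])
    then have "Y (S0 x) = S0 (Y x)" for x
      using S0(3)[OF bY] by blast
    then have "S (Y x) = Y (S x)" for x
      by (simp add: S_def lY)
    then show ?thesis
      by (rule positive_sqrt_unique[OF pS SS pY YY, symmetric])
  qed
  have "sqrt_op X = S"
    unfolding sqrt_op_def
  proof (rule the_equality)
    show "positive_op S \<and> S \<circ> S = X"
      using pS SS by (simp add: fun_eq_iff)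
  qed (rule unique)
  then show "positive_op (sqrt_op X)" "sqrt_op X (sqrt_op X x) = X x"
    using pS SS by auto
qed

subsection \<open>Multi-indices\<close>

definition mi_Suc :: "'d \<Rightarrow> ('d \<Rightarrow> nat) \<Rightarrow> 'd \<Rightarrow> nat" where
  "mi_Suc i \<alpha> = \<alpha>(i := Suc (\<alpha> i))"

lemma mi_Suc_same [simp]: "mi_Suc i \<alpha> i = Suc (\<alpha> i)"
  by (simp add: mi_Suc_def)

lemma mi_Suc_other: "j \<noteq> i \<Longrightarrow> mi_Suc i \<alpha> j = \<alpha> j"
  by (simp add: mi_Suc_def)

lemma mi_abs_Suc [simp]: "mi_abs (mi_Suc i \<alpha>) = Suc (mi_abs (\<alpha> :: 'd::finite \<Rightarrow> nat))"
proof -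
  have "sum \<beta> UNIV = \<beta> i + sum \<beta> (UNIV - {i})" for \<beta> :: "'d \<Rightarrow> nat"
    by (rule sum.remove) auto
  moreover have "sum (mi_Suc i \<alpha>) (UNIV - {i}) = sum \<alpha> (UNIV - {i})"
    by (intro sum.cong) (auto simp: mi_Suc_def)
  ultimately show ?thesis
    unfolding mi_abs_def by (simp add: mi_Suc_def)
qed

lemma mi_gamma_pos: "mi_gamma \<alpha> > 0"
  by (auto simp: mi_gamma_def intro!: divide_pos_pos prod_pos)

lemma mi_gamma_0 [simp]: "mi_gamma (\<lambda>_::'d::finite. 0) = 1"
  by (simp add: mi_gamma_def mi_abs_def)

lemma mi_abs_0 [simp]: "mi_abs (\<lambda>_::'d::finite. 0) = 0"
  by (simp add: mi_abs_def)

lemma mi_abs_eq_0_iff: "mi_abs \<alpha> = 0 \<longleftrightarrow> \<alpha> = (\<lambda>_. 0)"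
  by (auto simp: mi_abs_def fun_eq_iff)

lemma mi_gamma_Suc:
  "mi_gamma (mi_Suc i \<alpha>) * real (Suc (\<alpha> i)) = mi_gamma \<alpha> * real (Suc (mi_abs \<alpha>))"
proof -
  have "(\<Prod>j\<in>UNIV. fact (\<beta> j)) = fact (\<beta> i) * (\<Prod>j\<in>UNIV - {i}. fact (\<beta> j) :: real)"
    for \<beta> :: "'a \<Rightarrow> nat"
    by (rule prod.remove) auto
  moreover have "(\<Prod>j\<in>UNIV - {i}. fact (mi_Suc i \<alpha> j) :: real) = (\<Prod>j\<in>UNIV - {i}. fact (\<alpha> j))"
    by (intro prod.cong) (auto simp: mi_Suc_def)
  ultimately have "(\<Prod>j\<in>UNIV. fact (mi_Suc i \<alpha> j) :: real) = real (Suc (\<alpha> i)) * (\<Prod>j\<in>UNIV. fact (\<alpha> j))"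
    by (simp add: mi_Suc_def)
  then have "mi_gamma (mi_Suc i \<alpha>) =
      (real (Suc (mi_abs \<alpha>)) * fact (mi_abs \<alpha>)) / (real (Suc (\<alpha> i)) * (\<Prod>j\<in>UNIV. fact (\<alpha> j)))"
    by (simp add: mi_gamma_def)
  then show ?thesis
    by (simp add: mi_gamma_def mult.commute)
qed

text \<open>By \<open>mi_gamma_Suc\<close> the quotient of the two sides is (|alpha| + 1) / (alpha_i
  + 1). The inequality is what makes multiplication by z_i bounded.\<close>

lemma mi_gamma_le_Suc: "mi_gamma \<alpha> \<le> mi_gamma (mi_Suc i \<alpha>)"
proof -
  have "\<alpha> i \<le> mi_abs \<alpha>"
    unfolding mi_abs_def by (rule member_le_sum) auto
  then have "mi_gamma \<alpha> * real (Suc (\<alpha> i)) \<le> mi_gamma \<alpha> * real (Suc (mi_abs \<alpha>))"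
    using mi_gamma_pos[of \<alpha>] by (intro mult_left_mono) auto
  also have "\<dots> = mi_gamma (mi_Suc i \<alpha>) * real (Suc (\<alpha> i))"
    by (rule mi_gamma_Suc[symmetric])
  finally show ?thesis by simp
qed

lemma mi_monom_0 [simp]: "mi_monom z (\<lambda>_. 0) = 1"
  by (simp add: mi_monom_def)

lemma mi_monom_Suc: "mi_monom z (mi_Suc i \<alpha>) = z $ i * mi_monom z \<alpha>"
proof -
  have "mi_monom z \<beta> = (z $ i) ^ \<beta> i * (\<Prod>j\<in>UNIV - {i}. (z $ j) ^ \<beta> j)" for \<beta>
    unfolding mi_monom_def by (rule prod.remove) auto
  moreover have "(\<Prod>j\<in>UNIV - {i}. (z $ j) ^ mi_Suc i \<alpha> j) = (\<Prod>j\<in>UNIV - {i}. (z $ j) ^ \<alpha> j)"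
    by (intro prod.cong) (auto simp: mi_Suc_def)
  ultimately show ?thesis
    by (simp add: mi_Suc_def)
qed

lemma finite_mi_level: "finite {\<alpha> :: 'd::finite \<Rightarrow> nat. mi_abs \<alpha> = n}"
proof (rule finite_subset)
  have "\<alpha> i \<le> mi_abs \<alpha>" for \<alpha> :: "'d \<Rightarrow> nat" and i
    unfolding mi_abs_def by (rule member_le_sum) auto
  then show "{\<alpha> :: 'd \<Rightarrow> nat. mi_abs \<alpha> = n} \<subseteq> (\<Pi>\<^sub>E i\<in>UNIV. {..n})"
    by auto
  show "finite (\<Pi>\<^sub>E i\<in>(UNIV::'d set). {..n})"
    by (intro finite_PiE) auto
qed

lemma mi_Suc_cases:
  fixes \<alpha> :: "'d::finite \<Rightarrow> nat"
  assumes "\<alpha> \<noteq> (\<lambda>_. 0)"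
  obtains i \<beta> where "\<alpha> = mi_Suc i \<beta>"
proof -
  obtain i where "\<alpha> i \<noteq> 0" using assms by auto
  then have "\<alpha> = mi_Suc i (\<alpha>(i := \<alpha> i - 1))"
    by (auto simp: mi_Suc_def fun_eq_iff)
  then show ?thesis using that by blast
qed

lemma mi_induct [case_names zero Suc]:
  fixes \<alpha> :: "'d::finite \<Rightarrow> nat"
  assumes "P (\<lambda>_. 0)" "\<And>\<alpha> i. P \<alpha> \<Longrightarrow> P (mi_Suc i \<alpha>)"
  shows "P \<alpha>"
proof (induction "mi_abs \<alpha>" arbitrary: \<alpha>)
  case 0
  then have "\<alpha> = (\<lambda>_. 0)" using mi_abs_eq_0_iff by metis
  then show ?case using assms(1) by simp
next
  case (Suc n)
  then have "\<alpha> \<noteq> (\<lambda>_. 0)" by auto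
  then obtain i \<beta> where \<beta>: "\<alpha> = mi_Suc i \<beta>" using mi_Suc_cases by blast
  then have "n = mi_abs \<beta>" using Suc(2) by simp
  then show ?case using Suc(1) assms(2) \<beta> by blast
qed

lemma mi_Suc_neq_0: "mi_Suc i \<alpha> \<noteq> (\<lambda>_. 0)"
  by (auto simp: mi_Suc_def fun_eq_iff)

(* The multinomial form of Pascal's rule. *)
lemma mi_level_sum_Suc:
  fixes G :: "('d::finite \<Rightarrow> nat) \<Rightarrow> 'v::real_vector"
  shows "(\<Sum>\<alpha> | mi_abs \<alpha> = Suc n. mi_gamma \<alpha> *\<^sub>R G \<alpha>)
    = (\<Sum>i\<in>UNIV. \<Sum>\<alpha> | mi_abs \<alpha> = n. mi_gamma \<alpha> *\<^sub>R G (mi_Suc i \<alpha>))"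
proof -
  \<comment> \<open>Since gamma_(alpha - e_i) = (alpha_i / |alpha|) gamma_alpha, each shifted sum
    becomes a sum over level n + 1 with the factors alpha_i / (n + 1). Over i these factors add up
    to 1.\<close>
  have shift: "(\<Sum>\<alpha> | mi_abs \<alpha> = n. mi_gamma \<alpha> *\<^sub>R G (mi_Suc i \<alpha>))
      = (\<Sum>\<alpha> | mi_abs \<alpha> = Suc n. (real (\<alpha> i) / real (Suc n)) *\<^sub>R mi_gamma \<alpha> *\<^sub>R G \<alpha>)" for i
  proof -
    have "(\<Sum>\<alpha> | mi_abs \<alpha> = n. mi_gamma \<alpha> *\<^sub>R G (mi_Suc i \<alpha>))
        = (\<Sum>\<alpha> | mi_abs \<alpha> = Suc n \<and> \<alpha> i \<noteq> 0. (real (\<alpha> i) / real (Suc n)) *\<^sub>R mi_gamma \<alpha> *\<^sub>R G \<alpha>)"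
    proof (rule sum.reindex_bij_witness[where i = "\<lambda>\<alpha>. \<alpha>(i := \<alpha> i - 1)" and j = "mi_Suc i"])
      fix \<alpha> :: "'d \<Rightarrow> nat"
      assume "\<alpha> \<in> {\<alpha>. mi_abs \<alpha> = n}"
      then have n: "mi_abs \<alpha> = n" by simp
      show "(mi_Suc i \<alpha>)(i := mi_Suc i \<alpha> i - 1) = \<alpha>"
        by (simp add: mi_Suc_def)
      show "mi_Suc i \<alpha> \<in> {\<alpha>. mi_abs \<alpha> = Suc n \<and> \<alpha> i \<noteq> 0}"
        using n by simp
      have "real (mi_Suc i \<alpha> i) / real (Suc n) * mi_gamma (mi_Suc i \<alpha>) = mi_gamma \<alpha>"
        using mi_gamma_Suc[of i \<alpha>] by (simp add: n field_simps)
      then show "(real (mi_Suc i \<alpha> i) / real (Suc n)) *\<^sub>R mi_gamma (mi_Suc i \<alpha>) *\<^sub>R G (mi_Suc i \<alpha>)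
          = mi_gamma \<alpha> *\<^sub>R G (mi_Suc i \<alpha>)"
        by simp
    next
      fix \<alpha> :: "'d \<Rightarrow> nat"
      assume \<alpha>: "\<alpha> \<in> {\<alpha>. mi_abs \<alpha> = Suc n \<and> \<alpha> i \<noteq> 0}"
      then show eq: "mi_Suc i (\<alpha>(i := \<alpha> i - 1)) = \<alpha>"
        by (simp add: mi_Suc_def)
      have "Suc (mi_abs (\<alpha>(i := \<alpha> i - 1))) = mi_abs \<alpha>"
        unfolding mi_abs_Suc[of i, symmetric] eq ..
      then have "Suc (mi_abs (\<alpha>(i := \<alpha> i - 1))) = Suc n"
        using \<alpha> by simp
      then show "\<alpha>(i := \<alpha> i - 1) \<in> {\<alpha>. mi_abs \<alpha> = n}"
        by simp
    qed
    also have "\<dots> = (\<Sum>\<alpha> | mi_abs \<alpha> = Suc n. (real (\<alpha> i) / real (Suc n)) *\<^sub>R mi_gamma \<alpha> *\<^sub>R G \<alpha>)"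
      by (rule sum.mono_neutral_left) (auto simp: finite_mi_level)
    finally show ?thesis .
  qed
  have "(\<Sum>i\<in>UNIV. \<Sum>\<alpha> | mi_abs \<alpha> = n. mi_gamma \<alpha> *\<^sub>R G (mi_Suc i \<alpha>))
      = (\<Sum>\<alpha> | mi_abs \<alpha> = Suc n. \<Sum>i\<in>UNIV. (real (\<alpha> i) / real (Suc n)) *\<^sub>R mi_gamma \<alpha> *\<^sub>R G \<alpha>)"
    unfolding shift by (rule sum.swap)
  also have "\<dots> = (\<Sum>\<alpha> | mi_abs \<alpha> = Suc n. mi_gamma \<alpha> *\<^sub>R G \<alpha>)"
  proof (intro sum.cong refl)
    fix \<alpha> :: "'d \<Rightarrow> nat" assume "\<alpha> \<in> {\<alpha>. mi_abs \<alpha> = Suc n}"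
    moreover have "(\<Sum>i\<in>UNIV. real (\<alpha> i)) = real (mi_abs \<alpha>)"
      by (simp add: mi_abs_def)
    ultimately have "(\<Sum>i\<in>UNIV. real (\<alpha> i)) = real (Suc n)"
      by simp
    then have "(\<Sum>i\<in>UNIV. real (\<alpha> i) / real (Suc n)) = 1"
      by (simp add: sum_divide_distrib[symmetric])
    then show "(\<Sum>i\<in>UNIV. (real (\<alpha> i) / real (Suc n)) *\<^sub>R mi_gamma \<alpha> *\<^sub>R G \<alpha>) = mi_gamma \<alpha> *\<^sub>R G \<alpha>"
      by (simp only: scaleR_sum_left[symmetric] scaleR_one)
  qed
  finally show ?thesis ..
qed

section \<open>Grouping sums over multi-indices by total degree\<close>

lemma mi_level_0: "{\<alpha> :: 'd::finite \<Rightarrow> nat. mi_abs \<alpha> = 0} = {\<lambda>_. 0}"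
  by (auto simp: mi_abs_eq_0_iff)

text \<open>Passes from unconditional sums, used for \<open>HK\<close>, to series over the degree,
  used for operators. The way back, \<open>mi_level_summable_on\<close>, is for nonnegative
  terms.\<close>

lemma mi_level_has_sum:
  fixes h :: "('d::finite \<Rightarrow> nat) \<Rightarrow> 'v::real_normed_vector"
  assumes "(h has_sum s) UNIV"
  shows "(\<lambda>n. \<Sum>\<alpha> | mi_abs \<alpha> = n. h \<alpha>) sums s"
proof -
  have "(h has_sum s) UNIV \<longleftrightarrow>
      ((\<lambda>p. h (snd p)) has_sum s) (SIGMA n:UNIV. {\<alpha> :: 'd \<Rightarrow> nat. mi_abs \<alpha> = n})"
    by (rule has_sum_reindex_bij_witness[where i = snd and j = "\<lambda>\<alpha>. (mi_abs \<alpha>, \<alpha>)"]) auto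
  then have "((\<lambda>p. h (snd p)) has_sum s) (SIGMA n:UNIV. {\<alpha> :: 'd \<Rightarrow> nat. mi_abs \<alpha> = n})"
    using assms by simp
  then have "((\<lambda>n. \<Sum>\<alpha> | mi_abs \<alpha> = n. h \<alpha>) has_sum s) UNIV"
    by (rule has_sum_SigmaD) (auto intro!: has_sum_finiteI finite_mi_level)
  then show ?thesis
    by (rule has_sum_imp_sums)
qed

lemma mi_level_summable_on:
  fixes h :: "('d::finite \<Rightarrow> nat) \<Rightarrow> real"
  assumes "\<And>\<alpha>. h \<alpha> \<ge> 0" "summable (\<lambda>n. \<Sum>\<alpha> | mi_abs \<alpha> = n. h \<alpha>)"
  shows "h summable_on UNIV"
proof (rule nonneg_bounded_partial_sums_imp_summable_on)
  show "\<forall>\<^sub>F F in finite_subsets_at_top UNIV. sum h F \<le> (\<Sum>n. \<Sum>\<alpha> | mi_abs \<alpha> = n. h \<alpha>)"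
  proof (rule eventually_finite_subsets_at_top_weakI)
    fix F :: "('d \<Rightarrow> nat) set" assume F: "finite F"
    define N where "N = Suc (Max (insert 0 (mi_abs ` F)))"
    have "F \<subseteq> (\<Union>n<N. {\<alpha>. mi_abs \<alpha> = n})"
      using F by (auto simp: N_def less_Suc_eq_le)
    then have "sum h F \<le> sum h (\<Union>n<N. {\<alpha>. mi_abs \<alpha> = n})"
      by (intro sum_mono2) (auto simp: finite_mi_level assms(1))
    also have "\<dots> = (\<Sum>n<N. \<Sum>\<alpha> | mi_abs \<alpha> = n. h \<alpha>)"
      by (rule sum.UNION_disjoint) (auto simp: finite_mi_level)
    also have "\<dots> \<le> (\<Sum>n. \<Sum>\<alpha> | mi_abs \<alpha> = n. h \<alpha>)"
      by (rule sum_le_suminf[OF assms(2)]) (auto intro: sum_nonneg assms(1))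
    finally show "sum h F \<le> (\<Sum>n. \<Sum>\<alpha> | mi_abs \<alpha> = n. h \<alpha>)" .
  qed
qed (use assms in auto)

lemma norm_vec_square: "(norm z)\<^sup>2 = (\<Sum>i\<in>UNIV. (norm (z $ i))\<^sup>2)" for z :: "'a::real_normed_vector ^ 'd"
  by (simp add: norm_vec_def L2_set_def sum_nonneg)

text \<open>The multinomial expansion of <z, z>^n.\<close>

lemma mi_level_sum_monom:
  "(\<Sum>\<alpha> | mi_abs \<alpha> = n. mi_gamma \<alpha> * (norm (mi_monom z \<alpha>))\<^sup>2) = (norm z) ^ (2 * n)"
proof (induction n)
  case 0
  then show ?case by (simp add: mi_level_0)
next
  case (Suc n)
  have "(\<Sum>\<alpha> | mi_abs \<alpha> = Suc n. mi_gamma \<alpha> * (norm (mi_monom z \<alpha>))\<^sup>2)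
      = (\<Sum>i\<in>UNIV. (norm (z $ i))\<^sup>2 * (\<Sum>\<alpha> | mi_abs \<alpha> = n. mi_gamma \<alpha> * (norm (mi_monom z \<alpha>))\<^sup>2))"
    using mi_level_sum_Suc[of "\<lambda>\<alpha>. (norm (mi_monom z \<alpha>))\<^sup>2" n]
    by (simp add: mi_monom_Suc norm_mult power_mult_distrib sum_distrib_left ac_simps)
  also have "\<dots> = (norm z)\<^sup>2 * (norm z) ^ (2 * n)"
    unfolding Suc sum_distrib_right[symmetric] norm_vec_square ..
  finally show ?case by (simp add: power_add[symmetric] power2_eq_square)
qed

text \<open>Cauchy-Schwarz with the weights gamma_alpha shared evenly between the factors, so that
  \<open>mi_level_sum_monom\<close> evaluates the scalar one exactly. It serves to bound the powers
  of ZT*.\<close>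

lemma mi_level_Cauchy_Schwarz:
  fixes v :: "('d::finite \<Rightarrow> nat) \<Rightarrow> 'v::complex_hilbert"
  shows "norm (\<Sum>\<alpha> | mi_abs \<alpha> = n. mi_gamma \<alpha> *\<^sub>R mi_monom z \<alpha> *\<^sub>C v \<alpha>)
    \<le> norm z ^ n * sqrt (\<Sum>\<alpha> | mi_abs \<alpha> = n. mi_gamma \<alpha> * (norm (v \<alpha>))\<^sup>2)"
proof -
  let ?L = "{\<alpha>::'d \<Rightarrow> nat. mi_abs \<alpha> = n}"
  have g: "sqrt (mi_gamma \<alpha>) * sqrt (mi_gamma \<alpha>) = mi_gamma \<alpha>" for \<alpha> :: "'d \<Rightarrow> nat"
    using mi_gamma_pos[of \<alpha>] by simp
  then have g2: "(sqrt (mi_gamma \<alpha>))\<^sup>2 = mi_gamma \<alpha>" for \<alpha> :: "'d \<Rightarrow> nat"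
    by (simp add: power2_eq_square)
  have "norm (\<Sum>\<alpha>\<in>?L. mi_gamma \<alpha> *\<^sub>R mi_monom z \<alpha> *\<^sub>C v \<alpha>)
      \<le> (\<Sum>\<alpha>\<in>?L. mi_gamma \<alpha> * (norm (mi_monom z \<alpha>) * norm (v \<alpha>)))"
    using mi_gamma_pos by (intro sum_norm_le) (simp add: norm_scaleC abs_of_pos[OF mi_gamma_pos])
  also have "\<dots> = (\<Sum>\<alpha>\<in>?L. \<bar>sqrt (mi_gamma \<alpha>) * norm (mi_monom z \<alpha>)\<bar> * \<bar>sqrt (mi_gamma \<alpha>) * norm (v \<alpha>)\<bar>)"
  proof (intro sum.cong refl)
    fix \<alpha> :: "'d \<Rightarrow> nat"
    have "mi_gamma \<alpha> * (norm (mi_monom z \<alpha>) * norm (v \<alpha>))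
        = (sqrt (mi_gamma \<alpha>) * sqrt (mi_gamma \<alpha>)) * (norm (mi_monom z \<alpha>) * norm (v \<alpha>))"
      by (simp only: g)
    then show "mi_gamma \<alpha> * (norm (mi_monom z \<alpha>) * norm (v \<alpha>))
        = \<bar>sqrt (mi_gamma \<alpha>) * norm (mi_monom z \<alpha>)\<bar> * \<bar>sqrt (mi_gamma \<alpha>) * norm (v \<alpha>)\<bar>"
      using mi_gamma_pos[of \<alpha>] by (simp add: abs_mult ac_simps)
  qed
  also have "\<dots> \<le> L2_set (\<lambda>\<alpha>. sqrt (mi_gamma \<alpha>) * norm (mi_monom z \<alpha>)) ?L
      * L2_set (\<lambda>\<alpha>. sqrt (mi_gamma \<alpha>) * norm (v \<alpha>)) ?L"
    by (rule L2_set_mult_ineq)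
  also have "L2_set (\<lambda>\<alpha>. sqrt (mi_gamma \<alpha>) * norm (mi_monom z \<alpha>)) ?L = norm z ^ n"
  proof -
    have "(\<Sum>\<alpha>\<in>?L. (sqrt (mi_gamma \<alpha>) * norm (mi_monom z \<alpha>))\<^sup>2) = (norm z ^ n)\<^sup>2"
      using mi_level_sum_monom[where n = n and z = z]
      by (simp add: power_mult_distrib g2 power_mult[symmetric] mult.commute)
    then show ?thesis by (simp add: L2_set_def)
  qed
  also have "L2_set (\<lambda>\<alpha>. sqrt (mi_gamma \<alpha>) * norm (v \<alpha>)) ?L
      = sqrt (\<Sum>\<alpha>\<in>?L. mi_gamma \<alpha> * (norm (v \<alpha>))\<^sup>2)"
    by (simp add: L2_set_def power_mult_distrib g2)
  finally show ?thesis .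
qed

subsection \<open>Powers of commuting tuples\<close>

lemma funpow_comm:
  assumes "f \<circ> g = g \<circ> f"
  shows "(f ^^ m) \<circ> (g ^^ n) = (g ^^ n) \<circ> (f ^^ m)"
proof -
  have fg: "f (g x) = g (f x)" for x
    using assms by (simp add: fun_eq_iff)
  have 1: "f ((g ^^ n) x) = (g ^^ n) (f x)" for x
    by (induction n) (simp_all add: fg)
  show ?thesis
    by (induction m) (simp_all add: fun_eq_iff 1)
qed

context
  fixes S :: "'d::finite \<Rightarrow> 'a \<Rightarrow> 'a"
  assumes comm: "\<And>i j. S i \<circ> S j = S j \<circ> S i"
begin

text \<open>Commutation of the tuple makes the fold in \<open>op_pow\<close> independent of the
  order, so that any chosen factor can be split off.\<close>

lemma comp_fun_commute_op_pow: "comp_fun_commute (\<lambda>i X. (S i ^^ \<alpha> i) \<circ> X)"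
proof
  fix i j
  show "(\<lambda>X. (S j ^^ \<alpha> j) \<circ> X) \<circ> (\<lambda>X. (S i ^^ \<alpha> i) \<circ> X)
      = (\<lambda>X. (S i ^^ \<alpha> i) \<circ> X) \<circ> (\<lambda>X. (S j ^^ \<alpha> j) \<circ> X)"
    by (rule ext) (simp only: comp_apply comp_assoc[symmetric] funpow_comm[OF comm])
qed

lemma op_pow_remove:
  "op_pow S \<alpha> = (S i ^^ \<alpha> i) \<circ> Finite_Set.fold (\<lambda>i X. (S i ^^ \<alpha> i) \<circ> X) id (UNIV - {i})"
proof -
  interpret comp_fun_commute "\<lambda>i X. (S i ^^ \<alpha> i) \<circ> X"
    by (rule comp_fun_commute_op_pow)
  show ?thesis
    unfolding op_pow_def by (rule fold_rec) auto
qed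

lemma op_pow_0: "op_pow S (\<lambda>_. 0) = id"
proof -
  have "Finite_Set.fold (\<lambda>i X. (S i ^^ 0) \<circ> X) id A = id" if "finite A" for A
    using that
  proof (induction A rule: finite_induct)
    case (insert i A)
    interpret comp_fun_commute "\<lambda>i X. (S i ^^ 0) \<circ> X"
      using comp_fun_commute_op_pow[of "\<lambda>_. 0"] .
    show ?case unfolding fold_insert[OF insert(1,2)] insert(3) by simp
  qed simp
  then show ?thesis by (simp add: op_pow_def)
qed

lemma op_pow_Suc: "op_pow S (mi_Suc i \<alpha>) = S i \<circ> op_pow S \<alpha>"
proof -
  \<comment> \<open>Away from i the exponents of \<open>mi_Suc i \<alpha>\<close> and \<alpha>
    agree, so only the factor of index i changes.\<close>
  have "Finite_Set.fold (\<lambda>j X. (S j ^^ mi_Suc i \<alpha> j) \<circ> X) id A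
      = Finite_Set.fold (\<lambda>j X. (S j ^^ \<alpha> j) \<circ> X) id A" if "finite A" "i \<notin> A" for A
    using that
  proof (induction A rule: finite_induct)
    case (insert j A)
    interpret c1: comp_fun_commute "\<lambda>j X. (S j ^^ mi_Suc i \<alpha> j) \<circ> X"
      by (rule comp_fun_commute_op_pow)
    interpret c2: comp_fun_commute "\<lambda>j X. (S j ^^ \<alpha> j) \<circ> X"
      by (rule comp_fun_commute_op_pow)
    have j: "j \<noteq> i" and A: "i \<notin> A" using insert(4) by auto
    show ?case
      unfolding c1.fold_insert[OF insert(1,2)] c2.fold_insert[OF insert(1,2)] insert(3)[OF A]
        mi_Suc_other[OF j] ..
  qed simp
  from this[of "UNIV - {i}"] show ?thesis
    unfolding op_pow_remove[of _ i] by (simp add: mi_Suc_def comp_assoc)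
qed

lemma op_pow_comm: "op_pow S \<alpha> \<circ> S i = S i \<circ> op_pow S \<alpha>"
proof (induction \<alpha> rule: mi_induct)
  case zero
  then show ?case by (simp add: op_pow_0)
next
  case (Suc \<alpha> j)
  have "op_pow S (mi_Suc j \<alpha>) \<circ> S i = S j \<circ> (op_pow S \<alpha> \<circ> S i)"
    by (simp add: op_pow_Suc comp_assoc)
  also have "\<dots> = S i \<circ> (S j \<circ> op_pow S \<alpha>)"
    unfolding Suc by (simp only: comp_assoc[symmetric] comm)
  finally show ?case by (simp only: op_pow_Suc)
qed

lemma op_pow_add: "op_pow S (\<lambda>i. \<alpha> i + \<beta> i) = op_pow S \<alpha> \<circ> op_pow S \<beta>"
proof (induction \<alpha> rule: mi_induct)
  case zero
  then show ?case by (simp add: op_pow_0)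
next
  case (Suc \<alpha> j)
  have "(\<lambda>i. mi_Suc j \<alpha> i + \<beta> i) = mi_Suc j (\<lambda>i. \<alpha> i + \<beta> i)"
    by (auto simp: mi_Suc_def)
  then show ?case by (simp add: op_pow_Suc Suc comp_assoc)
qed

end

lemma bounded_clinear_op_pow:
  assumes "\<And>i j. S i \<circ> S j = S j \<circ> S i" "\<And>i. bounded_clinear (S i)"
  shows "bounded_clinear (op_pow S \<alpha>)"
proof (induction \<alpha> rule: mi_induct)
  case zero
  show ?case using bounded_clinear_id by (simp add: op_pow_0[OF assms(1)] id_def)
next
  case (Suc \<alpha> i)
  then show ?case
    using bounded_clinear_compose[OF assms(2)] by (simp add: op_pow_Suc[OF assms(1)] comp_def)
qed

text \<open>The multinomial theorem for commuting operators, with \<open>mi_level_sum_Suc\<close> as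
  induction step. It expands the powers of ZT* into the sums that occur in F.\<close>

lemma linear_combination_funpow:
  fixes S :: "'d::finite \<Rightarrow> 'a::complex_hilbert \<Rightarrow> 'a"
  assumes "\<And>i j. S i \<circ> S j = S j \<circ> S i" "\<And>i. bounded_clinear (S i)"
  shows "((\<lambda>x. \<Sum>i\<in>UNIV. (z $ i) *\<^sub>C S i x) ^^ n) x
    = (\<Sum>\<alpha> | mi_abs \<alpha> = n. mi_gamma \<alpha> *\<^sub>R mi_monom z \<alpha> *\<^sub>C op_pow S \<alpha> x)"
proof (induction n)
  case 0
  then show ?case by (simp add: mi_level_0 op_pow_0[OF assms(1)])
next
  case (Suc n)
  have lin: "linear (S i)" "S i (u *\<^sub>C y) = u *\<^sub>C S i y" for i u y
    using assms(2)[of i] by (auto simp: bounded_clinear_def bounded_linear.linear)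
  have "((\<lambda>x. \<Sum>i\<in>UNIV. (z $ i) *\<^sub>C S i x) ^^ Suc n) x
      = (\<Sum>i\<in>UNIV. (z $ i) *\<^sub>C S i (\<Sum>\<alpha> | mi_abs \<alpha> = n. mi_gamma \<alpha> *\<^sub>R mi_monom z \<alpha> *\<^sub>C op_pow S \<alpha> x))"
    using Suc by simp
  also have "\<dots> = (\<Sum>i\<in>UNIV. \<Sum>\<alpha> | mi_abs \<alpha> = n.
      mi_gamma \<alpha> *\<^sub>R mi_monom z (mi_Suc i \<alpha>) *\<^sub>C op_pow S (mi_Suc i \<alpha>) x)"
    by (simp add: linear_sum[OF lin(1)] linear_scale[OF lin(1)] lin(2) scaleC.sum_right scaleC.scaleR_right
        scaleC_scaleC mi_monom_Suc op_pow_Suc[OF assms(1)])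
  also have "\<dots> = (\<Sum>\<alpha> | mi_abs \<alpha> = Suc n. mi_gamma \<alpha> *\<^sub>R mi_monom z \<alpha> *\<^sub>C op_pow S \<alpha> x)"
    by (rule mi_level_sum_Suc[symmetric])
  finally show ?case .
qed

subsection \<open>Uniqueness of power series coefficients\<close>

text \<open>Once the first n coefficients vanish, dividing by t^n leaves a series that is 0 near 0
  and tends to \<open>c n\<close> there.\<close>

lemma powser_eq_0_imp_coeff_0:
  fixes c :: "nat \<Rightarrow> complex"
  assumes "0 < e" and sums: "\<And>t. t \<noteq> 0 \<Longrightarrow> norm t < e \<Longrightarrow> (\<lambda>n. c n * t ^ n) sums 0"
  shows "c n = 0"
proof (induction n rule: less_induct)
  case (less n)
  have "(\<lambda>m. c (m + n) * t ^ m) sums 0" if t: "t \<noteq> 0" "norm t < e" for t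
  proof -
    have "(\<lambda>m. c (m + n) * t ^ (m + n)) sums (0 - (\<Sum>i<n. c i * t ^ i))"
      using sums[OF t] by (rule sums_split_initial_segment)
    moreover have "(\<Sum>i<n. c i * t ^ i) = 0"
      by (intro sum.neutral) (simp add: less)
    ultimately have "(\<lambda>m. c (m + n) * t ^ (m + n)) sums 0" by simp
    then have "(\<lambda>m. c (m + n) * t ^ (m + n) / t ^ n) sums (0 / t ^ n)"
      by (rule sums_divide)
    moreover have "c (m + n) * t ^ (m + n) / t ^ n = c (m + n) * t ^ m" for m
      using t by (simp add: power_add)
    ultimately show ?thesis by simp
  qed
  then have "((\<lambda>_::complex. 0) \<longlongrightarrow> c (0 + n)) (at 0)"
    using \<open>0 < e\<close> by (intro powser_limit_0_strong[where s = e and a = "\<lambda>m. c (m + n)"]) auto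
  then show ?case
    using tendsto_const_iff[of "at (0::complex)" 0 "c n"] by simp
qed

(* Induction on the set I of active variables: fixing the exponent of one more variable keeps
   the elements of L distinguishable on the remaining ones. *)
lemma polynomial_eq_0_imp_coeff_0:
  fixes h :: "('d \<Rightarrow> nat) \<Rightarrow> complex"
  assumes "finite I" "finite L" "0 < e"
    and "\<And>\<alpha> \<beta>. \<alpha> \<in> L \<Longrightarrow> \<beta> \<in> L \<Longrightarrow> (\<And>i. i \<in> I \<Longrightarrow> \<alpha> i = \<beta> i) \<Longrightarrow> \<alpha> = \<beta>"
    and "\<And>z. (\<And>i. norm (z i) < e) \<Longrightarrow> (\<Sum>\<alpha>\<in>L. h \<alpha> * (\<Prod>i\<in>I. z i ^ \<alpha> i)) = 0"
    and "\<alpha> \<in> L"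
  shows "h \<alpha> = 0"
  using assms(1,2,4-)
proof (induction I arbitrary: L rule: finite_induct)
  case empty
  have "L = {\<alpha>}" using empty(2,4) by blast
  then show ?case using empty(3)[of "\<lambda>_. 0"] \<open>0 < e\<close> by simp
next
  case (insert j I)
  define L' where "L' = {\<beta> \<in> L. \<beta> j = \<alpha> j}"
  show ?case
  proof (rule insert.IH[of L'])
    show "finite L'" "\<alpha> \<in> L'" using insert.prems by (auto simp: L'_def)
    show "\<beta> = \<gamma>" if "\<beta> \<in> L'" "\<gamma> \<in> L'" "\<And>i. i \<in> I \<Longrightarrow> \<beta> i = \<gamma> i" for \<beta> \<gamma>
      using that insert.prems(2)[of \<beta> \<gamma>] unfolding L'_def by fastforce
  next
    fix z :: "'d \<Rightarrow> complex" assume z: "\<And>i. norm (z i) < e"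
    define q where "q \<beta> = h \<beta> * (\<Prod>i\<in>I. z i ^ \<beta> i)" for \<beta>
    \<comment> \<open>\<open>c k\<close> is the coefficient of t^k when the sum is read as a
      polynomial in the variable of index j alone.\<close>
    define c where "c k = (\<Sum>\<beta> | \<beta> \<in> L \<and> \<beta> j = k. q \<beta>)" for k
    have "c (\<alpha> j) = 0"
    proof (rule powser_eq_0_imp_coeff_0[OF \<open>0 < e\<close>])
      fix t :: complex assume "norm t < e"
      then have "(\<Sum>\<beta>\<in>L. h \<beta> * (\<Prod>i\<in>insert j I. (z(j := t)) i ^ \<beta> i)) = 0"
        using z by (intro insert.prems(3)) auto
      moreover have "h \<beta> * (\<Prod>i\<in>insert j I. (z(j := t)) i ^ \<beta> i) = q \<beta> * t ^ \<beta> j" for \<beta>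
      proof -
        have "(\<Prod>i\<in>I. (z(j := t)) i ^ \<beta> i) = (\<Prod>i\<in>I. z i ^ \<beta> i)"
          using insert.hyps by (intro prod.cong) auto
        then show ?thesis using insert.hyps by (simp add: q_def)
      qed
      ultimately have "(\<Sum>\<beta>\<in>L. q \<beta> * t ^ \<beta> j) = 0" by simp
      also have "(\<Sum>\<beta>\<in>L. q \<beta> * t ^ \<beta> j) = (\<Sum>k\<in>(\<lambda>\<beta>. \<beta> j) ` L. \<Sum>\<beta> | \<beta> \<in> L \<and> \<beta> j = k. q \<beta> * t ^ \<beta> j)"
        by (rule sum.image_gen) (rule insert.prems)
      also have "\<dots> = (\<Sum>k\<in>(\<lambda>\<beta>. \<beta> j) ` L. c k * t ^ k)"
        by (simp add: c_def sum_distrib_right)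
      finally have 0: "(\<Sum>k\<in>(\<lambda>\<beta>. \<beta> j) ` L. c k * t ^ k) = 0" .
      have c0: "c k = 0" if "k \<notin> (\<lambda>\<beta>. \<beta> j) ` L" for k
      proof -
        have "{\<beta>. \<beta> \<in> L \<and> \<beta> j = k} = {}" using that by auto
        then show ?thesis unfolding c_def by (simp only: sum.empty)
      qed
      have "(\<lambda>n. c n * t ^ n) sums (\<Sum>k\<in>(\<lambda>\<beta>. \<beta> j) ` L. c k * t ^ k)"
        by (rule sums_finite) (use insert.prems(1) c0 in auto)
      then show "(\<lambda>n. c n * t ^ n) sums 0"
        using 0 by simp
    qed
    then show "(\<Sum>\<beta>\<in>L'. h \<beta> * (\<Prod>i\<in>I. z i ^ \<beta> i)) = 0"
      by (simp add: c_def q_def L'_def)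
  qed
qed

lemma mi_monom_scale: "mi_monom (t *\<^sub>C z) \<alpha> = t ^ mi_abs \<alpha> * mi_monom z \<alpha>"
  for z :: "complex ^ 'd"
  by (simp add: mi_monom_def mi_abs_def scaleC_vec_def scaleC_complex_def power_mult_distrib
      prod.distrib power_sum)

text \<open>On each complex line t z the series is a power series in t whose coefficients are the
  homogeneous parts at z. So every homogeneous part vanishes on the ball, and it is a
  polynomial.\<close>

lemma multi_power_series_eq_0_imp_coeff_0:
  fixes h :: "('d::finite \<Rightarrow> nat) \<Rightarrow> complex"
  assumes sum0: "\<And>z. z \<in> ball 0 1 \<Longrightarrow> ((\<lambda>\<alpha>. mi_monom z \<alpha> * h \<alpha>) has_sum 0) UNIV"
  shows "h \<alpha> = 0"
proof -
  have hom: "(\<Sum>\<alpha> | mi_abs \<alpha> = n. mi_monom z \<alpha> * h \<alpha>) = 0" if z: "z \<in> ball 0 1" for z n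
  proof (rule powser_eq_0_imp_coeff_0[of 1])
    fix t :: complex assume t: "norm t < 1"
    have "norm (t *\<^sub>C z) < 1"
      using z t mult_strict_mono[of "norm t" 1 "norm z" 1] by (simp add: norm_scaleC)
    then have "(\<lambda>n. \<Sum>\<alpha> | mi_abs \<alpha> = n. mi_monom (t *\<^sub>C z) \<alpha> * h \<alpha>) sums 0"
      by (intro mi_level_has_sum sum0) simp
    moreover have "(\<Sum>\<alpha> | mi_abs \<alpha> = n. mi_monom (t *\<^sub>C z) \<alpha> * h \<alpha>)
        = (\<Sum>\<alpha> | mi_abs \<alpha> = n. mi_monom z \<alpha> * h \<alpha>) * t ^ n" for n
      unfolding sum_distrib_right by (intro sum.cong) (auto simp: mi_monom_scale)
    ultimately show "(\<lambda>n. (\<Sum>\<alpha> | mi_abs \<alpha> = n. mi_monom z \<alpha> * h \<alpha>) * t ^ n) sums 0"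
      by simp
  qed simp
  \<comment> \<open>The polydisc of radius 1/d lies in the unit ball, because the norm is at most
    the sum of the moduli of the coordinates.\<close>
  define e where "e = 1 / real CARD('d)"
  have e: "0 < e" by (simp add: e_def)
  show ?thesis
  proof (rule polynomial_eq_0_imp_coeff_0[of UNIV "{\<beta>. mi_abs \<beta> = mi_abs \<alpha>}" e])
    fix z :: "'d \<Rightarrow> complex" assume z: "\<And>i. norm (z i) < e"
    have "norm (\<chi> i. z i) \<le> (\<Sum>i\<in>UNIV. norm (z i))"
      unfolding norm_vec_def by (rule order_trans[OF L2_set_le_sum]) auto
    also have "\<dots> < (\<Sum>i\<in>(UNIV::'d set). e)"
      using z by (intro sum_strict_mono) auto
    also have "\<dots> = 1" by (simp add: e_def)
    finally have "(\<chi> i. z i) \<in> ball 0 1" by simp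
    from hom[OF this, of "mi_abs \<alpha>"]
    show "(\<Sum>\<beta> | mi_abs \<beta> = mi_abs \<alpha>. h \<beta> * (\<Prod>i\<in>UNIV. z i ^ \<beta> i)) = 0"
      by (simp add: mi_monom_def mult.commute)
  qed (use e finite_mi_level in auto)
qed

subsection \<open>The functional Hilbert space\<close>

text \<open>A crude form of the inequality of arithmetic and geometric means. With w a weight of the
  space it separates the kernel from the norm of f; with w = 1 it bounds inner products.\<close>

lemma product_le_weighted_squares:
  assumes "w > (0::real)"
  shows "x * y \<le> x\<^sup>2 * w + y\<^sup>2 / w"
proof -
  have "0 \<le> (x * w - y / 2)\<^sup>2 + 3 / 4 * y\<^sup>2" by simp
  then have "x * y * w \<le> x\<^sup>2 * w * w + y\<^sup>2"
    by (simp add: power2_eq_square algebra_simps)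
  then show ?thesis
    using assms by (simp add: field_simps power2_eq_square)
qed

text \<open>The coefficient family of z^alpha times the series with coefficients f. The case
  distinction keeps the truncated subtraction honest.\<close>

definition mi_shift :: "('d \<Rightarrow> nat) \<Rightarrow> (('d \<Rightarrow> nat) \<Rightarrow> 'e::complex_hilbert) \<Rightarrow> ('d \<Rightarrow> nat) \<Rightarrow> 'e" where
  "mi_shift \<alpha> f \<beta> = (if \<forall>i. \<alpha> i \<le> \<beta> i then f (\<lambda>i. \<beta> i - \<alpha> i) else 0)"

lemma mi_shift_add [simp]: "mi_shift \<alpha> f (\<lambda>i. \<beta> i + \<alpha> i) = f \<beta>"
  by (simp add: mi_shift_def)

lemma mi_add_has_sum_iff:
  fixes \<alpha> :: "'d \<Rightarrow> nat"
  assumes "\<And>\<beta>. \<not> (\<forall>i. \<alpha> i \<le> \<beta> i) \<Longrightarrow> h \<beta> = 0"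
  shows "((\<lambda>\<beta>. h (\<lambda>i. \<beta> i + \<alpha> i)) has_sum s) UNIV \<longleftrightarrow> (h has_sum s) UNIV"
proof -
  have "((\<lambda>\<beta>. h (\<lambda>i. \<beta> i + \<alpha> i)) has_sum s) UNIV \<longleftrightarrow> (h has_sum s) {\<beta>. \<forall>i. \<alpha> i \<le> \<beta> i}"
    by (rule has_sum_reindex_bij_witness[where i = "\<lambda>\<beta> i. \<beta> i - \<alpha> i" and j = "\<lambda>\<beta> i. \<beta> i + \<alpha> i"]) auto
  also have "\<dots> \<longleftrightarrow> (h has_sum s) UNIV"
    by (rule has_sum_cong_neutral) (use assms in auto)
  finally show ?thesis .
qed

lemma mi_monom_add: "mi_monom z (\<lambda>i. \<beta> i + \<alpha> i) = mi_monom z \<alpha> * mi_monom z \<beta>"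
  by (simp add: mi_monom_def power_add prod.distrib mult.commute)

lemma mi_add_unit: "(\<lambda>j. \<beta> j + mi_Suc i (\<lambda>_. 0) j) = mi_Suc i \<beta>"
  by (auto simp: mi_Suc_def)

lemma Mz_pow_eq:
  fixes F :: "complex ^ 'd \<Rightarrow> 'e::complex_hilbert" and \<alpha> :: "'d::finite \<Rightarrow> nat"
  shows "Mz_pow \<alpha> F z = mi_monom z \<alpha> *\<^sub>C F z"
proof -
  have comm: "Mz i \<circ> Mz j = Mz j \<circ> (Mz i :: (complex ^ 'd \<Rightarrow> 'e) \<Rightarrow> _)" for i j
    by (auto simp: Mz_def fun_eq_iff scaleC_scaleC mult.commute)
  show ?thesis
    unfolding Mz_pow_def
  proof (induction \<alpha> rule: mi_induct)
    case zero
    then show ?case by (simp add: op_pow_0[OF comm])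
  next
    case (Suc \<alpha> i)
    have "op_pow Mz (mi_Suc i \<alpha>) F z = (z $ i) *\<^sub>C op_pow Mz \<alpha> F z"
      unfolding op_pow_Suc[OF comm] by (simp add: Mz_def)
    then show ?case by (simp add: Suc mi_monom_Suc scaleC_scaleC)
  qed
qed

text \<open>The bound M makes multiplication by the coordinates and its adjoint bounded, m does so
  for Delta, and summability on [0, 1) makes point evaluations bounded.\<close>

locale kernel_coefficients =
  fixes a :: "nat \<Rightarrow> real" and m M :: real
  assumes a_pos: "\<And>n. a n > 0"
    and m_pos: "m > 0" and a_ratio_lower: "\<And>n. m * a (Suc n) \<le> a n"
    and a_ratio_upper: "\<And>n. a n \<le> M * a (Suc n)"
    and a_summable: "\<And>x. 0 \<le> x \<Longrightarrow> x < 1 \<Longrightarrow> summable (\<lambda>n. a n * x ^ n)"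
begin

lemma M_pos: "M > 0"
  using a_ratio_upper[of 0] a_pos[of 0] a_pos[of 1] by (simp add: zero_less_mult_iff) (smt (verit) mult_nonpos_nonneg)

lemma hk_weight_pos: "hk_weight a \<alpha> > 0"
  by (simp add: hk_weight_def a_pos mi_gamma_pos)

lemma hk_weight_le_Suc: "hk_weight a \<alpha> \<le> M * hk_weight a (mi_Suc i \<alpha>)"
proof -
  have "hk_weight a \<alpha> \<le> (M * a (Suc (mi_abs \<alpha>))) * mi_gamma (mi_Suc i \<alpha>)"
    unfolding hk_weight_def using a_pos mi_gamma_pos M_pos
    by (intro mult_mono a_ratio_upper mi_gamma_le_Suc) (auto intro: less_imp_le)
  then show ?thesis by (simp add: hk_weight_def)
qed

lemma hk_weight_le_add: "hk_weight a \<beta> \<le> M ^ mi_abs \<alpha> * hk_weight a (\<lambda>i. \<beta> i + \<alpha> i)"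
proof (induction \<alpha> rule: mi_induct)
  case (Suc \<alpha> i)
  have "(\<lambda>j. \<beta> j + mi_Suc i \<alpha> j) = mi_Suc i (\<lambda>j. \<beta> j + \<alpha> j)"
    by (auto simp: mi_Suc_def)
  moreover have "M ^ mi_abs \<alpha> * hk_weight a (\<lambda>i. \<beta> i + \<alpha> i)
      \<le> M ^ mi_abs \<alpha> * (M * hk_weight a (mi_Suc i (\<lambda>j. \<beta> j + \<alpha> j)))"
    using M_pos by (intro mult_left_mono hk_weight_le_Suc) simp
  ultimately show ?case using Suc by (simp add: ac_simps)
qed simp

lemma hk_coeffs_summable:
  "f \<in> hk_coeffs a \<Longrightarrow> (\<lambda>\<alpha>. (norm (f \<alpha>))\<^sup>2 / hk_weight a \<alpha>) summable_on UNIV"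
  by (simp add: hk_coeffs_def)

text \<open>With w the weight, |z^alpha| |f_alpha| <= |z^alpha|^2 w + |f_alpha|^2 / w. The first
  terms sum to k(|z|^2), the second ones to the squared norm of f.\<close>

lemma hk_coeffs_abs_summable:
  fixes f :: "('d::finite \<Rightarrow> nat) \<Rightarrow> 'e::complex_hilbert"
  assumes f: "f \<in> hk_coeffs a" and z: "z \<in> ball 0 1"
  shows "(\<lambda>\<alpha>. norm (mi_monom z \<alpha> *\<^sub>C f \<alpha>)) summable_on UNIV"
proof -
  have "summable (\<lambda>n. a n * (norm z ^ 2) ^ n)"
    using z by (intro a_summable) (auto simp: power_less_one_iff abs_square_less_1)
  moreover have "(\<Sum>\<alpha> | mi_abs \<alpha> = n. (norm (mi_monom z \<alpha>))\<^sup>2 * hk_weight a \<alpha>) = a n * (norm z ^ 2) ^ n" for n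
    unfolding power_mult[symmetric] mi_level_sum_monom[symmetric] sum_distrib_left
    by (intro sum.cong) (auto simp: hk_weight_def)
  ultimately have "(\<lambda>\<alpha>. (norm (mi_monom z \<alpha>))\<^sup>2 * hk_weight a \<alpha>) summable_on UNIV"
    by (intro mi_level_summable_on) (auto intro!: mult_nonneg_nonneg less_imp_le[OF hk_weight_pos])
  then have "(\<lambda>\<alpha>. (norm (mi_monom z \<alpha>))\<^sup>2 * hk_weight a \<alpha> + (norm (f \<alpha>))\<^sup>2 / hk_weight a \<alpha>) summable_on UNIV"
    by (intro summable_on_add hk_coeffs_summable f)
  then show ?thesis
    by (rule summable_on_comparison_test)
       (auto simp: norm_scaleC intro: product_le_weighted_squares hk_weight_pos)
qed

lemma power_series_fun_has_sum:
  assumes "f \<in> hk_coeffs a" "z \<in> ball 0 1"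
  shows "((\<lambda>\<alpha>. mi_monom z \<alpha> *\<^sub>C f \<alpha>) has_sum power_series_fun f z) UNIV"
  using abs_summable_summable[OF hk_coeffs_abs_summable[OF assms]] assms(2)
  by (simp add: power_series_fun_def on_ball_def)

text \<open>Pairing with a fixed vector e reduces the claim to scalar series. It is what makes the
  description in \<open>hk_coeff\<close> meaningful.\<close>

lemma power_series_fun_inj:
  fixes f g :: "('d::finite \<Rightarrow> nat) \<Rightarrow> 'e::complex_hilbert"
  assumes f: "f \<in> hk_coeffs a" and g: "g \<in> hk_coeffs a" and eq: "power_series_fun f = power_series_fun g"
  shows "f = g"
proof
  fix \<alpha>
  have "cinner (f \<alpha> - g \<alpha>) e = 0" for e
  proof (rule multi_power_series_eq_0_imp_coeff_0[where h = "\<lambda>\<alpha>. cinner (f \<alpha> - g \<alpha>) e"])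
    fix z :: "complex ^ 'd" assume z: "z \<in> ball 0 1"
    have "((\<lambda>\<alpha>. mi_monom z \<alpha> *\<^sub>C f \<alpha> + (- (mi_monom z \<alpha> *\<^sub>C g \<alpha>))) has_sum
        power_series_fun f z + (- power_series_fun g z)) UNIV"
      using power_series_fun_has_sum[OF f z] power_series_fun_has_sum[OF g z]
      by (intro has_sum_add) (auto simp: has_sum_uminus)
    from has_sum_bounded_linear[OF cinner.bounded_linear_left this, of e]
    show "((\<lambda>\<alpha>. mi_monom z \<alpha> * cinner (f \<alpha> - g \<alpha>) e) has_sum 0) UNIV"
      by (simp add: eq cinner.add_left cinner.minus_left cinner.diff_left cinner_scaleC_left
          right_diff_distrib cinner.zero_left)
  qed
  from this[of "f \<alpha> - g \<alpha>"] show "f \<alpha> = g \<alpha>"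
    by (simp add: cinner_self)
qed

lemma hk_coeff_power_series_fun:
  "f \<in> hk_coeffs a \<Longrightarrow> hk_coeff a (power_series_fun f) = f"
  unfolding hk_coeff_def by (rule the_equality) (auto intro: power_series_fun_inj)

lemma power_series_fun_in_HK: "f \<in> hk_coeffs a \<Longrightarrow> power_series_fun f \<in> HK a"
  by (simp add: HK_def)

lemma HK_E:
  assumes "F \<in> HK a"
  obtains f where "f \<in> hk_coeffs a" "F = power_series_fun f"
  using assms by (auto simp: HK_def)

section \<open>The inner product of \<open>HK\<close> in terms of coefficients\<close>

lemma norm_hk_inner_term_le:
  "norm (cinner x y / complex_of_real (hk_weight a \<alpha>)) \<le> (norm x)\<^sup>2 / hk_weight a \<alpha> + (norm y)\<^sup>2 / hk_weight a \<alpha>"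
proof -
  have "norm (cinner x y) \<le> norm x * norm y"
    by (rule norm_cinner_le)
  also have "\<dots> \<le> (norm x)\<^sup>2 + (norm y)\<^sup>2"
    using product_le_weighted_squares[of 1] by simp
  finally show ?thesis
    using hk_weight_pos[of \<alpha>] by (simp add: norm_divide add_divide_distrib[symmetric] divide_right_mono)
qed

lemma hk_inner_abs_summable:
  assumes "f \<in> hk_coeffs a" "g \<in> hk_coeffs a"
  shows "(\<lambda>\<alpha>. norm (cinner (f \<alpha>) (g \<alpha>) / complex_of_real (hk_weight a \<alpha>))) summable_on UNIV"
proof -
  have "(\<lambda>\<alpha>. (norm (f \<alpha>))\<^sup>2 / hk_weight a \<alpha> + (norm (g \<alpha>))\<^sup>2 / hk_weight a \<alpha>) summable_on UNIV"
    by (intro summable_on_add hk_coeffs_summable assms)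
  then show ?thesis
  proof (rule summable_on_comparison_test)
    fix \<alpha>
    show "norm (cinner (f \<alpha>) (g \<alpha>) / complex_of_real (hk_weight a \<alpha>))
        \<le> (norm (f \<alpha>))\<^sup>2 / hk_weight a \<alpha> + (norm (g \<alpha>))\<^sup>2 / hk_weight a \<alpha>"
      by (rule norm_hk_inner_term_le)
  qed auto
qed

lemma hk_inner_has_sum:
  assumes "f \<in> hk_coeffs a" "g \<in> hk_coeffs a"
  shows "((\<lambda>\<alpha>. cinner (f \<alpha>) (g \<alpha>) / complex_of_real (hk_weight a \<alpha>)) has_sum
    hk_inner a (power_series_fun f) (power_series_fun g)) UNIV"
  using abs_summable_summable[OF hk_inner_abs_summable[OF assms]]
  by (simp add: hk_inner_def hk_coeff_power_series_fun assms)

text \<open>Weaker than Cauchy-Schwarz, but homogeneity turns it into a linear bound in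
  \<open>bounded_clinear_hk_inner_j\<close>.\<close>

lemma norm_hk_inner_le:
  assumes "f \<in> hk_coeffs a" "g \<in> hk_coeffs a"
  shows "norm (hk_inner a (power_series_fun f) (power_series_fun g))
    \<le> (\<Sum>\<^sub>\<infinity>\<alpha>. (norm (f \<alpha>))\<^sup>2 / hk_weight a \<alpha>) + (\<Sum>\<^sub>\<infinity>\<alpha>. (norm (g \<alpha>))\<^sup>2 / hk_weight a \<alpha>)"
proof -
  have "norm (hk_inner a (power_series_fun f) (power_series_fun g))
      \<le> (\<Sum>\<^sub>\<infinity>\<alpha>. norm (cinner (f \<alpha>) (g \<alpha>) / complex_of_real (hk_weight a \<alpha>)))"
    using norm_infsum_bound[OF hk_inner_abs_summable[OF assms]]
    by (simp add: hk_inner_def hk_coeff_power_series_fun assms)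
  also have "\<dots> \<le> (\<Sum>\<^sub>\<infinity>\<alpha>. (norm (f \<alpha>))\<^sup>2 / hk_weight a \<alpha> + (norm (g \<alpha>))\<^sup>2 / hk_weight a \<alpha>)"
  proof (rule infsum_mono[OF hk_inner_abs_summable[OF assms]])
    show "(\<lambda>\<alpha>. (norm (f \<alpha>))\<^sup>2 / hk_weight a \<alpha> + (norm (g \<alpha>))\<^sup>2 / hk_weight a \<alpha>) summable_on UNIV"
      by (intro summable_on_add hk_coeffs_summable assms)
    fix \<alpha>
    show "norm (cinner (f \<alpha>) (g \<alpha>) / complex_of_real (hk_weight a \<alpha>))
        \<le> (norm (f \<alpha>))\<^sup>2 / hk_weight a \<alpha> + (norm (g \<alpha>))\<^sup>2 / hk_weight a \<alpha>"
      by (rule norm_hk_inner_term_le)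
  qed
  also have "\<dots> = (\<Sum>\<^sub>\<infinity>\<alpha>. (norm (f \<alpha>))\<^sup>2 / hk_weight a \<alpha>) + (\<Sum>\<^sub>\<infinity>\<alpha>. (norm (g \<alpha>))\<^sup>2 / hk_weight a \<alpha>)"
    by (intro infsum_add hk_coeffs_summable assms)
  finally show ?thesis .
qed

lemma hk_inner_commute:
  assumes "f \<in> hk_coeffs a" "g \<in> hk_coeffs a"
  shows "hk_inner a (power_series_fun f) (power_series_fun g)
    = cnj (hk_inner a (power_series_fun g) (power_series_fun f))"
  unfolding hk_inner_def hk_coeff_power_series_fun[OF assms(1)] hk_coeff_power_series_fun[OF assms(2)]
    infsum_cnj[symmetric]
  by (intro infsum_cong) (simp add: cinner_commute[symmetric])

lemma hk_norm_eq:
  fixes f :: "('d::finite \<Rightarrow> nat) \<Rightarrow> 'e::complex_hilbert"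
  assumes "f \<in> hk_coeffs a"
  shows "hk_norm a (power_series_fun f) = sqrt (Re (hk_inner a (power_series_fun f) (power_series_fun f)))"
proof -
  have "((\<lambda>\<alpha>. Re (cinner (f \<alpha>) (f \<alpha>) / complex_of_real (hk_weight a \<alpha>))) has_sum
      Re (hk_inner a (power_series_fun f) (power_series_fun f))) UNIV"
    by (rule has_sum_Re[OF hk_inner_has_sum[OF assms assms]])
  then have "((\<lambda>\<alpha>. (norm (f \<alpha>))\<^sup>2 / hk_weight a \<alpha>) has_sum
      Re (hk_inner a (power_series_fun f) (power_series_fun f))) UNIV"
    by (simp add: cinner_self Re_divide_of_real)
  then show ?thesis
    by (simp add: hk_norm_def hk_coeff_power_series_fun[OF assms] infsumI)
qed

lemma single_in_hk_coeffs: "(\<lambda>\<beta>. if \<beta> = \<alpha> then e else 0) \<in> hk_coeffs a"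
  unfolding hk_coeffs_def mem_Collect_eq
  by (rule has_sum_imp_summable[OF has_sum_finite_neutralI[of "{\<alpha>}"]]) auto

text \<open>Testing against the monomials e z^alpha recovers every coefficient.\<close>

lemma hk_inner_nondegenerate:
  fixes f g :: "('d::finite \<Rightarrow> nat) \<Rightarrow> 'e::complex_hilbert"
  assumes f: "f \<in> hk_coeffs a" and g: "g \<in> hk_coeffs a"
    and eq: "\<And>u. u \<in> hk_coeffs a \<Longrightarrow>
      hk_inner a (power_series_fun u) (power_series_fun f) = hk_inner a (power_series_fun u) (power_series_fun g)"
  shows "f = g"
proof
  fix \<alpha> :: "'d \<Rightarrow> nat"
  have single: "hk_inner a (power_series_fun (\<lambda>\<beta>. if \<beta> = \<alpha> then e else 0)) (power_series_fun h)
      = cinner e (h \<alpha>) / complex_of_real (hk_weight a \<alpha>)" if "h \<in> hk_coeffs a" for h e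
  proof -
    have "((\<lambda>\<beta>. cinner (if \<beta> = \<alpha> then e else 0) (h \<beta>) / complex_of_real (hk_weight a \<beta>)) has_sum
        cinner e (h \<alpha>) / complex_of_real (hk_weight a \<alpha>)) UNIV"
      by (rule has_sum_finite_neutralI[of "{\<alpha>}"]) (auto simp: cinner.zero_left)
    then show ?thesis
      using hk_inner_has_sum[OF single_in_hk_coeffs that] has_sum_unique by blast
  qed
  show "f \<alpha> = g \<alpha>"
  proof (rule cinner_ext)
    fix e
    show "cinner e (f \<alpha>) = cinner e (g \<alpha>)"
      using eq[OF single_in_hk_coeffs, of \<alpha> e] hk_weight_pos[of \<alpha>] by (simp add: single f g)
  qed
qed

subsection \<open>Multiplication operators\<close>

text \<open>Multiplication by z^alpha increases the squared norm at most by the factor M^|alpha|, by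
  \<open>hk_weight_le_add\<close>.\<close>

lemma mi_shift_in_hk_coeffs:
  assumes "f \<in> hk_coeffs a"
  shows "mi_shift \<alpha> f \<in> hk_coeffs a"
proof -
  have "(\<lambda>\<beta>. M ^ mi_abs \<alpha> * ((norm (f \<beta>))\<^sup>2 / hk_weight a \<beta>)) summable_on UNIV"
    by (intro summable_on_cmult_right hk_coeffs_summable assms)
  then have "(\<lambda>\<beta>. (norm (mi_shift \<alpha> f (\<lambda>i. \<beta> i + \<alpha> i)))\<^sup>2 / hk_weight a (\<lambda>i. \<beta> i + \<alpha> i)) summable_on UNIV"
  proof (rule summable_on_comparison_test)
    fix \<beta>
    have "1 / hk_weight a (\<lambda>i. \<beta> i + \<alpha> i) \<le> M ^ mi_abs \<alpha> / hk_weight a \<beta>"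
      using hk_weight_le_add[of \<beta> \<alpha>] hk_weight_pos[of \<beta>] hk_weight_pos[of "\<lambda>i. \<beta> i + \<alpha> i"]
      by (simp add: field_simps)
    from mult_left_mono[OF this, of "(norm (f \<beta>))\<^sup>2"]
    show "(norm (mi_shift \<alpha> f (\<lambda>i. \<beta> i + \<alpha> i)))\<^sup>2 / hk_weight a (\<lambda>i. \<beta> i + \<alpha> i)
        \<le> M ^ mi_abs \<alpha> * ((norm (f \<beta>))\<^sup>2 / hk_weight a \<beta>)"
      by (simp add: mult.commute mult.left_commute)
  qed (auto intro!: divide_nonneg_pos hk_weight_pos)
  then obtain s where "((\<lambda>\<beta>. (norm (mi_shift \<alpha> f (\<lambda>i. \<beta> i + \<alpha> i)))\<^sup>2 / hk_weight a (\<lambda>i. \<beta> i + \<alpha> i)) has_sum s) UNIV"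
    unfolding summable_on_def by blast
  then have "((\<lambda>\<beta>. (norm (mi_shift \<alpha> f \<beta>))\<^sup>2 / hk_weight a \<beta>) has_sum s) UNIV"
    by (subst (asm) mi_add_has_sum_iff[where h = "\<lambda>\<beta>. (norm (mi_shift \<alpha> f \<beta>))\<^sup>2 / hk_weight a \<beta>"])
       (auto simp: mi_shift_def)
  then show ?thesis
    by (auto simp: hk_coeffs_def summable_on_def)
qed

lemma power_series_fun_mi_shift:
  assumes f: "f \<in> hk_coeffs a"
  shows "power_series_fun (mi_shift \<alpha> f) z = mi_monom z \<alpha> *\<^sub>C power_series_fun f z"
proof (cases "z \<in> ball 0 1")
  case True
  have "((\<lambda>\<beta>. mi_monom z \<alpha> *\<^sub>C (mi_monom z \<beta> *\<^sub>C f \<beta>)) has_sum mi_monom z \<alpha> *\<^sub>C power_series_fun f z) UNIV"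
    by (rule has_sum_bounded_linear[OF scaleC.bounded_linear_right power_series_fun_has_sum[OF f True]])
  then have "((\<lambda>\<beta>. mi_monom z (\<lambda>i. \<beta> i + \<alpha> i) *\<^sub>C mi_shift \<alpha> f (\<lambda>i. \<beta> i + \<alpha> i)) has_sum
      mi_monom z \<alpha> *\<^sub>C power_series_fun f z) UNIV"
    by (simp add: mi_monom_add scaleC_scaleC)
  then have "((\<lambda>\<beta>. mi_monom z \<beta> *\<^sub>C mi_shift \<alpha> f \<beta>) has_sum mi_monom z \<alpha> *\<^sub>C power_series_fun f z) UNIV"
    by (subst (asm) mi_add_has_sum_iff[where h = "\<lambda>\<beta>. mi_monom z \<beta> *\<^sub>C mi_shift \<alpha> f \<beta>"])
       (auto simp: mi_shift_def scaleC.zero_right)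
  then show ?thesis
    using power_series_fun_has_sum[OF mi_shift_in_hk_coeffs[OF f] True] has_sum_unique by blast
qed (simp add: power_series_fun_def on_ball_def scaleC.zero_right)

lemma Mz_pow_power_series_fun:
  "f \<in> hk_coeffs a \<Longrightarrow> Mz_pow \<alpha> (power_series_fun f) = power_series_fun (mi_shift \<alpha> f)"
  by (rule ext) (simp add: Mz_pow_eq power_series_fun_mi_shift)

lemma Mz_power_series_fun:
  "f \<in> hk_coeffs a \<Longrightarrow> Mz i (power_series_fun f) = power_series_fun (mi_shift (mi_Suc i (\<lambda>_. 0)) f)"
  by (rule ext) (simp add: Mz_def power_series_fun_mi_shift mi_monom_Suc)

text \<open>Only the coefficients of g at the indices beta + alpha meet z^alpha f. This formula
  yields the adjoint of \<open>Mz\<close> and later the orthogonality relations.\<close>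

lemma hk_inner_mi_shift_has_sum:
  assumes f: "f \<in> hk_coeffs a" and g: "g \<in> hk_coeffs a"
  shows "((\<lambda>\<beta>. cinner (f \<beta>) (g (\<lambda>i. \<beta> i + \<alpha> i)) / complex_of_real (hk_weight a (\<lambda>i. \<beta> i + \<alpha> i))) has_sum
    hk_inner a (power_series_fun (mi_shift \<alpha> f)) (power_series_fun g)) UNIV"
  using hk_inner_has_sum[OF mi_shift_in_hk_coeffs[OF f, of \<alpha>] g]
  by (subst (asm) mi_add_has_sum_iff[where \<alpha> = \<alpha>, symmetric]) (auto simp: mi_shift_def cinner.zero_left)

lemma Mz_adjoint_coeffs:
  assumes f: "f \<in> hk_coeffs a"
  shows "(\<lambda>\<alpha>. complex_of_real (hk_weight a \<alpha> / hk_weight a (mi_Suc i \<alpha>)) *\<^sub>C f (mi_Suc i \<alpha>)) \<in> hk_coeffs a"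
    (is "?g \<in> _")
proof -
  have "(\<lambda>\<alpha>. (norm (f \<alpha>))\<^sup>2 / hk_weight a \<alpha>) summable_on range (mi_Suc i)"
    using hk_coeffs_summable[OF f] by (rule summable_on_subset_banach) simp
  moreover have "inj (mi_Suc i)"
    by (rule inj_on_inverseI[where g = "\<lambda>\<alpha>. \<alpha>(i := \<alpha> i - 1)"]) (auto simp: mi_Suc_def)
  ultimately have "(\<lambda>\<alpha>. (norm (f (mi_Suc i \<alpha>)))\<^sup>2 / hk_weight a (mi_Suc i \<alpha>)) summable_on UNIV"
    by (simp add: summable_on_reindex o_def)
  then have "(\<lambda>\<alpha>. M * ((norm (f (mi_Suc i \<alpha>)))\<^sup>2 / hk_weight a (mi_Suc i \<alpha>))) summable_on UNIV"
    by (rule summable_on_cmult_right)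
  then have "(\<lambda>\<alpha>. (norm (?g \<alpha>))\<^sup>2 / hk_weight a \<alpha>) summable_on UNIV"
  proof (rule summable_on_comparison_test)
    fix \<alpha>
    let ?v = "hk_weight a \<alpha>" and ?w = "hk_weight a (mi_Suc i \<alpha>)"
    have v: "?v > 0" "?w > 0" by (rule hk_weight_pos)+
    have "?v / ?w \<le> M"
      using hk_weight_le_Suc[of \<alpha> i] v by (simp add: field_simps)
    then have "(?v / ?w) * ((norm (f (mi_Suc i \<alpha>)))\<^sup>2 / ?w) \<le> M * ((norm (f (mi_Suc i \<alpha>)))\<^sup>2 / ?w)"
      using v by (intro mult_right_mono) auto
    moreover have "(norm (?g \<alpha>))\<^sup>2 / ?v = (?v / ?w) * ((norm (f (mi_Suc i \<alpha>)))\<^sup>2 / ?w)"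
      using v by (simp add: norm_scaleC norm_divide power_mult_distrib power_divide power2_eq_square)
    ultimately show "(norm (?g \<alpha>))\<^sup>2 / ?v \<le> M * ((norm (f (mi_Suc i \<alpha>)))\<^sup>2 / ?w)"
      by simp
  qed (auto intro!: divide_nonneg_pos hk_weight_pos)
  then show ?thesis by (simp add: hk_coeffs_def)
qed

text \<open>A weighted backward shift: the quotient of weights corrects for pairing in degree alpha
  instead of alpha + e_i.\<close>

lemma Mz_adjoint:
  fixes f :: "('d::finite \<Rightarrow> nat) \<Rightarrow> 'e::complex_hilbert"
  assumes f: "f \<in> hk_coeffs a"
  shows "adj_on (HK a) (hk_inner a) (hk_inner a) (Mz i) (power_series_fun f) =
    power_series_fun (\<lambda>\<alpha>. complex_of_real (hk_weight a \<alpha> / hk_weight a (mi_Suc i \<alpha>)) *\<^sub>C f (mi_Suc i \<alpha>))"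
    (is "_ = power_series_fun ?g")
proof (rule adj_on_eqI)
  have g: "?g \<in> hk_coeffs a" by (rule Mz_adjoint_coeffs[OF f])
  then show "power_series_fun ?g \<in> HK a" by (rule power_series_fun_in_HK)
  show "hk_inner a (Mz i U) (power_series_fun f) = hk_inner a U (power_series_fun ?g)" if U: "U \<in> HK a" for U
  proof -
    obtain u where u: "u \<in> hk_coeffs a" "U = power_series_fun u" using HK_E[OF U] by blast
    have "((\<lambda>\<beta>. cinner (u \<beta>) (f (mi_Suc i \<beta>)) / complex_of_real (hk_weight a (mi_Suc i \<beta>))) has_sum
        hk_inner a (Mz i U) (power_series_fun f)) UNIV"
      using hk_inner_mi_shift_has_sum[OF u(1) f, of "mi_Suc i (\<lambda>_. 0)"]
      by (simp add: mi_add_unit u(2) Mz_power_series_fun[OF u(1)])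
    moreover have "cinner (u \<beta>) (?g \<beta>) / complex_of_real (hk_weight a \<beta>)
        = cinner (u \<beta>) (f (mi_Suc i \<beta>)) / complex_of_real (hk_weight a (mi_Suc i \<beta>))" for \<beta>
      using hk_weight_pos[of \<beta>] by (simp add: cinner_scaleC_right)
    ultimately show ?thesis
      using hk_inner_has_sum[OF u(1) g] has_sum_unique unfolding u(2) by fastforce
  qed
  show "G = power_series_fun ?g"
    if G: "G \<in> HK a" "\<And>U. U \<in> HK a \<Longrightarrow> hk_inner a U G = hk_inner a U (power_series_fun ?g)" for G
  proof -
    obtain h where h: "h \<in> hk_coeffs a" "G = power_series_fun h" using HK_E[OF G(1)] by blast
    have "h = ?g"
      by (rule hk_inner_nondegenerate[OF h(1) g]) (use G(2) power_series_fun_in_HK h(2) in blast)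
    then show ?thesis by (simp add: h(2))
  qed
qed

section \<open>The diagonal operator Delta\<close>

lemma hk_Delta_coeffs:
  fixes f :: "('d::finite \<Rightarrow> nat) \<Rightarrow> 'e::complex_hilbert"
  assumes f: "f \<in> hk_coeffs a"
  shows "(\<lambda>\<alpha>. complex_of_real (a (Suc (mi_abs \<alpha>)) / a (mi_abs \<alpha>)) *\<^sub>C f \<alpha>) \<in> hk_coeffs a"
proof -
  have "(\<lambda>\<alpha>. (1 / m)\<^sup>2 * ((norm (f \<alpha>))\<^sup>2 / hk_weight a \<alpha>)) summable_on UNIV"
    by (intro summable_on_cmult_right hk_coeffs_summable f)
  then have "(\<lambda>\<alpha>. (norm (complex_of_real (a (Suc (mi_abs \<alpha>)) / a (mi_abs \<alpha>)) *\<^sub>C f \<alpha>))\<^sup>2 / hk_weight a \<alpha>) summable_on UNIV"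
  proof (rule summable_on_comparison_test)
    fix \<alpha> :: "'d \<Rightarrow> nat"
    let ?q = "a (Suc (mi_abs \<alpha>)) / a (mi_abs \<alpha>)"
    \<comment> \<open>The diagonal entries of Delta are at most 1 / m.\<close>
    have q: "0 \<le> ?q" "?q \<le> 1 / m"
      using a_pos[of "mi_abs \<alpha>"] a_pos[of "Suc (mi_abs \<alpha>)"] m_pos a_ratio_lower[of "mi_abs \<alpha>"]
      by (simp_all add: field_simps)
    then have "?q\<^sup>2 * ((norm (f \<alpha>))\<^sup>2 / hk_weight a \<alpha>) \<le> (1 / m)\<^sup>2 * ((norm (f \<alpha>))\<^sup>2 / hk_weight a \<alpha>)"
      using hk_weight_pos[of \<alpha>] by (intro mult_right_mono power_mono) auto
    then show "(norm (complex_of_real ?q *\<^sub>C f \<alpha>))\<^sup>2 / hk_weight a \<alpha>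
        \<le> (1 / m)\<^sup>2 * ((norm (f \<alpha>))\<^sup>2 / hk_weight a \<alpha>)"
      by (simp add: norm_scaleC power_mult_distrib norm_divide power_divide)
  qed (auto intro!: divide_nonneg_pos hk_weight_pos)
  then show ?thesis by (simp add: hk_coeffs_def)
qed

lemma hk_Delta_power_series_fun:
  assumes "f \<in> hk_coeffs a"
  shows "hk_Delta a (power_series_fun f) =
    power_series_fun (\<lambda>\<alpha>. complex_of_real (a (Suc (mi_abs \<alpha>)) / a (mi_abs \<alpha>)) *\<^sub>C f \<alpha>)"
  by (simp add: hk_Delta_def hk_coeff_power_series_fun assms)

end

subsection \<open>Growth of the coefficients\<close>

context kernel_coefficients
begin

lemma ratio_limit_ge_1:
  assumes r: "(\<lambda>n. a n / a (Suc n)) \<longlonglongrightarrow> r"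
  shows "r \<ge> 1"
proof (rule ccontr)
  assume "\<not> r \<ge> 1"
  have rad: "conv_radius a = ereal r"
  proof (rule conv_radius_ratio_limit_ereal)
    show "\<forall>\<^sub>F n in sequentially. a n \<noteq> 0"
      using a_pos by (simp add: less_imp_neq[symmetric])
    show "(\<lambda>n. ereal (norm (a n) / norm (a (Suc n)))) \<longlonglongrightarrow> ereal r"
      using r a_pos by (simp add: abs_of_pos)
  qed
  \<comment> \<open>A point of [0, 1) beyond the radius of convergence; \<open>max 0 r\<close> keeps
    it nonnegative whatever the sign of r.\<close>
  define x where "x = (max 0 r + 1) / 2"
  have x: "0 \<le> x" "x < 1" "r < x" using \<open>\<not> r \<ge> 1\<close> by (auto simp: x_def)
  have "ereal (norm x) \<le> conv_radius a"
    by (rule conv_radius_geI[OF a_summable[OF x(1,2)]])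
  then show False using rad x by simp
qed

text \<open>From N on, each step of the index costs a factor q. Each of the at most N - k earlier
  steps costs M <= L q with L = max 1 (M / q), so the excess is at most L^(N - k), which is 1 once k
  >= N.\<close>

lemma a_le_geometric:
  assumes q: "q > 0" and N: "\<And>n. n \<ge> N \<Longrightarrow> a n \<le> q * a (Suc n)"
  shows "a k \<le> (max 1 (M / q)) ^ N * q ^ n * a (k + n)"
proof -
  define L where "L = max 1 (M / q)"
  have L: "L \<ge> 1" "M \<le> L * q"
    using q mult_right_mono[of "M / q" L q] by (simp_all add: L_def)
  have "a k \<le> L ^ (N - k) * q ^ n * a (k + n)" for k
  proof (induction n arbitrary: k)
    case 0
    have "1 * a k \<le> L ^ (N - k) * a k"
      using L a_pos[of k] by (intro mult_right_mono one_le_power) auto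
    then show ?case by simp
  next
    case (Suc n)
    have IH: "a (Suc k) \<le> L ^ (N - Suc k) * q ^ n * a (Suc k + n)" by (rule Suc)
    show ?case
    proof (cases "k < N")
      case True
      have "a k \<le> M * a (Suc k)" by (rule a_ratio_upper)
      also have "\<dots> \<le> (L * q) * a (Suc k)"
        using L a_pos[of "Suc k"] by (intro mult_right_mono) auto
      also have "\<dots> \<le> (L * q) * (L ^ (N - Suc k) * q ^ n * a (Suc k + n))"
        using L q by (intro mult_left_mono IH) auto
      also have "\<dots> = L ^ Suc (N - Suc k) * q ^ Suc n * a (k + Suc n)"
        by simp
      also have "Suc (N - Suc k) = N - k" using True by simp
      finally show ?thesis .
    next
      case False
      then have "a k \<le> q * a (Suc k)" by (intro N) simp
      also have "\<dots> \<le> q * (L ^ (N - Suc k) * q ^ n * a (Suc k + n))"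
        using q by (intro mult_left_mono IH) auto
      finally show ?thesis using False by simp
    qed
  qed
  also have "L ^ (N - k) * q ^ n * a (k + n) \<le> L ^ N * q ^ n * a (k + n)"
    using L q a_pos[of "k + n"] by (intro mult_right_mono power_increasing) auto
  finally show ?thesis by (simp add: L_def)
qed

(* With s n = sup a_k / a_(k+n), the norm of the n-th power of z T* is at most |z|^n sqrt (s n), and
   sqrt (s n) grows like sqrt r ^ n, whereas a_n decays like r ^ -n; since r >= 1, this leaves room. *)
lemma coefficient_growth:
  assumes r: "(\<lambda>n. a n / a (Suc n)) \<longlonglongrightarrow> r" and R: "0 < R" "R < 1"
  obtains s where "\<And>n. s n \<ge> 0" "\<And>k n. a k \<le> s n * a (k + n)"
    "summable (\<lambda>n. real (Suc n) * a (Suc n) * R ^ n * sqrt (s n))"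
proof -
  have r1: "r \<ge> 1" by (rule ratio_limit_ge_1[OF r])
  \<comment> \<open>Chosen so that R^2 (1 + t) < 1. Then q = r (1 + t) satisfies R^2 q < r <= r^2,
    hence R sqrt q < r, which is what the ratio test below needs.\<close>
  define t where "t = (1 - R\<^sup>2) / 2"
  have R2: "0 < R\<^sup>2" "R\<^sup>2 < 1" using R by (auto simp: power_less_one_iff abs_square_less_1)
  have t: "0 < t" "R\<^sup>2 * (1 + t) < 1"
  proof -
    show "0 < t" using R2 by (simp add: t_def)
    have "R\<^sup>2 * t < 1 * (1 - R\<^sup>2)"
      using R2 by (intro mult_strict_mono) (auto simp: t_def)
    then show "R\<^sup>2 * (1 + t) < 1" by (simp add: algebra_simps)
  qed
  define q where "q = r * (1 + t)"
  have q: "q > 0" "r < q" using r1 t by (auto simp: q_def)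
  have "R\<^sup>2 * q < 1 * r"
    using t r1 mult_strict_right_mono[of "R\<^sup>2 * (1 + t)" 1 r] by (simp add: q_def ac_simps)
  also have "1 * r \<le> r\<^sup>2" using r1 by (simp add: power2_eq_square)
  finally have "(R * sqrt q)\<^sup>2 < r\<^sup>2" using q by (simp add: power_mult_distrib)
  then have Rq: "R * sqrt q < r" using r1 by (auto intro: power_less_imp_less_base)
  have Rq0: "R * sqrt q > 0" using R q by simp
  have "\<forall>\<^sub>F n in sequentially. a n / a (Suc n) < q"
    using order_tendstoD(2)[OF r q(2)] .
  then obtain N where N: "\<And>n. n \<ge> N \<Longrightarrow> a n / a (Suc n) < q"
    unfolding eventually_sequentially by blast
  define K where "K = (max 1 (M / q)) ^ N"
  have K: "K > 0" by (simp add: K_def)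
  have aK: "a k \<le> K * q ^ n * a (k + n)" for k n
    unfolding K_def using N a_pos by (intro a_le_geometric q) (simp add: less_imp_le pos_divide_less_eq)
  \<comment> \<open>The factor n + 1 makes room for the derivative of the series taken term by
    term.\<close>
  define g where "g n = real (Suc n) * a (Suc n) * R ^ n * sqrt (K * q ^ n)" for n
  have g_eq: "g n = sqrt K * (real (Suc n) * a (Suc n) * (R * sqrt q) ^ n)" for n
    by (simp add: g_def real_sqrt_mult real_sqrt_power power_mult_distrib ac_simps)
  have g_pos: "g n > 0" for n
    unfolding g_eq using K a_pos R q by (intro mult_pos_pos zero_less_power) auto
  have "g n / g (Suc n) = (real (Suc n) / real (Suc (Suc n))) * (a (Suc n) / a (Suc (Suc n))) / (R * sqrt q)" for n
  proof -
    have cancel: "(u * (p * b * x)) / (u * (p' * b' * (v * x))) = (p / p') * (b / b') / v"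
      if "u \<noteq> 0" "x \<noteq> 0" for u p b x p' b' v :: real
      using that by simp
    show ?thesis
      unfolding g_eq power_Suc using K Rq0 by (intro cancel zero_less_power[THEN less_imp_neq, symmetric]) auto
  qed
  moreover have "(\<lambda>n. (real (Suc n) / real (Suc (Suc n))) * (a (Suc n) / a (Suc (Suc n))) / (R * sqrt q))
      \<longlonglongrightarrow> 1 * r / (R * sqrt q)"
    using r R q by (intro tendsto_intros LIMSEQ_Suc[OF LIMSEQ_n_over_Suc_n] LIMSEQ_Suc[OF r]) auto
  ultimately have "(\<lambda>n. g n / g (Suc n)) \<longlonglongrightarrow> r / (R * sqrt q)"
    by simp
  then have "liminf (\<lambda>n. ereal (g n / g (Suc n))) = ereal (r / (R * sqrt q))"
    by (intro lim_imp_Liminf) auto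
  moreover have "1 < r / (R * sqrt q)" using Rq Rq0 by simp
  ultimately have "summable g"
    using g_pos by (intro ratio_test_convergence[of g]) simp_all
  then show ?thesis
    using that[of "\<lambda>n. K * q ^ n"] K q aK unfolding g_def by simp
qed

end

subsection \<open>Pure K-contractions\<close>

locale pure_contraction = kernel_coefficients a m M for a :: "nat \<Rightarrow> real" and m M :: real +
  fixes c :: "nat \<Rightarrow> complex" and T :: "'d::finite \<Rightarrow> 'h::complex_hilbert \<Rightarrow> 'h"
  assumes pure: "pure_K_contraction a c T"
begin

abbreviation Tadj :: "'d \<Rightarrow> 'h \<Rightarrow> 'h" where
  "Tadj i \<equiv> cadjoint (T i)"

abbreviation Tadj_pow :: "('d \<Rightarrow> nat) \<Rightarrow> 'h \<Rightarrow> 'h" where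
  "Tadj_pow \<alpha> \<equiv> op_pow (\<lambda>i. cadjoint (T i)) \<alpha>"

lemma bounded_clinear_T: "bounded_clinear (T i)"
  using pure by (simp add: pure_K_contraction_def K_contraction_def)

lemma bounded_clinear_Tadj: "bounded_clinear (Tadj i)"
  by (rule bounded_clinear_cadjoint[OF bounded_clinear_T])

lemma Tadj_comm: "Tadj i \<circ> Tadj j = Tadj j \<circ> Tadj i"
  using pure by (intro cadjoint_commute bounded_clinear_T)
    (simp add: pure_K_contraction_def K_contraction_def)

lemma Tadj_pow_0 [simp]: "Tadj_pow (\<lambda>_. 0) x = x"
  by (simp add: op_pow_0[OF Tadj_comm])

lemma Tadj_pow_Suc: "Tadj_pow (mi_Suc i \<alpha>) x = Tadj_pow \<alpha> (Tadj i x)"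
  using op_pow_Suc[where S = "\<lambda>i. cadjoint (T i)" and i = i and \<alpha> = \<alpha>, OF Tadj_comm]
    op_pow_comm[where S = "\<lambda>i. cadjoint (T i)" and i = i and \<alpha> = \<alpha>, OF Tadj_comm]
  by (simp add: fun_eq_iff)

lemma Tadj_pow_add: "Tadj_pow (\<lambda>i. \<alpha> i + \<beta> i) x = Tadj_pow \<alpha> (Tadj_pow \<beta> x)"
  by (simp add: op_pow_add[OF Tadj_comm])

lemma bounded_clinear_Tadj_pow: "bounded_clinear (Tadj_pow \<alpha>)"
  by (rule bounded_clinear_op_pow[OF Tadj_comm bounded_clinear_Tadj])

lemma positive_inv_K: "positive_op (inv_K c T)"
  using pure by (simp add: pure_K_contraction_def K_contraction_def)

text \<open>The identity C*C = (1/K)(T) as an identity of forms. It covers both the root inside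
  \<open>Delta_T\<close> and the given C, whose target spaces differ.\<close>

definition is_factor :: "('h \<Rightarrow> 'e::complex_hilbert) \<Rightarrow> bool" where
  "is_factor C \<longleftrightarrow> bounded_clinear C \<and> (\<forall>x y. cinner (C x) (C y) = cinner (inv_K c T x) y)"

lemma is_factor_sqrt: "is_factor (sqrt_op (inv_K c T))"
proof -
  note sq = sqrt_op_works[OF positive_inv_K]
  show ?thesis
    unfolding is_factor_def
  proof (intro conjI allI)
    show "bounded_clinear (sqrt_op (inv_K c T))"
      using sq(1) by (simp add: positive_op_def)
    fix x y
    show "cinner (sqrt_op (inv_K c T) x) (sqrt_op (inv_K c T) y) = cinner (inv_K c T x) y"
      by (simp only: positive_op_self_adjoint[OF sq(1), symmetric] sq(2))
  qed
qed

text \<open>Moving the outermost T_i across the inner product reproduces the claim for n at T_i* x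
  and T_i* y, and Pascal's rule collects the d sums.\<close>

lemma factor_level_form:
  assumes "is_factor C"
  shows "cinner ((sigma_op T ^^ n) (inv_K c T) x) y
    = (\<Sum>\<alpha> | mi_abs \<alpha> = n. mi_gamma \<alpha> *\<^sub>R cinner (C (Tadj_pow \<alpha> x)) (C (Tadj_pow \<alpha> y)))"
proof (induction n arbitrary: x y)
  case 0
  then show ?case using assms by (simp add: mi_level_0 is_factor_def)
next
  case (Suc n)
  have "cinner ((sigma_op T ^^ Suc n) (inv_K c T) x) y
      = (\<Sum>i\<in>UNIV. cinner ((sigma_op T ^^ n) (inv_K c T) (Tadj i x)) (Tadj i y))"
    by (simp add: sigma_op_def[of T "(sigma_op T ^^ n) (inv_K c T)"] cinner.sum_left
        cinner_cadjoint[OF bounded_clinear_T])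
  also have "\<dots> = (\<Sum>i\<in>UNIV. \<Sum>\<alpha> | mi_abs \<alpha> = n. mi_gamma \<alpha> *\<^sub>R
      cinner (C (Tadj_pow (mi_Suc i \<alpha>) x)) (C (Tadj_pow (mi_Suc i \<alpha>) y)))"
    by (simp only: Suc Tadj_pow_Suc)
  also have "\<dots> = (\<Sum>\<alpha> | mi_abs \<alpha> = Suc n. mi_gamma \<alpha> *\<^sub>R cinner (C (Tadj_pow \<alpha> x)) (C (Tadj_pow \<alpha> y)))"
    by (rule mi_level_sum_Suc[symmetric])
  finally show ?case .
qed

text \<open>For a factor C this is the quadratic form of sigma_T^n((1/K)(T)) at x, by
  \<open>factor_level_form\<close>.\<close>

definition level_form :: "('h \<Rightarrow> 'e::complex_hilbert) \<Rightarrow> nat \<Rightarrow> 'h \<Rightarrow> real" where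
  "level_form C n x = (\<Sum>\<alpha> | mi_abs \<alpha> = n. mi_gamma \<alpha> * (norm (C (Tadj_pow \<alpha> x)))\<^sup>2)"

lemma level_form_nonneg: "level_form C n x \<ge> 0"
  unfolding level_form_def using mi_gamma_pos by (intro sum_nonneg mult_nonneg_nonneg) (auto intro: less_imp_le)

text \<open>Purity paired with x. In terms of coefficients this is the isometry of j_C.\<close>

lemma factor_Parseval:
  assumes "is_factor C"
  shows "(\<lambda>n. a n * level_form C n x) sums (norm x)\<^sup>2"
proof -
  have "(\<lambda>N. x - (\<Sum>n\<le>N. a n *\<^sub>R (sigma_op T ^^ n) (inv_K c T) x)) \<longlonglongrightarrow> 0"
    using pure by (simp add: pure_K_contraction_def)
  then have "(\<lambda>N. x - (x - (\<Sum>n\<le>N. a n *\<^sub>R (sigma_op T ^^ n) (inv_K c T) x))) \<longlonglongrightarrow> x - 0"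
    by (intro tendsto_intros)
  then have "(\<lambda>n. a n *\<^sub>R (sigma_op T ^^ n) (inv_K c T) x) sums x"
    by (simp add: sums_def_le)
  then have "(\<lambda>n. Re (cinner (a n *\<^sub>R (sigma_op T ^^ n) (inv_K c T) x) x)) sums Re (cinner x x)"
    by (intro sums_Re bounded_linear.sums[OF cinner.bounded_linear_left])
  moreover have "Re (cinner (a n *\<^sub>R (sigma_op T ^^ n) (inv_K c T) x) x) = a n * level_form C n x" for n
    unfolding cinner.scaleR_left factor_level_form[OF assms] level_form_def by (simp add: cinner_self)
  ultimately show ?thesis by (simp add: cinner_self)
qed

text \<open>Reflects sigma_T^n applied to sigma_T^k being sigma_T^(k + n).\<close>

lemma level_form_add:
  "(\<Sum>\<alpha> | mi_abs \<alpha> = n. mi_gamma \<alpha> * level_form C k (Tadj_pow \<alpha> x)) = level_form C (k + n) x"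
proof (induction n arbitrary: x)
  case 0
  then show ?case by (simp add: mi_level_0)
next
  case (Suc n)
  have "(\<Sum>\<alpha> | mi_abs \<alpha> = Suc n. mi_gamma \<alpha> * level_form C k (Tadj_pow \<alpha> x))
      = (\<Sum>i\<in>UNIV. \<Sum>\<alpha> | mi_abs \<alpha> = n. mi_gamma \<alpha> * level_form C k (Tadj_pow \<alpha> (Tadj i x)))"
    using mi_level_sum_Suc[of "\<lambda>\<alpha>. level_form C k (Tadj_pow \<alpha> x)" n] by (simp add: Tadj_pow_Suc)
  also have "\<dots> = (\<Sum>i\<in>UNIV. level_form C (k + n) (Tadj i x))"
    by (simp only: Suc)
  also have "\<dots> = level_form C (Suc (k + n)) x"
    using mi_level_sum_Suc[of "\<lambda>\<alpha>. (norm (C (Tadj_pow \<alpha> x)))\<^sup>2" "k + n"]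
    by (simp add: level_form_def Tadj_pow_Suc)
  finally show ?case by simp
qed

text \<open>The left-hand side is the form of sigma_T^n(1). Expanding each norm by
  \<open>factor_Parseval\<close> gives the sum of a_k \<open>level_form C (k + n) x\<close>;
  replacing a_k by s a_(k + n) leaves s times a tail of the series for |x|^2.\<close>

lemma Tadj_pow_level_bound:
  assumes s: "\<And>k. a k \<le> s * a (k + n)"
  shows "(\<Sum>\<alpha> | mi_abs \<alpha> = n. mi_gamma \<alpha> * (norm (Tadj_pow \<alpha> x))\<^sup>2) \<le> s * (norm x)\<^sup>2"
proof -
  define C where "C = sqrt_op (inv_K c T)"
  have C: "is_factor C" unfolding C_def by (rule is_factor_sqrt)
  have s0: "s \<ge> 0"
    using s[of 0] a_pos[of 0] a_pos[of n] by (metis add_0 less_le_not_le linorder_not_less mult_nonpos_nonneg nle_le order_trans)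
  have "(\<lambda>k. \<Sum>\<alpha> | mi_abs \<alpha> = n. mi_gamma \<alpha> * (a k * level_form C k (Tadj_pow \<alpha> x)))
      sums (\<Sum>\<alpha> | mi_abs \<alpha> = n. mi_gamma \<alpha> * (norm (Tadj_pow \<alpha> x))\<^sup>2)"
    by (intro sums_sum sums_mult factor_Parseval C)
  moreover have "(\<Sum>\<alpha> | mi_abs \<alpha> = n. mi_gamma \<alpha> * (a k * level_form C k (Tadj_pow \<alpha> x)))
      = a k * level_form C (k + n) x" for k
    unfolding level_form_add[symmetric] sum_distrib_left by (intro sum.cong) auto
  ultimately have 1: "(\<lambda>k. a k * level_form C (k + n) x)
      sums (\<Sum>\<alpha> | mi_abs \<alpha> = n. mi_gamma \<alpha> * (norm (Tadj_pow \<alpha> x))\<^sup>2)" by simp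
  have "(\<lambda>k. a (k + n) * level_form C (k + n) x) sums ((norm x)\<^sup>2 - (\<Sum>k<n. a k * level_form C k x))"
    by (rule sums_split_initial_segment[OF factor_Parseval[OF C]])
  then have 2: "(\<lambda>k. s * (a (k + n) * level_form C (k + n) x))
      sums (s * ((norm x)\<^sup>2 - (\<Sum>k<n. a k * level_form C k x)))"
    by (rule sums_mult)
  have le: "(\<Sum>\<alpha> | mi_abs \<alpha> = n. mi_gamma \<alpha> * (norm (Tadj_pow \<alpha> x))\<^sup>2)
      \<le> s * ((norm x)\<^sup>2 - (\<Sum>k<n. a k * level_form C k x))"
  proof (rule sums_le[OF _ 1 2])
    fix k
    show "a k * level_form C (k + n) x \<le> s * (a (k + n) * level_form C (k + n) x)"
      using mult_right_mono[OF s level_form_nonneg] by (simp add: mult.assoc)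
  qed
  have "0 \<le> (\<Sum>k<n. a k * level_form C k x)"
    using a_pos by (intro sum_nonneg mult_nonneg_nonneg level_form_nonneg) (rule less_imp_le)
  then have "s * ((norm x)\<^sup>2 - (\<Sum>k<n. a k * level_form C k x)) \<le> s * (norm x)\<^sup>2"
    using s0 by (intro mult_left_mono) auto
  with le show ?thesis by (rule order_trans)
qed

section \<open>The operators ZT* and the norms of their powers\<close>

definition zT :: "complex ^ 'd \<Rightarrow> 'h \<Rightarrow> 'h" where
  "zT z = row_Z z \<circ> col_adj T"

lemma zT_eq: "zT z = (\<lambda>x. \<Sum>i\<in>UNIV. (z $ i) *\<^sub>C Tadj i x)"
  by (simp add: zT_def row_Z_def col_adj_def fun_eq_iff)

lemma bounded_clinear_zT: "bounded_clinear (zT z)"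
  unfolding zT_eq by (intro bounded_clinear_sum bounded_clinear_scaleC bounded_clinear_Tadj)

lemma zT_funpow:
  "(zT z ^^ n) x = (\<Sum>\<alpha> | mi_abs \<alpha> = n. mi_gamma \<alpha> *\<^sub>R mi_monom z \<alpha> *\<^sub>C Tadj_pow \<alpha> x)"
  unfolding zT_eq by (rule linear_combination_funpow[OF Tadj_comm bounded_clinear_Tadj])

lemma norm_zT_funpow_le:
  assumes s: "\<And>k. a k \<le> s * a (k + n)"
  shows "norm ((zT z ^^ n) x) \<le> norm z ^ n * sqrt s * norm x"
proof -
  have "norm ((zT z ^^ n) x) \<le> norm z ^ n * sqrt (\<Sum>\<alpha> | mi_abs \<alpha> = n. mi_gamma \<alpha> * (norm (Tadj_pow \<alpha> x))\<^sup>2)"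
    unfolding zT_funpow by (rule mi_level_Cauchy_Schwarz)
  also have "\<dots> \<le> norm z ^ n * sqrt (s * (norm x)\<^sup>2)"
    by (intro mult_left_mono real_sqrt_le_mono Tadj_pow_level_bound s) simp
  finally show ?thesis by (simp add: real_sqrt_mult)
qed

subsection \<open>The isometry and the operator Delta\<close>

definition j_coeff :: "('h \<Rightarrow> 'e::complex_hilbert) \<Rightarrow> 'h \<Rightarrow> ('d \<Rightarrow> nat) \<Rightarrow> 'e" where
  "j_coeff C x \<alpha> = complex_of_real (hk_weight a \<alpha>) *\<^sub>C C (Tadj_pow \<alpha> x)"

lemma j_map_eq: "j_map a T C x = power_series_fun (j_coeff C x)"
  by (simp add: j_map_def j_coeff_def[abs_def])

lemma j_coeff_norm:
  assumes "is_factor C"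
  shows "j_coeff C x \<in> hk_coeffs a"
    and "(\<Sum>\<^sub>\<infinity>\<alpha>. (norm (j_coeff C x \<alpha>))\<^sup>2 / hk_weight a \<alpha>) = (norm x)\<^sup>2"
proof -
  have weighted: "(norm (j_coeff C x \<alpha>))\<^sup>2 / hk_weight a \<alpha> = hk_weight a \<alpha> * (norm (C (Tadj_pow \<alpha> x)))\<^sup>2" for \<alpha>
    using hk_weight_pos[of \<alpha>] by (simp add: j_coeff_def norm_scaleC power_mult_distrib power2_eq_square)
  have level: "(\<Sum>\<alpha> | mi_abs \<alpha> = n. (norm (j_coeff C x \<alpha>))\<^sup>2 / hk_weight a \<alpha>) = a n * level_form C n x" for n
    unfolding weighted level_form_def sum_distrib_left by (intro sum.cong) (auto simp: hk_weight_def)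
  have sm: "(\<lambda>\<alpha>. (norm (j_coeff C x \<alpha>))\<^sup>2 / hk_weight a \<alpha>) summable_on UNIV"
    using factor_Parseval[OF assms, of x]
    by (intro mi_level_summable_on) (auto simp: level sums_iff intro!: divide_nonneg_pos hk_weight_pos)
  then show "j_coeff C x \<in> hk_coeffs a" by (simp add: hk_coeffs_def)
  from mi_level_has_sum[OF has_sum_infsum[OF sm]]
  show "(\<Sum>\<^sub>\<infinity>\<alpha>. (norm (j_coeff C x \<alpha>))\<^sup>2 / hk_weight a \<alpha>) = (norm x)\<^sup>2"
    using factor_Parseval[OF assms, of x] by (simp add: level sums_iff)
qed

text \<open>The premise of \<open>adj_on_UNIV\<close> for the adjoint of j. The isometry of j gives
  the bound |u|^2 + G, which at unit vectors is 1 + G; homogeneity does the rest.\<close>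

lemma bounded_clinear_hk_inner_j:
  assumes C: "is_factor C" and g: "g \<in> hk_coeffs a"
  shows "bounded_clinear (\<lambda>u. hk_inner a (j_map a T C u) (power_series_fun g))"
proof -
  define \<phi> where "\<phi> u = hk_inner a (j_map a T C u) (power_series_fun g)" for u
  define G where "G = (\<Sum>\<^sub>\<infinity>\<alpha>. (norm (g \<alpha>))\<^sup>2 / hk_weight a \<alpha>)"
  have bC: "bounded_clinear (\<lambda>x. C (Tadj_pow \<alpha> x))" for \<alpha>
    using C unfolding is_factor_def by (blast intro: bounded_clinear_compose[OF _ bounded_clinear_Tadj_pow])
  note linC = bounded_linear.linear[OF bounded_clinearD(1)[OF bC]]
  have \<phi>: "((\<lambda>\<alpha>. cinner (j_coeff C u \<alpha>) (g \<alpha>) / complex_of_real (hk_weight a \<alpha>)) has_sum \<phi> u) UNIV" for u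
    unfolding \<phi>_def j_map_eq by (rule hk_inner_has_sum[OF j_coeff_norm(1)[OF C] g])
  have scale: "\<phi> (s *\<^sub>C u) = s * \<phi> u" for s u
  proof -
    have "j_coeff C (s *\<^sub>C u) \<alpha> = s *\<^sub>C j_coeff C u \<alpha>" for \<alpha>
      by (simp add: j_coeff_def bounded_clinearD(2)[OF bC] scaleC_scaleC mult.commute)
    then have "((\<lambda>\<alpha>. s * (cinner (j_coeff C u \<alpha>) (g \<alpha>) / complex_of_real (hk_weight a \<alpha>))) has_sum \<phi> (s *\<^sub>C u)) UNIV"
      using \<phi>[of "s *\<^sub>C u"] by (simp add: cinner_scaleC_left)
    then show ?thesis
      using has_sum_cmult_right[OF \<phi>[of u], of s] has_sum_unique by blast
  qed
  have add: "\<phi> (u + v) = \<phi> u + \<phi> v" for u v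
  proof -
    have "j_coeff C (u + v) \<alpha> = j_coeff C u \<alpha> + j_coeff C v \<alpha>" for \<alpha>
      by (simp add: j_coeff_def linear_add[OF linC] scaleC_add_right)
    then have "((\<lambda>\<alpha>. cinner (j_coeff C u \<alpha>) (g \<alpha>) / complex_of_real (hk_weight a \<alpha>)
        + cinner (j_coeff C v \<alpha>) (g \<alpha>) / complex_of_real (hk_weight a \<alpha>)) has_sum \<phi> (u + v)) UNIV"
      using \<phi>[of "u + v"] by (simp add: cinner_add_left add_divide_distrib)
    then show ?thesis
      using has_sum_add[OF \<phi>[of u] \<phi>[of v]] has_sum_unique by blast
  qed
  have le: "norm (\<phi> u) \<le> (norm u)\<^sup>2 + G" for u
    using norm_hk_inner_le[OF j_coeff_norm(1)[OF C] g, of u]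
    by (simp add: \<phi>_def j_map_eq j_coeff_norm(2)[OF C] G_def)
  have bound: "norm (\<phi> u) \<le> norm u * (1 + G)" for u
  proof (cases "u = 0")
    case True
    then show ?thesis using scale[of 0 u] by (simp add: scaleC.zero_left)
  next
    case False
    define w where "w = complex_of_real (1 / norm u) *\<^sub>C u"
    have w: "norm w = 1" using False by (simp add: w_def norm_scaleC norm_divide)
    have u: "u = complex_of_real (norm u) *\<^sub>C w"
      using False by (simp add: w_def scaleC_scaleC of_real_mult[symmetric] del: of_real_mult)
    have "norm (\<phi> u) = norm u * norm (\<phi> w)"
      by (subst u) (simp add: scale norm_mult)
    also have "\<dots> \<le> norm u * (1 + G)"
      using le[of w] w by (intro mult_left_mono) auto
    finally show ?thesis .
  qed
  have "bounded_clinear \<phi>"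
    by (rule bounded_clinearI[of _ "1 + G"]) (simp_all add: add scale bound scaleC_complex_def)
  then show ?thesis by (simp add: \<phi>_def[abs_def])
qed

lemma Delta_T_sums:
  assumes C: "is_factor C"
  shows "(\<lambda>n. a (Suc n) *\<^sub>R (\<Sum>\<alpha> | mi_abs \<alpha> = n. mi_gamma \<alpha> *\<^sub>R cinner (C (Tadj_pow \<alpha> u)) (C (Tadj_pow \<alpha> x))))
    sums cinner u (Delta_T a c T x)"
proof -
  define C0 where "C0 = sqrt_op (inv_K c T)"
  have C0: "is_factor C0" unfolding C0_def by (rule is_factor_sqrt)
  define g where "g \<alpha> = complex_of_real (a (Suc (mi_abs \<alpha>)) / a (mi_abs \<alpha>)) *\<^sub>C j_coeff C0 x \<alpha>" for \<alpha>
  have g: "g \<in> hk_coeffs a"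
    unfolding g_def[abs_def] by (rule hk_Delta_coeffs[OF j_coeff_norm(1)[OF C0]])
  have Dj: "hk_Delta a (j_map a T C0 x) = power_series_fun g"
    unfolding j_map_eq hk_Delta_power_series_fun[OF j_coeff_norm(1)[OF C0]] g_def[abs_def] ..
  have "Delta_T a c T x = adj_on UNIV cinner (hk_inner a) (j_map a T C0) (power_series_fun g)"
    by (simp add: Delta_T_def Let_def C0_def[symmetric] Dj)
  then have "hk_inner a (power_series_fun (j_coeff C0 u)) (power_series_fun g) = cinner u (Delta_T a c T x)"
    using adj_on_UNIV[of "hk_inner a" "j_map a T C0", OF bounded_clinear_hk_inner_j[OF C0 g], of u]
    by (simp add: j_map_eq)
  then have "(\<lambda>n. \<Sum>\<alpha> | mi_abs \<alpha> = n. cinner (j_coeff C0 u \<alpha>) (g \<alpha>) / complex_of_real (hk_weight a \<alpha>))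
      sums cinner u (Delta_T a c T x)"
    using mi_level_has_sum[OF hk_inner_has_sum[OF j_coeff_norm(1)[OF C0, of u] g]] by simp
  moreover have "cinner (j_coeff C0 u \<alpha>) (g \<alpha>) / complex_of_real (hk_weight a \<alpha>)
      = a (Suc (mi_abs \<alpha>)) *\<^sub>R mi_gamma \<alpha> *\<^sub>R cinner (C (Tadj_pow \<alpha> u)) (C (Tadj_pow \<alpha> x))" for \<alpha>
  proof -
    \<comment> \<open>Only here is the square root exchanged for C: both have the same inner
      products of images.\<close>
    have "cinner (C0 (Tadj_pow \<alpha> u)) (C0 (Tadj_pow \<alpha> x)) = cinner (C (Tadj_pow \<alpha> u)) (C (Tadj_pow \<alpha> x))"
      using C C0 by (simp add: is_factor_def)
    then show ?thesis
      using hk_weight_pos[of \<alpha>] a_pos[of "mi_abs \<alpha>"]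
      by (simp add: g_def j_coeff_def cinner_scaleC_left cinner_scaleC_right scaleR_conv_of_real)
         (simp add: hk_weight_def)
  qed
  ultimately show ?thesis
    by (simp add: scaleR_sum_right)
qed

end

subsection \<open>Analyticity\<close>

context pure_contraction
begin

definition zT_pow :: "nat \<Rightarrow> complex ^ 'd \<Rightarrow> 'h \<Rightarrow>\<^sub>L 'h" where
  "zT_pow n z = Blinfun (zT z ^^ n)"

lemma zT_pow_apply [simp]: "blinfun_apply (zT_pow n z) = zT z ^^ n"
  unfolding zT_pow_def
  by (rule bounded_linear_Blinfun_apply[OF bounded_clinearD(1)[OF bounded_clinear_funpow[OF bounded_clinear_zT]]])

lemma zT_pow_0: "zT_pow 0 z = id_blinfun"
  by (rule blinfun_eqI) simp

lemma zT_pow_Suc: "zT_pow (Suc n) z = zT_pow 1 z o\<^sub>L zT_pow n z"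
  by (rule blinfun_eqI) simp

text \<open>Lets the product rule collect the derivative of a power into one term.\<close>

lemma zT_comm: "zT w (zT z x) = zT z (zT w x)"
proof -
  have lin: "Tadj i (\<Sum>j\<in>UNIV. (v $ j) *\<^sub>C Tadj j x) = (\<Sum>j\<in>UNIV. (v $ j) *\<^sub>C Tadj i (Tadj j x))" for i v
    by (simp add: linear_sum[OF bounded_linear.linear[OF bounded_clinearD(1)[OF bounded_clinear_Tadj]]]
        bounded_clinearD(2)[OF bounded_clinear_Tadj])
  have comm: "Tadj i (Tadj j x) = Tadj j (Tadj i x)" for i j
    using Tadj_comm[of i j] by (simp add: fun_eq_iff)
  have "zT w (zT z x) = (\<Sum>i\<in>UNIV. \<Sum>j\<in>UNIV. (w $ i * z $ j) *\<^sub>C Tadj i (Tadj j x))"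
    by (simp add: zT_eq lin scaleC.sum_right scaleC_scaleC)
  also have "\<dots> = (\<Sum>j\<in>UNIV. \<Sum>i\<in>UNIV. (w $ i * z $ j) *\<^sub>C Tadj i (Tadj j x))"
    by (rule sum.swap)
  also have "\<dots> = (\<Sum>j\<in>UNIV. \<Sum>i\<in>UNIV. (z $ j * w $ i) *\<^sub>C Tadj j (Tadj i x))"
    by (intro sum.cong refl) (metis comm mult.commute)
  also have "\<dots> = zT z (zT w x)"
    by (simp add: zT_eq lin scaleC.sum_right scaleC_scaleC)
  finally show ?thesis .
qed

lemma bounded_linear_zT_pow_1: "bounded_linear (zT_pow 1)"
proof -
  have "\<exists>K. \<forall>x. norm (Tadj i x) \<le> norm x * K" for i
    using bounded_linear.bounded[OF bounded_clinearD(1)[OF bounded_clinear_Tadj]] by blast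
  then obtain K where K: "\<And>i x. norm (Tadj i x) \<le> norm x * K i" by metis
  show ?thesis
  proof (rule bounded_linear_intro)
    show "zT_pow 1 (v + w) = zT_pow 1 v + zT_pow 1 w" for v w
      by (rule blinfun_eqI) (simp add: blinfun.add_left zT_eq scaleC_add_left sum.distrib)
    show "zT_pow 1 (s *\<^sub>R v) = s *\<^sub>R zT_pow 1 v" for s v
      by (rule blinfun_eqI) (simp add: blinfun.scaleR_left zT_eq scaleC.scaleR_left scaleR_sum_right)
    show "norm (zT_pow 1 v) \<le> norm v * (\<Sum>i\<in>UNIV. \<bar>K i\<bar>)" for v
    proof (rule norm_blinfun_bound)
      show "0 \<le> norm v * (\<Sum>i\<in>UNIV. \<bar>K i\<bar>)"
        by (intro mult_nonneg_nonneg sum_nonneg) auto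
      fix x
      have "norm ((v $ i) *\<^sub>C Tadj i x) \<le> norm v * (norm x * \<bar>K i\<bar>)" for i
        unfolding norm_scaleC
      proof (rule mult_mono)
        show "norm (Tadj i x) \<le> norm x * \<bar>K i\<bar>"
          using K[of i x] by (rule order_trans) (intro mult_left_mono; simp)
      qed (auto simp: Finite_Cartesian_Product.norm_nth_le)
      then have "norm (zT v x) \<le> (\<Sum>i\<in>UNIV. norm v * (norm x * \<bar>K i\<bar>))"
        unfolding zT_eq by (intro sum_norm_le)
      then show "norm (blinfun_apply (zT_pow 1 v) x) \<le> norm v * (\<Sum>i\<in>UNIV. \<bar>K i\<bar>) * norm x"
        by (simp add: sum_distrib_left[symmetric] ac_simps)
    qed
  qed
qed

text \<open>The scalar power rule survives because the operators at z and h commute. At n = 0 the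
  truncated exponent n - 1 is harmless, as the factor n vanishes.\<close>

lemma zT_pow_has_derivative:
  "(zT_pow n has_derivative (\<lambda>h. real n *\<^sub>R (zT_pow 1 h o\<^sub>L zT_pow (n - 1) z))) (at z within S)"
proof (induction n)
  case 0
  have "zT_pow 0 = (\<lambda>_. id_blinfun)" by (rule ext) (rule zT_pow_0)
  then show ?case by simp
next
  case (Suc n)
  have "zT_pow (Suc n) = (\<lambda>z. zT_pow 1 z o\<^sub>L zT_pow n z)"
    by (rule ext) (rule zT_pow_Suc)
  moreover have "((\<lambda>z. zT_pow 1 z o\<^sub>L zT_pow n z) has_derivative
      (\<lambda>h. (zT_pow 1 z o\<^sub>L (real n *\<^sub>R (zT_pow 1 h o\<^sub>L zT_pow (n - 1) z))) + (zT_pow 1 h o\<^sub>L zT_pow n z)))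
      (at z within S)"
    by (rule bounded_bilinear.FDERIV[OF bounded_bilinear_blinfun_compose
          bounded_linear.has_derivative[OF bounded_linear_zT_pow_1 has_derivative_ident] Suc])
  moreover have "(zT_pow 1 z o\<^sub>L (real n *\<^sub>R (zT_pow 1 h o\<^sub>L zT_pow (n - 1) z))) + (zT_pow 1 h o\<^sub>L zT_pow n z)
      = real (Suc n) *\<^sub>R (zT_pow 1 h o\<^sub>L zT_pow (Suc n - 1) z)" for h
  proof (rule blinfun_eqI)
    fix x
    have "zT z (real n *\<^sub>R zT h ((zT z ^^ (n - 1)) x)) = real n *\<^sub>R zT h ((zT z ^^ n) x)"
    proof (cases n)
      case 0
      then show ?thesis
        using linear_0[OF bounded_linear.linear[OF bounded_clinearD(1)[OF bounded_clinear_zT]]] by simp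
    next
      case (Suc k)
      then show ?thesis
        by (simp add: linear_scale[OF bounded_linear.linear[OF bounded_clinearD(1)[OF bounded_clinear_zT]]]
            zT_comm[of z h])
    qed
    then show "blinfun_apply ((zT_pow 1 z o\<^sub>L (real n *\<^sub>R (zT_pow 1 h o\<^sub>L zT_pow (n - 1) z))) + (zT_pow 1 h o\<^sub>L zT_pow n z)) x
        = blinfun_apply (real (Suc n) *\<^sub>R (zT_pow 1 h o\<^sub>L zT_pow (Suc n - 1) z)) x"
      by (simp add: blinfun.add_left blinfun.scaleR_left algebra_simps)
  qed
  ultimately show ?case by simp
qed

lemma norm_zT_pow_le:
  assumes "\<And>k. a k \<le> s * a (k + n)" "s \<ge> 0" "norm z \<le> R"
  shows "norm (zT_pow n z) \<le> R ^ n * sqrt s"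
proof (rule norm_blinfun_bound)
  show "0 \<le> R ^ n * sqrt s"
    using assms(2) order_trans[OF norm_ge_zero assms(3)] by simp
  fix x
  have "norm ((zT z ^^ n) x) \<le> norm z ^ n * sqrt s * norm x"
    by (rule norm_zT_funpow_le[OF assms(1)])
  also have "\<dots> \<le> R ^ n * sqrt s * norm x"
    using assms(2,3) by (intro mult_right_mono power_mono) auto
  finally show "norm (blinfun_apply (zT_pow n z) x) \<le> R ^ n * sqrt s * norm x" by simp
qed

text \<open>Differentiation term by term on a smaller ball, where \<open>coefficient_growth\<close>
  majorizes the terms and their derivatives uniformly. Complex homogeneity of the derivative passes
  from the terms to the sum.\<close>

lemma zT_series_has_derivative:
  assumes r: "(\<lambda>n. a n / a (Suc n)) \<longlonglongrightarrow> r" and R: "0 < R" "R < 1"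
  obtains G G' where "\<And>z. z \<in> ball 0 R \<Longrightarrow> (\<lambda>n. a (Suc n) *\<^sub>R zT_pow n z) sums G z"
    "\<And>z. z \<in> ball 0 R \<Longrightarrow> (G has_derivative G' z) (at z)"
    "\<And>z u v x. z \<in> ball 0 R \<Longrightarrow> blinfun_apply (G' z (u *\<^sub>C v)) x = u *\<^sub>C blinfun_apply (G' z v) x"
proof -
  obtain s where s: "\<And>n. s n \<ge> 0" "\<And>k n. a k \<le> s n * a (k + n)"
    and sm: "summable (\<lambda>n. real (Suc n) * a (Suc n) * R ^ n * sqrt (s n))"
    using coefficient_growth[OF r R] by blast
  have PR: "norm (zT_pow n z) \<le> R ^ n * sqrt (s n)" if "z \<in> ball 0 R" for n z
    using that by (intro norm_zT_pow_le s) auto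
  obtain K where K: "K > 0" "\<And>h. norm (zT_pow 1 h) \<le> norm h * K"
    using bounded_linear.pos_bounded[OF bounded_linear_zT_pow_1] by blast
  have sm1: "summable (\<lambda>n. norm (a (Suc n) *\<^sub>R zT_pow n z))" if z: "z \<in> ball 0 R" for z
  proof (rule summable_comparison_test'[OF sm, of 0])
    fix n
    have "a (Suc n) * norm (zT_pow n z) \<le> a (Suc n) * (R ^ n * sqrt (s n))"
      using a_pos[of "Suc n"] by (intro mult_left_mono PR z) auto
    also have "\<dots> \<le> real (Suc n) * (a (Suc n) * (R ^ n * sqrt (s n)))"
      using a_pos[of "Suc n"] R s(1)[of n] mult_right_mono[of 1 "real (Suc n)"] by simp
    finally show "norm (norm (a (Suc n) *\<^sub>R zT_pow n z)) \<le> real (Suc n) * a (Suc n) * R ^ n * sqrt (s n)"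
      using a_pos[of "Suc n"] by (simp add: mult.assoc)
  qed
  define f' where "f' n z h = a (Suc n) *\<^sub>R real n *\<^sub>R (zT_pow 1 h o\<^sub>L zT_pow (n - 1) z)" for n z h
  \<comment> \<open>The derivative of term n involves a_(n+1) and the power n - 1. By a_(n+1) <= a_n
    / m it is majorized by the summable sequence of \<open>coefficient_growth\<close> at index n -
    1; term 0 is constant.\<close>
  define b where "b n = (if n = 0 then 0 else (K / m) * (real n * a n * R ^ (n - 1) * sqrt (s (n - 1))))" for n
  have b: "summable b"
    using summable_mult[OF sm, of "K / m"] unfolding b_def by (subst summable_Suc_iff[symmetric]) simp
  have f'_le: "norm (f' n z h) \<le> b n * norm h" if z: "z \<in> ball 0 R" for n z h
  proof (cases n)
    case 0 then show ?thesis by (simp add: f'_def b_def)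
  next
    case (Suc k)
    have "norm (f' n z h) \<le> a (Suc n) * (real n * (norm (zT_pow 1 h) * norm (zT_pow k z)))"
      unfolding f'_def using a_pos[of "Suc n"] norm_blinfun_compose[of "zT_pow 1 h" "zT_pow k z"]
      by (auto simp: Suc intro!: mult_left_mono)
    also have "\<dots> \<le> (a n / m) * (real n * ((norm h * K) * (R ^ k * sqrt (s k))))"
      using a_ratio_lower[of n] a_pos[of n] m_pos K(1)
      by (intro mult_mono PR z K(2) mult_nonneg_nonneg) (auto simp: field_simps)
    also have "\<dots> = b n * norm h"
      by (simp add: b_def Suc)
    finally show ?thesis .
  qed
  have sf': "summable (\<lambda>n. norm (f' n z h))" if "z \<in> ball 0 R" for z h
    by (rule summable_comparison_test'[OF summable_mult2[OF b, of "norm h"], of 0])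
       (simp add: f'_le[OF that])
  define G' where "G' z h = (\<Sum>n. f' n z h)" for z h
  have "\<exists>G. \<forall>z\<in>ball 0 R. (\<lambda>n. a (Suc n) *\<^sub>R zT_pow n z) sums G z \<and> (G has_derivative G' z) (at z within ball 0 R)"
  proof (rule has_derivative_series)
    show "convex (ball (0 :: complex ^ 'd) R)" by (rule convex_ball)
    show "((\<lambda>z. a (Suc n) *\<^sub>R zT_pow n z) has_derivative f' n z) (at z within ball 0 R)" for n z
      unfolding f'_def by (rule has_derivative_scaleR_right[OF zT_pow_has_derivative])
    show "0 \<in> ball (0 :: complex ^ 'd) R" using R by simp
    then show "(\<lambda>n. a (Suc n) *\<^sub>R zT_pow n 0) sums (\<Sum>n. a (Suc n) *\<^sub>R zT_pow n 0)"
      by (intro summable_sums summable_norm_cancel[OF sm1])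
    fix e :: real assume "e > 0"
    then obtain N where N: "\<And>n. n \<ge> N \<Longrightarrow> norm (\<Sum>i. b (i + n)) < e"
      using suminf_exist_split[OF _ b] by blast
    show "\<forall>\<^sub>F n in sequentially. \<forall>z\<in>ball 0 R. \<forall>h. norm ((\<Sum>i<n. f' i z h) - G' z h) \<le> e * norm h"
      unfolding eventually_sequentially
    proof (intro exI allI impI ballI)
      fix n h and z :: "complex ^ 'd" assume n: "N \<le> n" and z: "z \<in> ball 0 R"
      have sfn: "summable (\<lambda>i. norm (f' (i + n) z h))"
        by (rule summable_ignore_initial_segment[OF sf'[OF z]])
      have "(\<Sum>i<n. f' i z h) - G' z h = - (\<Sum>i. f' (i + n) z h)"
        unfolding G'_def suminf_split_initial_segment[OF summable_norm_cancel[OF sf'[OF z]], of h n] by simp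
      then have "norm ((\<Sum>i<n. f' i z h) - G' z h) = norm (\<Sum>i. f' (i + n) z h)"
        by simp
      also have "\<dots> \<le> (\<Sum>i. norm (f' (i + n) z h))"
        by (rule summable_norm[OF sfn])
      also have "\<dots> \<le> (\<Sum>i. b (i + n) * norm h)"
        by (rule suminf_le[OF f'_le[OF z] sfn summable_mult2[OF summable_ignore_initial_segment[OF b]]])
      also have "\<dots> = (\<Sum>i. b (i + n)) * norm h"
        by (rule suminf_mult2[OF summable_ignore_initial_segment[OF b], symmetric])
      also have "\<dots> \<le> e * norm h"
        using N[OF n] by (intro mult_right_mono) auto
      finally show "norm ((\<Sum>i<n. f' i z h) - G' z h) \<le> e * norm h" .
    qed
  qed
  then obtain G where G: "\<And>z. z \<in> ball 0 R \<Longrightarrow> (\<lambda>n. a (Suc n) *\<^sub>R zT_pow n z) sums G z"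
    "\<And>z. z \<in> ball 0 R \<Longrightarrow> (G has_derivative G' z) (at z within ball 0 R)" by blast
  have "(G has_derivative G' z) (at z)" if "z \<in> ball 0 R" for z
    using G(2)[OF that] unfolding at_within_open[OF that open_ball] .
  moreover have "blinfun_apply (G' z (u *\<^sub>C v)) x = u *\<^sub>C blinfun_apply (G' z v) x" if z: "z \<in> ball 0 R" for z u v x
  proof -
    have f'u: "blinfun_apply (f' n z (u *\<^sub>C v)) x = u *\<^sub>C blinfun_apply (f' n z v) x" for n
      by (simp add: f'_def blinfun.scaleR_left zT_eq scaleC_vec_def scaleC_complex_def scaleC_scaleC[symmetric]
          scaleC.sum_right scaleC.scaleR_right)
    have sums: "(\<lambda>n. blinfun_apply (f' n z h) x) sums blinfun_apply (G' z h) x" for h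
      unfolding G'_def
      by (rule bounded_linear.sums[OF blinfun.bounded_linear_left summable_sums[OF summable_norm_cancel[OF sf'[OF z]]]])
    show ?thesis
      using sums[of "u *\<^sub>C v"] bounded_linear.sums[OF scaleC.bounded_linear_right sums[of v], of u]
      unfolding f'u by (rule sums_unique2)
  qed
  ultimately show ?thesis using that G(1) by blast
qed

lemma op_series_zT:
  assumes "(\<lambda>n. a (Suc n) *\<^sub>R zT_pow n z) sums L"
  shows "op_series (\<lambda>n. a (Suc n)) (zT z) = blinfun_apply L"
  using assms by (simp add: op_series_def zT_pow_def[symmetric] sums_iff)

lemma op_series_zT_sums:
  assumes r: "(\<lambda>n. a n / a (Suc n)) \<longlonglongrightarrow> r" and z: "z \<in> ball 0 1"
  shows "(\<lambda>n. a (Suc n) *\<^sub>R (zT z ^^ n) x) sums op_series (\<lambda>n. a (Suc n)) (zT z) x"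
proof -
  define R where "R = (1 + norm z) / 2"
  have R: "0 < R" "R < 1" "z \<in> ball 0 R"
      using z norm_ge_zero[of z] by (simp_all add: R_def add_pos_nonneg)
  obtain L where L: "(\<lambda>n. a (Suc n) *\<^sub>R zT_pow n z) sums L"
    using zT_series_has_derivative[OF r R(1,2)] R(3) by metis
  have "(\<lambda>n. blinfun_apply (a (Suc n) *\<^sub>R zT_pow n z) x) sums blinfun_apply L x"
    by (rule bounded_linear.sums[OF blinfun.bounded_linear_left L])
  then show ?thesis by (simp add: op_series_zT[OF L] blinfun.scaleR_left)
qed

text \<open>As an operator, W z = D + C G(z) Q(z), where G is the series for F and Q(z) = ZB is
  linear in z, so the product rule for composition applies.\<close>

lemma transfer_function_analytic:
  fixes B :: "'f::complex_hilbert \<Rightarrow> 'h ^ 'd" and C :: "'h \<Rightarrow> 'e::complex_hilbert" and D :: "'f \<Rightarrow> 'e"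
  assumes r: "(\<lambda>n. a n / a (Suc n)) \<longlonglongrightarrow> r"
    and B: "bounded_clinear B" and C: "bounded_clinear C" and D: "bounded_clinear D"
    and W: "\<And>z y. z \<in> ball 0 1 \<Longrightarrow> W z y = D y + C (op_series (\<lambda>n. a (Suc n)) (zT z) (row_Z z (B y)))"
  shows "op_analytic_on_ball W"
proof -
  note bB = bounded_clinearD(1)[OF B] and bC = bounded_clinearD(1)[OF C] and bD = bounded_clinearD(1)[OF D]
  define Q where "Q z = Blinfun (\<lambda>y. row_Z z (B y))" for z
  have cQ: "bounded_clinear (\<lambda>y. row_Z z (B y))" for z
    unfolding row_Z_def
    by (intro bounded_clinear_sum bounded_clinear_scaleC bounded_clinear_compose[OF bounded_clinear_vec_nth B])
  have Q_apply: "blinfun_apply (Q z) y = row_Z z (B y)" for z y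
    unfolding Q_def by (subst bounded_linear_Blinfun_apply) (simp_all add: bounded_clinearD(1)[OF cQ])
  obtain K where K: "K > 0" "\<And>y. norm (B y) \<le> norm y * K"
    using bounded_linear.pos_bounded[OF bB] by blast
  have bQ: "bounded_linear Q"
  proof (rule bounded_linear_intro)
    show "Q (v + w) = Q v + Q w" for v w
      by (rule blinfun_eqI) (simp add: blinfun.add_left Q_apply row_Z_def scaleC_add_left sum.distrib)
    show "Q (s *\<^sub>R v) = s *\<^sub>R Q v" for s v
      by (rule blinfun_eqI) (simp add: blinfun.scaleR_left Q_apply row_Z_def scaleC.scaleR_left scaleR_sum_right)
    show "norm (Q v) \<le> norm v * (real CARD('d) * K)" for v
    proof (rule norm_blinfun_bound)
      show "0 \<le> norm v * (real CARD('d) * K)" using K by simp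
      fix y
      have "norm ((v $ i) *\<^sub>C (B y $ i)) \<le> norm v * (norm y * K)" for i
        unfolding norm_scaleC
        by (intro mult_mono order_trans[OF Finite_Cartesian_Product.norm_nth_le K(2)]) (auto simp: Finite_Cartesian_Product.norm_nth_le)
      then have "norm (row_Z v (B y)) \<le> (\<Sum>i\<in>(UNIV::'d set). norm v * (norm y * K))"
        unfolding row_Z_def by (intro sum_norm_le)
      then show "norm (blinfun_apply (Q v) y) \<le> norm v * (real CARD('d) * K) * norm y"
        by (simp add: Q_apply ac_simps)
    qed
  qed
  have Q_scale: "blinfun_apply (Q (u *\<^sub>C v)) y = u *\<^sub>C blinfun_apply (Q v) y" for u v y
    by (simp add: Q_apply row_Z_def scaleC_vec_def scaleC_complex_def scaleC_scaleC[symmetric] scaleC.sum_right)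
  have clin: "bounded_clinear (W z)" and deriv: "\<exists>W'. ((\<lambda>z. Blinfun (W z)) has_derivative W') (at z) \<and>
      (\<forall>u v x. blinfun_apply (W' (u *\<^sub>C v)) x = u *\<^sub>C blinfun_apply (W' v) x)" if z: "z \<in> ball 0 1" for z
  proof -
    define R where "R = (1 + norm z) / 2"
    have R: "0 < R" "R < 1" "z \<in> ball 0 R"
      using z norm_ge_zero[of z] by (simp_all add: R_def add_pos_nonneg)
    obtain G G' where G: "\<And>z. z \<in> ball 0 R \<Longrightarrow> (\<lambda>n. a (Suc n) *\<^sub>R zT_pow n z) sums G z"
      "\<And>z. z \<in> ball 0 R \<Longrightarrow> (G has_derivative G' z) (at z)"
      "\<And>z u v x. z \<in> ball 0 R \<Longrightarrow> blinfun_apply (G' z (u *\<^sub>C v)) x = u *\<^sub>C blinfun_apply (G' z v) x"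
      using zT_series_has_derivative[OF r R(1,2)] by blast
    have G_scale: "blinfun_apply (G z) (u *\<^sub>C x) = u *\<^sub>C blinfun_apply (G z) x" for u x
    proof -
      have sums: "(\<lambda>n. blinfun_apply (a (Suc n) *\<^sub>R zT_pow n z) x) sums blinfun_apply (G z) x" for x
        by (rule bounded_linear.sums[OF blinfun.bounded_linear_left G(1)[OF R(3)]])
      have term_scale: "blinfun_apply (a (Suc n) *\<^sub>R zT_pow n z) (u *\<^sub>C x) = u *\<^sub>C blinfun_apply (a (Suc n) *\<^sub>R zT_pow n z) x" for n
        by (simp add: blinfun.scaleR_left bounded_clinearD(2)[OF bounded_clinear_funpow[OF bounded_clinear_zT]]
            scaleC.scaleR_right)
      show ?thesis
        using sums[of "u *\<^sub>C x"] bounded_linear.sums[OF scaleC.bounded_linear_right sums[of x], of u]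
        unfolding term_scale by (rule sums_unique2)
    qed
    define V where "V w = Blinfun D + (Blinfun C o\<^sub>L (G w o\<^sub>L Q w))" for w
    have WV: "W w = blinfun_apply (V w)" if "w \<in> ball 0 R" for w
    proof
      fix y
      have "w \<in> ball 0 1" using that R by auto
      then show "W w y = blinfun_apply (V w) y"
        using W[of w y] op_series_zT[OF G(1)[OF that]]
        by (simp add: V_def blinfun.add_left Q_apply bounded_linear_Blinfun_apply bC bD)
    qed
    show "bounded_clinear (W z)"
      unfolding bounded_clinear_def WV[OF R(3)]
      by (auto simp: blinfun.bounded_linear_right V_def blinfun.add_left bounded_linear_Blinfun_apply bC bD
          bounded_clinearD(2)[OF C] bounded_clinearD(2)[OF D] Q_apply bounded_clinearD(2)[OF cQ] G_scale
          scaleC_add_right)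
    define V' where "V' h = Blinfun C o\<^sub>L ((G z o\<^sub>L Q h) + (G' z h o\<^sub>L Q z))" for h
    have "((\<lambda>w. G w o\<^sub>L Q w) has_derivative (\<lambda>h. (G z o\<^sub>L Q h) + (G' z h o\<^sub>L Q z))) (at z)"
      by (rule bounded_bilinear.FDERIV[OF bounded_bilinear_blinfun_compose G(2)[OF R(3)]
            bounded_linear.has_derivative[OF bQ has_derivative_ident]])
    then have "((\<lambda>w. Blinfun C o\<^sub>L (G w o\<^sub>L Q w)) has_derivative V') (at z)"
      unfolding V'_def
      by (rule bounded_linear.has_derivative[OF bounded_bilinear.bounded_linear_right[OF bounded_bilinear_blinfun_compose]])
    then have "(V has_derivative V') (at z)"
      unfolding V_def[abs_def] by (auto intro: derivative_eq_intros)
    \<comment> \<open>W and V agree only on the ball of radius R; being open around z, it determines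
      the derivative.\<close>
    then have "((\<lambda>w. Blinfun (W w)) has_derivative V') (at z)"
      by (rule has_derivative_transform_within_open[OF _ open_ball R(3)]) (simp add: WV blinfun_apply_inverse)
    moreover have "blinfun_apply (V' (u *\<^sub>C v)) x = u *\<^sub>C blinfun_apply (V' v) x" for u v x
      by (simp add: V'_def blinfun.add_left bounded_linear_Blinfun_apply bC Q_scale G_scale G(3)[OF R(3)]
          scaleC_add_right[symmetric] bounded_clinearD(2)[OF C])
    ultimately show "\<exists>W'. ((\<lambda>z. Blinfun (W z)) has_derivative W') (at z) \<and>
      (\<forall>u v x. blinfun_apply (W' (u *\<^sub>C v)) x = u *\<^sub>C blinfun_apply (W' v) x)" by blast
  qed
  then show ?thesis
    unfolding op_analytic_on_ball_def by blast
qed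

end

subsection \<open>The transfer function is K-inner\<close>

lemma mi_level_sum_Suc':
  fixes H :: "('d::finite \<Rightarrow> nat) \<Rightarrow> 'v::real_vector"
  shows "(\<Sum>\<alpha> | mi_abs \<alpha> = Suc n. H \<alpha>)
    = (\<Sum>i\<in>UNIV. \<Sum>\<alpha> | mi_abs \<alpha> = n. (mi_gamma \<alpha> / mi_gamma (mi_Suc i \<alpha>)) *\<^sub>R H (mi_Suc i \<alpha>))"
proof -
  have "mi_gamma \<alpha> *\<^sub>R (1 / mi_gamma \<alpha>) *\<^sub>R H \<alpha> = H \<alpha>" for \<alpha>
    using mi_gamma_pos[of \<alpha>] by simp
  then show ?thesis
    using mi_level_sum_Suc[of "\<lambda>\<alpha>. (1 / mi_gamma \<alpha>) *\<^sub>R H \<alpha>" n] by simp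
qed

context pure_contraction
begin

lemma is_factorI:
  assumes "bounded_clinear C" "cadjoint C \<circ> C = inv_K c T"
  shows "is_factor C"
  unfolding is_factor_def
proof (intro conjI allI assms(1))
  fix x y
  have "cadjoint C (C x) = inv_K c T x"
    using assms(2) by (simp add: fun_eq_iff)
  then show "cinner (C x) (C y) = cinner (inv_K c T x) y"
    using cinner_cadjoint_left[OF assms(1), of "C x" y] by simp
qed

text \<open>The common core of the isometry and orthogonality computations: f stands for the
  coefficients of W y, while v is chosen according to the element paired with it.\<close>

lemma level_sums_Delta_T:
  assumes C: "is_factor C"
    and f: "\<And>i \<alpha>. f (mi_Suc i \<alpha>) = complex_of_real (hk_weight a (mi_Suc i \<alpha>)) *\<^sub>C C (Tadj_pow \<alpha> (b $ i))"
    and v: "\<And>i \<alpha>. v (mi_Suc i \<alpha>) = C (Tadj_pow \<alpha> (k $ i))"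
    and sum: "((\<lambda>\<beta>. cinner (f \<beta>) (v \<beta>)) has_sum s) UNIV"
  shows "s = cinner (f (\<lambda>_. 0)) (v (\<lambda>_. 0)) + (\<Sum>i\<in>UNIV. cinner (b $ i) (Delta_T a c T (k $ i)))"
proof -
  have "(\<lambda>n. \<Sum>\<alpha> | mi_abs \<alpha> = Suc n. cinner (f \<alpha>) (v \<alpha>)) sums (s - cinner (f (\<lambda>_. 0)) (v (\<lambda>_. 0)))"
    using sums_split_initial_segment[OF mi_level_has_sum[OF sum], of 1] by (simp add: mi_level_0)
  moreover have "(\<lambda>n. \<Sum>i\<in>UNIV. a (Suc n) *\<^sub>R (\<Sum>\<alpha> | mi_abs \<alpha> = n.
      mi_gamma \<alpha> *\<^sub>R cinner (C (Tadj_pow \<alpha> (b $ i))) (C (Tadj_pow \<alpha> (k $ i)))))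
      sums (\<Sum>i\<in>UNIV. cinner (b $ i) (Delta_T a c T (k $ i)))"
    by (intro sums_sum Delta_T_sums C)
  moreover have "(\<Sum>\<alpha> | mi_abs \<alpha> = Suc n. cinner (f \<alpha>) (v \<alpha>))
      = (\<Sum>i\<in>UNIV. a (Suc n) *\<^sub>R (\<Sum>\<alpha> | mi_abs \<alpha> = n.
      mi_gamma \<alpha> *\<^sub>R cinner (C (Tadj_pow \<alpha> (b $ i))) (C (Tadj_pow \<alpha> (k $ i)))))" for n
    \<comment> \<open>The weight a_(n+1) gamma_(alpha + e_i) contained in f cancels the denominator
      from Pascal's rule and leaves a_(n+1) gamma_alpha, the weight in
      \<open>Delta_T_sums\<close>.\<close>
    unfolding mi_level_sum_Suc' scaleR_sum_right
  proof (intro sum.cong refl)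
    fix i and \<alpha> :: "'d \<Rightarrow> nat" assume "\<alpha> \<in> {\<alpha>. mi_abs \<alpha> = n}"
    then show "(mi_gamma \<alpha> / mi_gamma (mi_Suc i \<alpha>)) *\<^sub>R cinner (f (mi_Suc i \<alpha>)) (v (mi_Suc i \<alpha>))
        = a (Suc n) *\<^sub>R mi_gamma \<alpha> *\<^sub>R cinner (C (Tadj_pow \<alpha> (b $ i))) (C (Tadj_pow \<alpha> (k $ i)))"
      using mi_gamma_pos[of "mi_Suc i \<alpha>"]
      by (simp add: f v cinner_scaleC_left hk_weight_def scaleR_conv_of_real)
  qed
  ultimately have "s - cinner (f (\<lambda>_. 0)) (v (\<lambda>_. 0)) = (\<Sum>i\<in>UNIV. cinner (b $ i) (Delta_T a c T (k $ i)))"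
    by (simp add: sums_iff)
  then show ?thesis by (simp add: algebra_simps)
qed

text \<open>(K4) provides a square summable family with the right nonconstant coefficients. The
  value e at 0 is arbitrary, since M_z* does not see it.\<close>

lemma transfer_coefficients:
  fixes B :: "'f::complex_hilbert \<Rightarrow> 'h ^ 'd" and C :: "'h \<Rightarrow> 'e::complex_hilbert"
  assumes C: "is_factor C"
    and K4: "range (direct_sum_op (j_map a T C) \<circ> B) \<subseteq> Mz_col_adj a ` HK a"
  obtains f where "f \<in> hk_coeffs a"
    "\<And>i \<alpha>. f (mi_Suc i \<alpha>) = complex_of_real (hk_weight a (mi_Suc i \<alpha>)) *\<^sub>C C (Tadj_pow \<alpha> (B y $ i))"
    "f (\<lambda>_. 0) = e"
proof -
  have "direct_sum_op (j_map a T C) (B y) \<in> Mz_col_adj a ` HK a"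
    using K4 by (auto simp: image_subset_iff)
  then obtain F where F: "F \<in> HK a" "direct_sum_op (j_map a T C) (B y) = Mz_col_adj a F"
    by blast
  obtain f where f: "f \<in> hk_coeffs a" "F = power_series_fun f" using HK_E[OF F(1)] by blast
  have f_Suc: "f (mi_Suc i \<alpha>) = complex_of_real (hk_weight a (mi_Suc i \<alpha>)) *\<^sub>C C (Tadj_pow \<alpha> (B y $ i))" for i \<alpha>
  proof -
    have "j_map a T C (B y $ i) = adj_on (HK a) (hk_inner a) (hk_inner a) (Mz i) F"
      using arg_cong[OF F(2), of "\<lambda>v. v $ i"] by (simp add: direct_sum_op_def Mz_col_adj_def)
    then have "power_series_fun (j_coeff C (B y $ i)) = power_series_fun
        (\<lambda>\<alpha>. complex_of_real (hk_weight a \<alpha> / hk_weight a (mi_Suc i \<alpha>)) *\<^sub>C f (mi_Suc i \<alpha>))"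
      by (simp add: j_map_eq f(2) Mz_adjoint[OF f(1)])
    then have "j_coeff C (B y $ i) =
        (\<lambda>\<alpha>. complex_of_real (hk_weight a \<alpha> / hk_weight a (mi_Suc i \<alpha>)) *\<^sub>C f (mi_Suc i \<alpha>))"
      by (rule power_series_fun_inj[OF j_coeff_norm(1)[OF C] Mz_adjoint_coeffs[OF f(1)]])
    then have "complex_of_real (hk_weight a \<alpha>) *\<^sub>C C (Tadj_pow \<alpha> (B y $ i))
        = complex_of_real (hk_weight a \<alpha> / hk_weight a (mi_Suc i \<alpha>)) *\<^sub>C f (mi_Suc i \<alpha>)"
      by (simp add: fun_eq_iff j_coeff_def)
    from arg_cong[OF this, of "\<lambda>x. complex_of_real (hk_weight a (mi_Suc i \<alpha>) / hk_weight a \<alpha>) *\<^sub>C x"]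
    show ?thesis
      using hk_weight_pos[of \<alpha>] hk_weight_pos[of "mi_Suc i \<alpha>"] by (simp add: scaleC_scaleC)
  qed
  \<comment> \<open>Changing one coefficient keeps the family square summable: its terms are
    dominated by those of f plus those of a constant.\<close>
  define g where "g = f((\<lambda>_. 0) := e)"
  have "(\<lambda>\<alpha>. (norm (f \<alpha>))\<^sup>2 / hk_weight a \<alpha> + (norm (if \<alpha> = (\<lambda>_. 0) then e else 0))\<^sup>2 / hk_weight a \<alpha>) summable_on UNIV"
    by (intro summable_on_add hk_coeffs_summable f single_in_hk_coeffs)
  then have "(\<lambda>\<alpha>. (norm (g \<alpha>))\<^sup>2 / hk_weight a \<alpha>) summable_on UNIV"
    by (rule summable_on_comparison_test)
       (auto simp: g_def less_imp_le[OF hk_weight_pos])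
  then have "g \<in> hk_coeffs a" by (simp add: hk_coeffs_def)
  moreover have "g (mi_Suc i \<alpha>) = f (mi_Suc i \<alpha>)" for i \<alpha>
    by (simp add: g_def mi_Suc_neq_0)
  ultimately show ?thesis
    using that[of g] f_Suc by (simp add: g_def)
qed

text \<open>The factor Z raises the degree by one, so term n of the operator series is matched with
  the homogeneous part of degree n + 1.\<close>

lemma transfer_function_eq_power_series:
  assumes r: "(\<lambda>n. a n / a (Suc n)) \<longlonglongrightarrow> r" and C: "bounded_clinear C"
    and f: "f \<in> hk_coeffs a"
    and f_Suc: "\<And>i \<alpha>. f (mi_Suc i \<alpha>) = complex_of_real (hk_weight a (mi_Suc i \<alpha>)) *\<^sub>C C (Tadj_pow \<alpha> (b $ i))"
    and z: "z \<in> ball 0 1"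
  shows "power_series_fun f z = f (\<lambda>_. 0) + C (op_series (\<lambda>n. a (Suc n)) (zT z) (row_Z z b))"
proof -
  have linC: "linear C" using bounded_clinearD(1)[OF C] by (rule bounded_linear.linear)
  have "(\<lambda>n. \<Sum>\<alpha> | mi_abs \<alpha> = Suc n. mi_monom z \<alpha> *\<^sub>C f \<alpha>) sums (power_series_fun f z - f (\<lambda>_. 0))"
    using sums_split_initial_segment[OF mi_level_has_sum[OF power_series_fun_has_sum[OF f z]], of 1]
    by (simp add: mi_level_0)
  moreover have "(\<lambda>n. C (a (Suc n) *\<^sub>R (zT z ^^ n) (row_Z z b))) sums
      C (op_series (\<lambda>n. a (Suc n)) (zT z) (row_Z z b))"
    by (rule bounded_linear.sums[OF bounded_clinearD(1)[OF C] op_series_zT_sums[OF r z]])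
  moreover have "(\<Sum>\<alpha> | mi_abs \<alpha> = Suc n. mi_monom z \<alpha> *\<^sub>C f \<alpha>) = C (a (Suc n) *\<^sub>R (zT z ^^ n) (row_Z z b))" for n
  proof -
    have "Tadj_pow \<alpha> (row_Z z b) = (\<Sum>i\<in>UNIV. (z $ i) *\<^sub>C Tadj_pow \<alpha> (b $ i))" for \<alpha>
      by (simp add: row_Z_def linear_sum[OF bounded_linear.linear[OF bounded_clinearD(1)[OF bounded_clinear_Tadj_pow]]]
          bounded_clinearD(2)[OF bounded_clinear_Tadj_pow])
    then have "C (a (Suc n) *\<^sub>R (zT z ^^ n) (row_Z z b)) = (\<Sum>\<alpha> | mi_abs \<alpha> = n. \<Sum>i\<in>UNIV.
        (a (Suc n) * mi_gamma \<alpha>) *\<^sub>R mi_monom z (mi_Suc i \<alpha>) *\<^sub>C C (Tadj_pow \<alpha> (b $ i)))"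
      by (simp add: zT_funpow linear_scale[OF linC] linear_sum[OF linC] bounded_clinearD(2)[OF C]
          scaleR_sum_right scaleC.sum_right scaleC_scaleC mi_monom_Suc mult.commute)
    also have "\<dots> = (\<Sum>i\<in>UNIV. \<Sum>\<alpha> | mi_abs \<alpha> = n.
        (a (Suc n) * mi_gamma \<alpha>) *\<^sub>R mi_monom z (mi_Suc i \<alpha>) *\<^sub>C C (Tadj_pow \<alpha> (b $ i)))"
      by (rule sum.swap)
    also have "\<dots> = (\<Sum>\<alpha> | mi_abs \<alpha> = Suc n. mi_monom z \<alpha> *\<^sub>C f \<alpha>)"
      unfolding mi_level_sum_Suc'
    proof (intro sum.cong refl)
      fix i and \<alpha> :: "'d \<Rightarrow> nat" assume "\<alpha> \<in> {\<alpha>. mi_abs \<alpha> = n}"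
      then show "(a (Suc n) * mi_gamma \<alpha>) *\<^sub>R mi_monom z (mi_Suc i \<alpha>) *\<^sub>C C (Tadj_pow \<alpha> (b $ i))
          = (mi_gamma \<alpha> / mi_gamma (mi_Suc i \<alpha>)) *\<^sub>R mi_monom z (mi_Suc i \<alpha>) *\<^sub>C f (mi_Suc i \<alpha>)"
        using mi_gamma_pos[of "mi_Suc i \<alpha>"]
        by (simp add: f_Suc hk_weight_def scaleR_eq_scaleC scaleC_scaleC ac_simps)
    qed
    finally show ?thesis ..
  qed
  ultimately have "power_series_fun f z - f (\<lambda>_. 0) = C (op_series (\<lambda>n. a (Suc n)) (zT z) (row_Z z b))"
    by (simp add: sums_iff)
  then show ?thesis by (simp add: algebra_simps)
qed

lemma transfer_function_K_inner:
  fixes B :: "'f::complex_hilbert \<Rightarrow> 'h ^ 'd" and C :: "'h \<Rightarrow> 'e::complex_hilbert" and D :: "'f \<Rightarrow> 'e"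
  assumes a_0: "a 0 = 1" and r: "(\<lambda>n. a n / a (Suc n)) \<longlonglongrightarrow> r"
    and B: "bounded_clinear B" and C: "bounded_clinear C" and D: "bounded_clinear D"
    and K1: "cadjoint C \<circ> C = inv_K c T"
    and K2: "\<And>x. cadjoint D (C x) + cadjoint B (direct_sum_op (Delta_T a c T) (col_adj T x)) = 0"
    and K3: "\<And>y. cadjoint D (D y) + cadjoint B (direct_sum_op (Delta_T a c T) (B y)) = y"
    and K4: "range (direct_sum_op (j_map a T C) \<circ> B) \<subseteq> Mz_col_adj a ` HK a"
    and W: "\<And>z y. z \<in> ball 0 1 \<Longrightarrow> W z y = D y + C (op_series (\<lambda>n. a (Suc n)) (zT z) (row_Z z (B y)))"
  shows "K_inner a W"
proof -
  have fC: "is_factor C" by (rule is_factorI[OF C K1])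
  have "\<exists>f. f \<in> hk_coeffs a \<and> f (\<lambda>_. 0) = D y \<and>
      (\<forall>i \<alpha>. f (mi_Suc i \<alpha>) = complex_of_real (hk_weight a (mi_Suc i \<alpha>)) *\<^sub>C C (Tadj_pow \<alpha> (B y $ i)))" for y
    by (rule transfer_coefficients[OF fC K4, of y "D y"]) blast
  then obtain f where f: "\<And>y. f y \<in> hk_coeffs a" "\<And>y. f y (\<lambda>_. 0) = D y"
    "\<And>y i \<alpha>. f y (mi_Suc i \<alpha>) = complex_of_real (hk_weight a (mi_Suc i \<alpha>)) *\<^sub>C C (Tadj_pow \<alpha> (B y $ i))"
    by metis
  have ev: "on_ball (\<lambda>z. W z y) = power_series_fun (f y)" for y
  proof
    fix z :: "complex ^ 'd"
    show "on_ball (\<lambda>z. W z y) z = power_series_fun (f y) z"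
    proof (cases "z \<in> ball 0 1")
      case True
      then show ?thesis
        using transfer_function_eq_power_series[OF r C f(1) f(3) True] W[OF True]
        by (simp add: on_ball_def f(2))
    next
      case False
      then show ?thesis by (simp add: on_ball_def power_series_fun_def)
    qed
  qed
  \<comment> \<open>Moving B and D to the other side exhibits the left-hand sides of (K2) and
    (K3).\<close>
  have pairing: "s = cinner y (cadjoint D (v (\<lambda>_. 0)) + cadjoint B (direct_sum_op (Delta_T a c T) k))"
    if "\<And>i \<alpha>. v (mi_Suc i \<alpha>) = C (Tadj_pow \<alpha> (k $ i))"
      and "((\<lambda>\<beta>. cinner (f y \<beta>) (v \<beta>)) has_sum s) UNIV" for s y v k
  proof -
    have "cinner (B y) (direct_sum_op (Delta_T a c T) k) = (\<Sum>i\<in>UNIV. cinner (B y $ i) (Delta_T a c T (k $ i)))"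
      by (simp add: cinner_vec_def direct_sum_op_def)
    then show ?thesis
      using level_sums_Delta_T[OF fC f(3) that]
      by (simp add: f(2) cinner_add_right cinner_cadjoint[OF B, symmetric] cinner_cadjoint[OF D, symmetric])
  qed
  have inner: "hk_inner a (power_series_fun (f y)) (power_series_fun (f x)) = cinner y x" for x y
  proof -
    \<comment> \<open>Dividing by the weight turns the inner product of \<open>HK\<close> into the
      plain pairing; (K3) then applies with k = B x.\<close>
    define v where "v \<beta> = complex_of_real (1 / hk_weight a \<beta>) *\<^sub>C f x \<beta>" for \<beta>
    have "hk_weight a (\<lambda>_::'d. 0) = 1" by (simp add: hk_weight_def a_0)
    then have v0: "v (\<lambda>_. 0) = D x" by (simp add: v_def f(2))
    have vS: "v (mi_Suc i \<alpha>) = C (Tadj_pow \<alpha> (B x $ i))" for i \<alpha>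
      using hk_weight_pos[of "mi_Suc i \<alpha>"] by (simp add: v_def f(3) scaleC_scaleC)
    have "((\<lambda>\<beta>. cinner (f y \<beta>) (v \<beta>)) has_sum hk_inner a (power_series_fun (f y)) (power_series_fun (f x))) UNIV"
      using hk_inner_has_sum[OF f(1) f(1), of y x] by (simp add: v_def cinner_scaleC_right)
    from pairing[OF vS this] show ?thesis by (simp only: v0 K3)
  qed
  have orth: "hk_inner a (power_series_fun (f x)) (Mz_pow \<alpha> (power_series_fun (f y))) = 0"
    if \<alpha>: "\<alpha> \<noteq> (\<lambda>_. 0)" for \<alpha> x y
  proof -
    obtain i \<alpha>' where \<alpha>': "\<alpha> = mi_Suc i \<alpha>'" using mi_Suc_cases[OF \<alpha>] .
    \<comment> \<open>Splitting e_i off alpha leaves a vector h such that, up to the weight, the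
      coefficient of W x at beta + alpha is C T*^beta h. So W x, seen through z^alpha, is the pair
      (C h, T* h) of (K2).\<close>
    define h where "h = Tadj_pow \<alpha>' (B x $ i)"
    define v where "v \<beta> = C (Tadj_pow \<beta> h)" for \<beta>
    have shift: "(\<lambda>j. \<beta> j + \<alpha> j) = mi_Suc i (\<lambda>j. \<beta> j + \<alpha>' j)" for \<beta>
      by (auto simp: \<alpha>' mi_Suc_def)
    have fx: "f x (\<lambda>j. \<beta> j + \<alpha> j) = complex_of_real (hk_weight a (\<lambda>j. \<beta> j + \<alpha> j)) *\<^sub>C C (Tadj_pow \<beta> h)" for \<beta>
      unfolding shift by (simp add: f(3) Tadj_pow_add h_def)
    have "cinner (f y \<beta>) (f x (\<lambda>j. \<beta> j + \<alpha> j)) / complex_of_real (hk_weight a (\<lambda>j. \<beta> j + \<alpha> j))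
        = cinner (f y \<beta>) (C (Tadj_pow \<beta> h))" for \<beta>
      using hk_weight_pos[of "\<lambda>j. \<beta> j + \<alpha> j"] unfolding fx cinner_scaleC_right by simp
    then have sum: "((\<lambda>\<beta>. cinner (f y \<beta>) (v \<beta>)) has_sum
        hk_inner a (power_series_fun (mi_shift \<alpha> (f y))) (power_series_fun (f x))) UNIV"
      using hk_inner_mi_shift_has_sum[OF f(1) f(1), of y x \<alpha>] by (simp add: v_def)
    have "v (mi_Suc i \<beta>) = C (Tadj_pow \<beta> (col_adj T h $ i))" for i \<beta>
      by (simp add: v_def Tadj_pow_Suc col_adj_def)
    from pairing[OF this sum]
    have "hk_inner a (power_series_fun (mi_shift \<alpha> (f y))) (power_series_fun (f x)) = 0"
      by (simp add: v_def K2 cinner.zero_right)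
    then show ?thesis
      using hk_inner_commute[OF f(1) mi_shift_in_hk_coeffs[OF f(1)], of x \<alpha> y]
      by (simp add: Mz_pow_power_series_fun[OF f(1)])
  qed
  have "hk_norm a (power_series_fun (f x)) = norm x" for x
    by (simp add: hk_norm_eq[OF f(1)] inner cinner_self)
  moreover have "op_analytic_on_ball W"
    by (rule transfer_function_analytic[OF r B C D W])
  ultimately show ?thesis
    by (simp add: K_inner_def Let_def ev orth power_series_fun_in_HK[OF f(1)])
qed

end

theorem theorem3p1:
  fixes k :: "complex \<Rightarrow> complex" and a :: "nat \<Rightarrow> real" and c :: "nat \<Rightarrow> complex" and r :: real
    and T :: "'d::finite \<Rightarrow> 'h::complex_hilbert \<Rightarrow> 'h"
    and B :: "'f::complex_hilbert \<Rightarrow> 'h ^ 'd"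
    and C :: "'h \<Rightarrow> 'e::complex_hilbert"
    and D :: "'f \<Rightarrow> 'e"
    and W :: "complex ^ 'd \<Rightarrow> 'f \<Rightarrow> 'e"
  assumes k_series: "\<And>z. z \<in> ball 0 1 \<Longrightarrow> (\<lambda>n. complex_of_real (a n) * z ^ n) sums k z"
    and k_nonzero: "\<And>z. z \<in> ball 0 1 \<Longrightarrow> k z \<noteq> 0"
    and a_0: "a 0 = 1"
    and a_pos: "\<And>n. a n > 0"
    and ratio_inf: "0 < (INF n. a n / a (Suc n))"
    and ratio_sup: "bdd_above (range (\<lambda>n. a n / a (Suc n)))"
    and ratio_lim: "(\<lambda>n. a n / a (Suc n)) \<longlonglongrightarrow> r"
    and c_series: "\<And>z. z \<in> ball 0 1 \<Longrightarrow> (\<lambda>n. c n * z ^ n) sums (1 / k z)"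
    and T: "pure_K_contraction a c T"
    and B: "bounded_clinear B" and C: "bounded_clinear C" and D: "bounded_clinear D"
    and K1: "cadjoint C \<circ> C = inv_K c T"
    and K2: "\<And>x. cadjoint D (C x) + cadjoint B (direct_sum_op (Delta_T a c T) (col_adj T x)) = 0"
    and K3: "\<And>y. cadjoint D (D y) + cadjoint B (direct_sum_op (Delta_T a c T) (B y)) = y"
    and K4: "range (direct_sum_op (j_map a T C) \<circ> B) \<subseteq> Mz_col_adj a ` HK a"
    and W: "\<And>z y. z \<in> ball 0 1 \<Longrightarrow>
      W z y = D y + C (op_series (\<lambda>n. a (Suc n)) (row_Z z \<circ> col_adj T) (row_Z z (B y)))"
  shows "K_inner a W"
proof -
  define m where "m = (INF n. a n / a (Suc n))"
  obtain M where M: "\<And>n. a n / a (Suc n) \<le> M"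
    using ratio_sup unfolding bdd_above_def by blast
  have m: "m \<le> a n / a (Suc n)" for n
    unfolding m_def
  proof (rule cINF_lower)
    \<comment> \<open>Needed because \<open>INF\<close> of reals is a lower bound only for sets
      bounded below.\<close>
    show "bdd_below (range (\<lambda>n. a n / a (Suc n)))"
      by (rule bdd_belowI[of _ 0]) (auto intro: divide_nonneg_pos less_imp_le[OF a_pos] a_pos)
  qed simp
  interpret pure_contraction a m M c T
  proof
    show "0 < a n" for n by (rule a_pos)
    show "0 < m" using ratio_inf by (simp add: m_def)
    show "m * a (Suc n) \<le> a n" for n
      using m[of n] a_pos[of "Suc n"] by (simp add: pos_le_divide_eq)
    show "a n \<le> M * a (Suc n)" for n
      using M[of n] a_pos[of "Suc n"] by (simp add: pos_divide_le_eq)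
    \<comment> \<open>At a real point the terms of the series of k are real, so its real part is the
      real series.\<close>
    show "summable (\<lambda>n. a n * x ^ n)" if "0 \<le> x" "x < 1" for x
      using sums_Re[OF k_series[of "complex_of_real x"]] that
      by (simp add: sums_iff of_real_power[symmetric] of_real_mult[symmetric] del: of_real_power of_real_mult)
    show "pure_K_contraction a c T" by (rule T)
  qed
  show ?thesis
    by (rule transfer_function_K_inner[OF a_0 ratio_lim B C D K1 K2 K3 K4 W[folded zT_def]])
qed

end
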